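(* Let $d>0$ and let $V_0:\mathbb{R}\to\mathbb{R}$ be continuous, even and $d$-periodic. For $t\in[0,d]$ let $L=-\partial_x^2+V(x)$ with $V(x)=V_0(x-t)$ for $x<0$ and $V(x)=V_0(x+t)$ for $x\ge0$. Consider the semi-infinite gap $G_0=(-\infty,s_1)$. (a) If $V_0$ is strictly increasing on $[0,\frac d2]$, then there is no eigenvalue of $L$ in $G_0$ for $t\in[0,\frac d2]$, and exactly one eigenvalue of $L$ in $G_0$ for $t\in(\frac d2,d)$. (b) If $V_0$ is strictly decreasing on $[0,\frac d2]$, then there is exactly one eigenvalue of $L$ in $G_0$ for $t\in(0,\frac d2)$, and no eigenvalue of $L$ in $G_0$ for $t\in[\frac d2,d]$.
   Context: The operator $L$ (the symmetric dislocation problem) acts in $L^2(\mathbb{R})$ with domain $H^2(\mathbb{R})$; its eigenvalues are called dislocation eigenvalues. Here $s_1=\min\sigma(L_0)$, where $L_0=-\partial_x^2+V_0$ on $\mathbb{R}$. *)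

theory Defs
  imports "HOL-Analysis.Analysis"
begin

text \<open>Elements of the complex Hilbert space $L^2(\mathbf R)$ are represented by functions;
  equality in $L^2$ is equality almost everywhere and is spelled out wherever it matters.\<close>

definition L2 :: "(real \<Rightarrow> complex) set" where
  "L2 = {u. u \<in> borel_measurable lborel \<and> integrable lborel (\<lambda>x. (cmod (u x))\<^sup>2)}"

definition L2_norm :: "(real \<Rightarrow> complex) \<Rightarrow> real" where
  "L2_norm u = sqrt (LINT x|lborel. (cmod (u x))\<^sup>2)"

definition test_function :: "(real \<Rightarrow> real) \<Rightarrow> bool" where
  "test_function \<phi> \<longleftrightarrow>
     (\<forall>n. (deriv ^^ n) \<phi> differentiable_on UNIV) \<and> compact (closure {x. \<phi> x \<noteq> 0})"

definition is_weak_deriv :: "nat \<Rightarrow> (real \<Rightarrow> complex) \<Rightarrow> (real \<Rightarrow> complex) \<Rightarrow> bool" where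
  "is_weak_deriv n u v \<longleftrightarrow>
     (\<forall>\<phi>. test_function \<phi> \<longrightarrow>
        (LINT x|lborel. u x * complex_of_real ((deriv ^^ n) \<phi> x)) =
        (-1) ^ n * (LINT x|lborel. v x * complex_of_real (\<phi> x)))"

definition sobolev_H :: "nat \<Rightarrow> (real \<Rightarrow> complex) set" where
  "sobolev_H m = {u \<in> L2. \<forall>n\<le>m. \<exists>v\<in>L2. is_weak_deriv n u v}"

text \<open>A weak derivative is unique up to a null set; the choice below picks a representative.\<close>

definition weak_deriv :: "nat \<Rightarrow> (real \<Rightarrow> complex) \<Rightarrow> (real \<Rightarrow> complex)" where
  "weak_deriv n u = (SOME v. v \<in> L2 \<and> is_weak_deriv n u v)"

text \<open>A (possibly unbounded) operator in $L^2(\mathbf R)$ is given by its domain \<open>D\<close> and its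
  action \<open>T\<close>, of which only the values on \<open>D\<close> are relevant.\<close>

definition eigenvalue ::
  "(real \<Rightarrow> complex) set \<Rightarrow> ((real \<Rightarrow> complex) \<Rightarrow> (real \<Rightarrow> complex)) \<Rightarrow> complex \<Rightarrow> bool" where
  "eigenvalue D T z \<longleftrightarrow>
     (\<exists>u\<in>D. \<not> (AE x in lborel. u x = 0) \<and> (AE x in lborel. T u x = z * u x))"

definition resolvent_set ::
  "(real \<Rightarrow> complex) set \<Rightarrow> ((real \<Rightarrow> complex) \<Rightarrow> (real \<Rightarrow> complex)) \<Rightarrow> complex set" where
  "resolvent_set D T = {z.
     (\<forall>u\<in>D. (AE x in lborel. T u x - z * u x = 0) \<longrightarrow> (AE x in lborel. u x = 0)) \<and>
     (\<forall>f\<in>L2. \<exists>u\<in>D. AE x in lborel. T u x - z * u x = f x) \<and>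
     (\<exists>C. \<forall>u\<in>D. L2_norm u \<le> C * L2_norm (\<lambda>x. T u x - z * u x))}"

definition spectrum ::
  "(real \<Rightarrow> complex) set \<Rightarrow> ((real \<Rightarrow> complex) \<Rightarrow> (real \<Rightarrow> complex)) \<Rightarrow> complex set" where
  "spectrum D T = - resolvent_set D T"

definition schroedinger :: "(real \<Rightarrow> real) \<Rightarrow> (real \<Rightarrow> complex) \<Rightarrow> (real \<Rightarrow> complex)" where
  "schroedinger V u = (\<lambda>x. - weak_deriv 2 u x + complex_of_real (V x) * u x)"

text \<open>For bounded measurable real \<open>V\<close> the operator with domain $H^2(\mathbf R)$ is self-adjoint and bounded
  below, so its spectrum is a closed set of real numbers and has a minimum.\<close>

definition min_spectrum :: "(real \<Rightarrow> real) \<Rightarrow> real" where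
  "min_spectrum V =
     (LEAST E::real. complex_of_real E \<in> spectrum (sobolev_H 2) (schroedinger V))"

definition dislocated :: "(real \<Rightarrow> real) \<Rightarrow> real \<Rightarrow> real \<Rightarrow> real" where
  "dislocated V0 t x = (if x < 0 then V0 (x - t) else V0 (x + t))"

definition dislocation_eigenvalue :: "(real \<Rightarrow> real) \<Rightarrow> real \<Rightarrow> real \<Rightarrow> bool" where
  "dislocation_eigenvalue V0 t E \<longleftrightarrow>
     eigenvalue (sobolev_H 2) (schroedinger (dislocated V0 t)) (complex_of_real E)"

end

theory Submission
  imports Defs
begin

text \<open>Because \<open>V0\<close> is even, the dislocated potential is \<open>V0 (\<bar>x\<bar> + t)\<close>: it is continuous and even. An
  eigenfunction with eigenvalue \<open>E\<close> is therefore glued from a square-integrable solution of the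
  half-line equation \<open>\<psi>'' = (V0 - E) \<psi>\<close>, shifted by \<open>t\<close>, and its mirror image. Below the spectrum of the periodic
  operator this equation has, up to a factor, one decaying solution, the Floquet solution \<open>\<psi> E\<close>, and the
  gluing is possible exactly if \<open>\<psi> E t = 0\<close> (odd eigenfunctions) or \<open>\<psi>' E t = 0\<close> (even ones).

  Let \<open>p\<close> be the positive periodic solution at the bottom \<open>E0\<close> of the spectrum. For \<open>E < E0\<close> the function
  \<open>F = \<psi> \<psi>' - \<psi>\<^sup>2 p'/p\<close> is strictly increasing, and multiplied by \<open>\<rho>\<^sup>2 < 1\<close> after one period; so \<open>F < 0\<close> everywhere.
  Hence \<open>\<psi>\<close> has no zero, which excludes odd eigenfunctions, and \<open>\<psi>'/\<psi> < p'/p\<close>. If \<open>p' t \<le> 0\<close>, the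
  condition \<open>\<psi>' E t = 0\<close> can thus never hold. If \<open>p' t > 0\<close>, it holds for exactly one \<open>E\<close>: the logarithmic derivative of \<open>\<psi>\<close> at
  \<open>t\<close> is continuous and strictly increasing in \<open>E\<close>, it is not positive for very negative \<open>E\<close> by convexity, and
  it tends to \<open>p' t / p t\<close> as \<open>E\<close> tends to \<open>E0\<close>. Everything is reduced to the sign of \<open>p' t\<close>, and that sign can be read off
  from \<open>p'' = (V0 - E0) p\<close> and \<open>p' 0 = p' (d/2) = 0\<close>: if \<open>V0\<close> is monotone, then \<open>V0 - E0\<close> changes its sign only once on
  the half period.

  The existence of \<open>p\<close> is a shooting argument in the energy (\<open>ground_state_exists\<close>), and the
  statements on \<open>F\<close> and \<open>\<psi>\<close> are \<open>riccati_strict_increase\<close>, \<open>psi_log_derivative_less\<close>,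
  \<open>neumann_unique\<close> and \<open>neumann_exists\<close>. The link with operators in $L^2$ goes through Green's function: two
  solutions with exponential decay at \<open>+\<infinity>\<close> and \<open>-\<infinity>\<close> and nonzero Wronskian put \<open>E\<close> into the
  resolvent set (\<open>dichotomy.in_resolvent_set\<close>). Used for the dislocated operator, this shows that there
  are no eigenvalues except those found above; used with \<open>t = 0\<close>, it shows that there is no spectrum of the
  periodic operator below \<open>E0\<close>. That \<open>E0\<close> itself belongs to the spectrum follows by testing with the slowly decaying
  approximate eigenfunctions \<open>p(x) / cosh (e x)\<close>.\<close>

section \<open>Linear second-order equations\<close>

text \<open>The derivative is carried along as a second function, so that a second-order equation becomes a pair of
  first-order statements and initial data can be read off directly.\<close>

definition ode_solution :: "(real \<Rightarrow> real) \<Rightarrow> (real \<Rightarrow> real) \<Rightarrow> (real \<Rightarrow> real) \<Rightarrow> bool" where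
  "ode_solution q u u' \<longleftrightarrow> (\<forall>x. (u has_real_derivative u' x) (at x)) \<and>
     (\<forall>x. (u' has_real_derivative q x * u x) (at x))"

definition primitive :: "(real \<Rightarrow> real) \<Rightarrow> real \<Rightarrow> real" where
  "primitive f x = (LBINT y=0..x. f y)"

lemma primitive_0 [simp]: "primitive f 0 = 0"
  by (simp add: primitive_def zero_ereal_def del: ereal_eq_0)

lemma DERIV_imp_continuous_on:
  fixes f :: "real \<Rightarrow> real"
  assumes "\<And>x. (f has_real_derivative f' x) (at x)"
  shows "continuous_on S f"
  by (rule DERIV_continuous_on[of S f f']) (rule has_field_derivative_at_within[OF assms])

lemma DERIV_reflect:
  fixes f :: "real \<Rightarrow> real"
  assumes "\<And>x. (f has_real_derivative f' x) (at x)"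
  shows "((\<lambda>x. f (a - x)) has_real_derivative - f' (a - x)) (at x)"
proof -
  have "((\<lambda>x. a - x) has_real_derivative -1) (at x)"
    by (auto intro!: derivative_eq_intros)
  from DERIV_chain2[where f = f and g = "\<lambda>x. a - x", OF assms this] show ?thesis by simp
qed

lemma DERIV_translate:
  fixes f :: "real \<Rightarrow> real"
  assumes "\<And>x. (f has_real_derivative f' x) (at x)"
  shows "((\<lambda>x. f (x + a)) has_real_derivative f' (x + a)) (at x)"
proof -
  have "((\<lambda>x. x + a) has_real_derivative 1) (at x)"
    by (auto intro!: derivative_eq_intros)
  from DERIV_chain2[where f = f and g = "\<lambda>x. x + a", OF assms this] show ?thesis by simp
qed

lemma has_real_derivative_primitive:
  assumes "continuous_on UNIV f"
  shows "(primitive f has_real_derivative f x) (at x)"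
proof -
  have "((\<lambda>x. LBINT y=ereal 0..x. f y) has_vector_derivative f x) (at x within {-\<bar>x\<bar>-1..\<bar>x\<bar>+1})"
    by (rule interval_integral_FTC2) (auto intro: continuous_on_subset[OF assms])
  moreover have "x \<in> interior {-\<bar>x\<bar>-1..\<bar>x\<bar>+1}" by (simp add: interior_atLeastAtMost_real) linarith
  ultimately show ?thesis
    unfolding has_real_derivative_iff_has_vector_derivative primitive_def[abs_def]
    by (metis at_within_interior zero_ereal_def)
qed

lemma primitive_power_bound:
  assumes f: "continuous_on UNIV f" and b: "\<And>x. \<bar>f x\<bar> \<le> c * \<bar>x\<bar> ^ n"
  shows "\<bar>primitive f x\<bar> \<le> c * \<bar>x\<bar> ^ Suc n / Suc n"
proof -
  have pos: "\<bar>s * F x\<bar> \<le> c * x ^ Suc n / Suc n"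
    if x: "x \<ge> 0" and s: "s = 1 \<or> s = -1" and F0: "F 0 = 0"
      and F: "\<And>y. (F has_real_derivative g y) (at y)"
      and g: "\<And>y. \<bar>g y\<bar> \<le> c * \<bar>y\<bar> ^ n" for F g x and s :: real
  proof -
    have "c * x ^ Suc n / Suc n - \<sigma> * F x \<ge> c * 0 ^ Suc n / Suc n - \<sigma> * F 0"
      if \<sigma>: "\<sigma> = 1 \<or> \<sigma> = -1" for \<sigma> :: real
    proof (rule DERIV_nonneg_imp_nondecreasing[OF x])
      fix y assume y: "0 \<le> y" "y \<le> x"
      have "((\<lambda>x. c * x ^ Suc n / Suc n - \<sigma> * F x) has_real_derivative c * y ^ n - \<sigma> * g y) (at y)"
        by (auto intro!: derivative_eq_intros F simp del: power_Suc of_nat_Suc simp: field_simps)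
      moreover have "c * y ^ n - \<sigma> * g y \<ge> 0" using g[of y] \<sigma> y by auto
      ultimately show "\<exists>z. ((\<lambda>x. c * x ^ Suc n / Suc n - \<sigma> * F x) has_real_derivative z) (at y) \<and> 0 \<le> z"
        by blast
    qed
    from this[of 1] this[of "-1"] show ?thesis using F0 s by (auto simp: abs_le_iff)
  qed
  show ?thesis
  proof (cases "x \<ge> 0")
    case True
    from pos[of x 1 "primitive f" f, OF True _ _ has_real_derivative_primitive[OF f] b] True
    show ?thesis by simp
  next
    case False
    have "((\<lambda>y. primitive f (- y)) has_real_derivative - f (- y)) (at y)" for y
      using DERIV_reflect[where a = 0, OF has_real_derivative_primitive[OF f]] by simp
    moreover have "\<bar>- f (- y)\<bar> \<le> c * \<bar>y\<bar> ^ n" for y using b[of "- y"] by simp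
    ultimately have "\<bar>1 * primitive f (- (- x))\<bar> \<le> c * (- x) ^ Suc n / Suc n"
      using False by (intro pos[where g = "\<lambda>y. - f (- y)" and F = "\<lambda>y. primitive f (- y)"]) auto
    then show ?thesis using False by simp
  qed
qed

text \<open>The terms of the Dyson series of the first-order system \<open>u' = v\<close>, \<open>v' = q u\<close>; their sum over \<open>n\<close> is the
  solution with initial data \<open>a\<close>, \<open>b\<close> at \<open>0\<close>.\<close>

fun picard_term :: "(real \<Rightarrow> real) \<Rightarrow> real \<Rightarrow> real \<Rightarrow> nat \<Rightarrow> (real \<Rightarrow> real) \<times> (real \<Rightarrow> real)" where
  "picard_term q a b 0 = ((\<lambda>_. a), (\<lambda>_. b))"
| "picard_term q a b (Suc n) =
     (primitive (snd (picard_term q a b n)), primitive (\<lambda>x. q x * fst (picard_term q a b n) x))"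

text \<open>The \<open>n\<close>-th term of the Dyson series is bounded by a multiple of \<open>(K \<bar>x\<bar>)\<^sup>n / n!\<close>, so that the series and the
  series of the derivatives converge uniformly on bounded sets.\<close>

lemma ode_solution_exists:
  assumes q: "continuous_on UNIV q" and Q: "\<And>x. \<bar>q x\<bar> \<le> Q"
  shows "\<exists>u u'. ode_solution q u u' \<and> u 0 = a \<and> u' 0 = b"
proof -
  define A where "A n = fst (picard_term q a b n)" for n
  define B where "B n = snd (picard_term q a b n)" for n
  define K where "K = Q + 1"
  define M where "M = \<bar>a\<bar> + \<bar>b\<bar>"
  have Q0: "Q \<ge> 0" using Q[of 0] by linarith
  have A0: "A 0 = (\<lambda>_. a)" "B 0 = (\<lambda>_. b)" by (auto simp: A_def B_def)
  have AS: "A (Suc n) = primitive (B n)" "B (Suc n) = primitive (\<lambda>x. q x * A n x)" for n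
    by (auto simp: A_def B_def)
  have cont: "continuous_on UNIV (A n) \<and> continuous_on UNIV (B n)" for n
  proof (induction n)
    case (Suc n)
    have "continuous_on UNIV (\<lambda>x. q x * A n x)" using Suc q by (intro continuous_intros) auto
    then show ?case using Suc unfolding AS
      by (intro conjI DERIV_imp_continuous_on[OF has_real_derivative_primitive]) auto
  qed (auto simp: A0)
  have contqA: "continuous_on UNIV (\<lambda>x. q x * A n x)" for n
    using cont q by (intro continuous_intros) auto
  have dA: "(A (Suc n) has_real_derivative B n x) (at x)" for n x
    unfolding AS using cont by (intro has_real_derivative_primitive) auto
  have dB: "(B (Suc n) has_real_derivative q x * A n x) (at x)" for n x
    unfolding AS by (intro has_real_derivative_primitive contqA)
  have bd: "\<bar>A n x\<bar> \<le> M * K ^ n / fact n * \<bar>x\<bar> ^ n \<and> \<bar>B n x\<bar> \<le> M * K ^ n / fact n * \<bar>x\<bar> ^ n" for n x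
  proof (induction n arbitrary: x)
    case (Suc n)
    let ?c = "M * K ^ n / fact n"
    have c0: "?c \<ge> 0" using Q0 by (auto simp: M_def K_def)
    have 1: "\<bar>A (Suc n) x\<bar> \<le> K * ?c * \<bar>x\<bar> ^ Suc n / Suc n"
      unfolding AS
    proof (rule primitive_power_bound)
      show "continuous_on UNIV (B n)" using cont by blast
      show "\<bar>B n y\<bar> \<le> K * ?c * \<bar>y\<bar> ^ n" for y
      proof -
        have "1 * (?c * \<bar>y\<bar> ^ n) \<le> K * (?c * \<bar>y\<bar> ^ n)"
          using Q0 c0 by (intro mult_right_mono mult_nonneg_nonneg) (auto simp: K_def)
        then show ?thesis using Suc[of y] by (simp add: mult.assoc)
      qed
    qed
    have 2: "\<bar>B (Suc n) x\<bar> \<le> K * ?c * \<bar>x\<bar> ^ Suc n / Suc n"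
      unfolding AS
    proof (rule primitive_power_bound[OF contqA])
      show "\<bar>q y * A n y\<bar> \<le> K * ?c * \<bar>y\<bar> ^ n" for y
      proof -
        have "\<bar>q y\<bar> \<le> K" using Q[of y] by (simp add: K_def)
        then show ?thesis using mult_mono[of "\<bar>q y\<bar>" K "\<bar>A n y\<bar>" "?c * \<bar>y\<bar> ^ n"] Suc[of y] Q0
          by (simp add: abs_mult K_def mult.assoc)
      qed
    qed
    have "K * ?c * \<bar>x\<bar> ^ Suc n / Suc n = M * K ^ Suc n / fact (Suc n) * \<bar>x\<bar> ^ Suc n"
      by (simp add: field_simps)
    with 1 2 show ?case by simp
  qed (auto simp: A0 M_def)
  define g where "g R n = M * (K * R) ^ n / fact n" for R :: real and n :: nat
  have sg: "summable (g R)" for R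
  proof -
    have "summable (\<lambda>n. M * ((K * R) ^ n /\<^sub>R fact n))"
      by (intro summable_mult summable_exp_generic)
    then show ?thesis by (simp add: g_def[abs_def] divide_inverse mult_ac)
  qed
  have bdR: "\<bar>A n x\<bar> \<le> g R n \<and> \<bar>B n x\<bar> \<le> g R n" if "\<bar>x\<bar> \<le> R" for n x R
  proof -
    have "M * K ^ n / fact n * \<bar>x\<bar> ^ n \<le> M * K ^ n / fact n * R ^ n"
      using that Q0 by (intro mult_left_mono power_mono) (auto simp: M_def K_def)
    also have "\<dots> = g R n" by (simp add: g_def power_mult_distrib)
    finally show ?thesis using bd[of n x] by linarith
  qed
  have sumA: "summable (\<lambda>n. A n x)" "summable (\<lambda>n. B n x)" for x
    using bdR[of x "\<bar>x\<bar>"] by (auto intro!: summable_comparison_test'[OF sg[of "\<bar>x\<bar>"], of 0])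
  define u where "u x = (\<Sum>n. A n x)" for x
  define v where "v x = (\<Sum>n. B n x)" for x
  have u_eq: "u x = (\<Sum>n. A (Suc n) x) + a" for x
    unfolding u_def by (subst suminf_split_head[OF sumA(1)]) (simp add: A0)
  have v_eq: "v x = (\<Sum>n. B (Suc n) x) + b" for x
    unfolding v_def by (subst suminf_split_head[OF sumA(2)]) (simp add: A0)
  have qb: "norm (q y * A n y) \<le> Q * g R n" if "\<bar>y\<bar> \<le> R" for y R n
    using mult_mono[of "\<bar>q y\<bar>" Q "\<bar>A n y\<bar>" "g R n"] Q bdR[OF that, of n] Q0 by (auto simp: abs_mult)
  have du: "(u has_real_derivative v x) (at x)" for x
  proof -
    let ?S = "{-\<bar>x\<bar>-1..\<bar>x\<bar>+1}"
    have "((\<lambda>x. \<Sum>n. A (Suc n) x) has_real_derivative (\<Sum>n. B n x)) (at x)"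
    proof (rule has_field_derivative_series'(2)[where S = ?S and ?x0.0 = 0 and f = "\<lambda>n. A (Suc n)" and f' = B])
      show "uniformly_convergent_on ?S (\<lambda>n x. \<Sum>i<n. B i x)"
        by (rule Weierstrass_m_test'[OF _ sg[of "\<bar>x\<bar>+1"]]) (use bdR in auto)
      show "summable (\<lambda>n. A (Suc n) 0)" using sumA(1)[of 0] by (subst summable_Suc_iff)
      show "x \<in> interior ?S" by (simp add: interior_atLeastAtMost_real) linarith
    qed (auto intro!: has_field_derivative_at_within[OF dA])
    from DERIV_add[OF this DERIV_const[of a]] show ?thesis
      unfolding v_def[of x] u_eq[abs_def] by simp
  qed
  have dv: "(v has_real_derivative q x * u x) (at x)" for x
  proof -
    let ?S = "{-\<bar>x\<bar>-1..\<bar>x\<bar>+1}"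
    have "((\<lambda>x. \<Sum>n. B (Suc n) x) has_real_derivative (\<Sum>n. q x * A n x)) (at x)"
    proof (rule has_field_derivative_series'(2)[where S = ?S and ?x0.0 = 0 and f = "\<lambda>n. B (Suc n)"
            and f' = "\<lambda>n x. q x * A n x"])
      show "uniformly_convergent_on ?S (\<lambda>n x. \<Sum>i<n. q x * A i x)"
        by (rule Weierstrass_m_test'[OF _ summable_mult[OF sg[of "\<bar>x\<bar>+1"]], of _ _ Q]) (rule qb, auto)
      show "summable (\<lambda>n. B (Suc n) 0)" using sumA(2)[of 0] by (subst summable_Suc_iff)
      show "x \<in> interior ?S" by (simp add: interior_atLeastAtMost_real) linarith
    qed (auto intro!: has_field_derivative_at_within[OF dB])
    moreover have "(\<Sum>n. q x * A n x) = q x * u x" unfolding u_def by (rule suminf_mult[OF sumA(1)])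
    ultimately show ?thesis using DERIV_add[OF _ DERIV_const[of b]] unfolding v_eq[abs_def] by fastforce
  qed
  have "u 0 = a" "v 0 = b" by (auto simp: u_eq v_eq AS)
  with du dv show ?thesis unfolding ode_solution_def by blast
qed

text \<open>Gronwall's inequality for the energy \<open>w\<^sup>2 + w'\<^sup>2\<close>. It is one-sided because a periodic potential and its
  dislocation agree on one side of the origin only. The inhomogeneity \<open>r\<close> is what a change of the spectral parameter
  produces.\<close>

lemma ode_gronwall:
  fixes w w' q r :: "real \<Rightarrow> real"
  assumes dw: "\<And>x. 0 < x \<Longrightarrow> x < X \<Longrightarrow> (w has_real_derivative w' x) (at x)"
    and dw': "\<And>x. 0 < x \<Longrightarrow> x < X \<Longrightarrow> (w' has_real_derivative q x * w x + r x) (at x)"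
    and c: "continuous_on {0..X} w" "continuous_on {0..X} w'"
    and Q: "\<And>x. \<bar>q x\<bar> \<le> Q" and R: "\<And>x. 0 \<le> x \<Longrightarrow> x \<le> X \<Longrightarrow> \<bar>r x\<bar> \<le> R"
    and init: "w 0 = 0" "w' 0 = 0" and x: "0 \<le> x" "x \<le> X"
  shows "(w x)\<^sup>2 + (w' x)\<^sup>2 \<le> R\<^sup>2 * exp ((2 + Q) * x)"
proof -
  define K where "K = 2 + Q"
  have Q0: "Q \<ge> 0" using Q[of 0] by linarith
  define N where "N x = (w x)\<^sup>2 + (w' x)\<^sup>2" for x
  define h where "h x = (N x + R\<^sup>2) * exp (- K * x)" for x
  have "h x \<le> h 0"
  proof (cases "x = 0")
    case False
    show ?thesis
    proof (rule DERIV_nonpos_imp_decreasing_open[where f = h])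
      show "0 \<le> x" by fact
      show "continuous_on {0..x} h"
        unfolding h_def N_def using x by (intro continuous_intros continuous_on_subset[OF c(1)] continuous_on_subset[OF c(2)]) auto
      fix y assume y: "0 < y" "y < x"
      then have yX: "0 < y" "y < X" using x by auto
      have d: "(h has_real_derivative (2 * w y * w' y + 2 * w' y * (q y * w y + r y) - K * (N y + R\<^sup>2)) * exp (- K * y)) (at y)"
        unfolding h_def[abs_def] N_def
        by (auto intro!: derivative_eq_intros dw[OF yX] dw'[OF yX] simp: algebra_simps)
      have e1: "2 * w y * w' y \<le> N y" unfolding N_def
        using sum_squares_bound[of "w y" "w' y"] by simp
      have e2: "2 * w' y * (q y * w y) \<le> Q * N y"
      proof -
        have "2 * w' y * (q y * w y) = q y * (2 * w y * w' y)" by (simp add: mult_ac)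
        also have "\<dots> \<le> \<bar>q y * (2 * w y * w' y)\<bar>" by (rule abs_ge_self)
        also have "\<dots> = \<bar>q y\<bar> * \<bar>2 * w y * w' y\<bar>" by (rule abs_mult)
        also have "\<dots> \<le> Q * N y"
        proof (intro mult_mono Q)
          show "\<bar>2 * w y * w' y\<bar> \<le> N y" unfolding N_def
            using sum_squares_bound[of "w y" "w' y"] sum_squares_bound[of "w y" "- w' y"] by (auto simp: abs_le_iff)
        qed (use Q0 in \<open>auto simp: N_def\<close>)
        finally show ?thesis .
      qed
      have e3: "2 * w' y * r y \<le> N y + R\<^sup>2"
      proof -
        have "2 * w' y * r y \<le> (w' y)\<^sup>2 + (r y)\<^sup>2" using sum_squares_bound[of "w' y" "r y"] by simp
        moreover have "(r y)\<^sup>2 \<le> R\<^sup>2" using R[of y] yX by (intro abs_le_square_iff[THEN iffD1]) auto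
        ultimately show ?thesis using zero_le_power2[of "w y"] unfolding N_def by linarith
      qed
      have "2 * w y * w' y + 2 * w' y * (q y * w y + r y) - K * (N y + R\<^sup>2)
          = 2 * w y * w' y + 2 * w' y * (q y * w y) + 2 * w' y * r y - 2 * N y - Q * N y - 2 * R\<^sup>2 - Q * R\<^sup>2"
        by (simp add: K_def algebra_simps)
      also have "\<dots> \<le> 0" using e1 e2 e3 Q0 mult_nonneg_nonneg[OF Q0 zero_le_power2[of R]] zero_le_power2[of R] by linarith
      finally show "\<exists>z. (h has_real_derivative z) (at y) \<and> z \<le> 0"
        using d by (intro exI[of _ "(2 * w y * w' y + 2 * w' y * (q y * w y + r y) - K * (N y + R\<^sup>2)) * exp (- K * y)"])
          (auto intro!: mult_nonpos_nonneg)
    qed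
  qed simp
  then have "(N x + R\<^sup>2) * exp (- K * x) \<le> R\<^sup>2" by (simp add: h_def N_def init)
  then have "(N x + R\<^sup>2) * exp (- K * x) * exp (K * x) \<le> R\<^sup>2 * exp (K * x)"
    by (rule mult_right_mono) simp
  moreover have "exp (- K * x) * exp (K * x) = 1" by (simp flip: exp_add)
  ultimately have "N x + R\<^sup>2 \<le> R\<^sup>2 * exp (K * x)" by (simp only: mult.assoc mult_1_right)
  then show ?thesis unfolding N_def K_def using zero_le_power2[of R] by linarith
qed

lemma ode_solution_continuous:
  assumes "ode_solution q u u'"
  shows "continuous_on S u" "continuous_on S u'"
proof -
  have u: "(u has_real_derivative u' x) (at x)" "(u' has_real_derivative q x * u x) (at x)" for x
    using assms by (auto simp: ode_solution_def)
  show "continuous_on S u" "continuous_on S u'"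
    by (rule DERIV_imp_continuous_on, rule u)+
qed

lemma ode_solution_unique_half_line:
  assumes u: "ode_solution q1 u u'" and v: "ode_solution q2 v v'"
    and eq: "\<And>x. x \<ge> 0 \<Longrightarrow> q1 x = q2 x" and Q: "\<And>x. \<bar>q1 x\<bar> \<le> Q"
    and init: "u 0 = v 0" "u' 0 = v' 0" and x: "x \<ge> 0"
  shows "u x = v x" "u' x = v' x"
proof -
  have "(u x - v x)\<^sup>2 + (u' x - v' x)\<^sup>2 \<le> 0\<^sup>2 * exp ((2 + Q) * x)"
  proof (rule ode_gronwall[where X = x and q = q1 and r = "\<lambda>_. 0"])
    show "continuous_on {0..x} (\<lambda>x. u x - v x)" "continuous_on {0..x} (\<lambda>x. u' x - v' x)"
      by (intro continuous_on_diff ode_solution_continuous[OF u] ode_solution_continuous[OF v])+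
    show "((\<lambda>x. u x - v x) has_real_derivative u' y - v' y) (at y)" for y
      using u v unfolding ode_solution_def by (simp add: DERIV_diff)
    show "((\<lambda>x. u' x - v' x) has_real_derivative q1 y * (u y - v y) + 0) (at y)" if "0 < y" for y
    proof -
      have "((\<lambda>x. u' x - v' x) has_real_derivative q1 y * u y - q2 y * v y) (at y)"
        using u v unfolding ode_solution_def by (simp add: DERIV_diff)
      then show ?thesis using eq[of y] that by (simp add: algebra_simps)
    qed
  qed (use Q init x in auto)
  then have "(u x - v x)\<^sup>2 + (u' x - v' x)\<^sup>2 \<le> 0" by simp
  then show "u x = v x" "u' x = v' x" 
    using sum_power2_le_zero_iff[of "u x - v x" "u' x - v' x"] by auto
qed

lemma ode_solution_reflect:
  assumes "ode_solution q u u'"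
  shows "ode_solution (\<lambda>x. q (a - x)) (\<lambda>x. u (a - x)) (\<lambda>x. - u' (a - x))"
proof -
  have u: "(u has_real_derivative u' x) (at x)" "(u' has_real_derivative q x * u x) (at x)" for x
    using assms by (auto simp: ode_solution_def)
  show ?thesis unfolding ode_solution_def
    using DERIV_reflect[OF u(1), of a] DERIV_minus[OF DERIV_reflect[OF u(2), of a]] by simp
qed

lemma ode_solution_shift:
  assumes "ode_solution q u u'"
  shows "ode_solution (\<lambda>x. q (x + a)) (\<lambda>x. u (x + a)) (\<lambda>x. u' (x + a))"
proof -
  have u: "(u has_real_derivative u' x) (at x)" "(u' has_real_derivative q x * u x) (at x)" for x
    using assms by (auto simp: ode_solution_def)
  show ?thesis unfolding ode_solution_def
    using DERIV_translate[OF u(1), of a] DERIV_translate[OF u(2), of a] by simp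
qed

lemma ode_solution_linear:
  assumes "ode_solution q u u'" "ode_solution q v v'"
  shows "ode_solution q (\<lambda>x. a * u x + b * v x) (\<lambda>x. a * u' x + b * v' x)"
proof -
  have u: "(u has_real_derivative u' x) (at x)" "(u' has_real_derivative q x * u x) (at x)"
    and v: "(v has_real_derivative v' x) (at x)" "(v' has_real_derivative q x * v x) (at x)" for x
    using assms by (auto simp: ode_solution_def)
  have "q x * (a * u x + b * v x) = a * (q x * u x) + b * (q x * v x)" for x
    by (simp add: algebra_simps)
  then show ?thesis unfolding ode_solution_def
    using DERIV_add[OF DERIV_cmult[OF u(1), of a] DERIV_cmult[OF v(1), of b]]
      DERIV_add[OF DERIV_cmult[OF u(2), of a] DERIV_cmult[OF v(2), of b]] by simp
qed

lemma ode_solution_unique: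
  assumes u: "ode_solution q u u'" and v: "ode_solution q v v'" and Q: "\<And>x. \<bar>q x\<bar> \<le> Q"
    and init: "u a = v a" "u' a = v' a"
  shows "u = v \<and> u' = v'"
proof -
  have "u x = v x \<and> u' x = v' x" for x
  proof (cases "x \<ge> a")
    case True
    show ?thesis
      using ode_solution_unique_half_line[OF ode_solution_shift[OF u, of a] ode_solution_shift[OF v, of a] refl Q, of "x - a"]
        init True by auto
  next
    case False
    show ?thesis
      using ode_solution_unique_half_line[OF ode_solution_reflect[OF u, of a] ode_solution_reflect[OF v, of a] refl Q, of "a - x"]
        init False by auto
  qed
  then show ?thesis by auto
qed

text \<open>The difference of two solutions with the same initial data solves the equation with inhomogeneity
  \<open>(E - E') U E\<close>, which is small; the estimate is uniform on \<open>[0, X]\<close>, as the shooting argument requires.\<close>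

lemma ode_solution_continuous_parameter:
  fixes U U' :: "real \<Rightarrow> real \<Rightarrow> real"
  assumes U: "\<And>E. ode_solution (\<lambda>x. V x - E) (U E) (U' E)"
    and V: "\<And>x. \<bar>V x\<bar> \<le> B" and init: "\<And>E. U E 0 = a" "\<And>E. U' E 0 = b" and e: "e > 0"
  shows "\<exists>\<delta>>0. \<forall>E'. \<bar>E' - E\<bar> < \<delta> \<longrightarrow> (\<forall>x\<in>{0..X}. \<bar>U E' x - U E x\<bar> < e \<and> \<bar>U' E' x - U' E x\<bar> < e)"
proof (cases "X \<ge> 0")
  case False
  then show ?thesis by (intro exI[of _ 1]) auto
next
  case X: True
  have "compact (U E ` {0..X})"
    by (intro compact_continuous_image ode_solution_continuous[OF U]) auto
  then obtain M where M: "\<And>x. x \<in> {0..X} \<Longrightarrow> \<bar>U E x\<bar> \<le> M" "M > 0"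
    by (metis bounded_pos compact_imp_bounded imageI real_norm_def)
  define Q where "Q = B + \<bar>E\<bar> + 1"
  define L where "L = exp ((2 + Q) * X)"
  define \<delta> where "\<delta> = min 1 (e / (M * L))"
  have L: "L \<ge> 1" "L > 0" using X V[of 0] by (auto simp: L_def Q_def)
  have B0: "B \<ge> 0" using V[of 0] by linarith
  have "\<bar>U E' x - U E x\<bar> < e \<and> \<bar>U' E' x - U' E x\<bar> < e" if E': "\<bar>E' - E\<bar> < \<delta>" and x: "x \<in> {0..X}" for E' x
  proof -
    have "(U E' x - U E x)\<^sup>2 + (U' E' x - U' E x)\<^sup>2 \<le> (\<bar>E' - E\<bar> * M)\<^sup>2 * exp ((2 + Q) * x)"
    proof (rule ode_gronwall[where X = X and q = "\<lambda>x. V x - E'" and r = "\<lambda>x. (E - E') * U E x"])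
      show "((\<lambda>x. U E' x - U E x) has_real_derivative U' E' y - U' E y) (at y)" for y
        using U unfolding ode_solution_def by (simp add: DERIV_diff)
      show "((\<lambda>x. U' E' x - U' E x) has_real_derivative (V y - E') * (U E' y - U E y) + (E - E') * U E y) (at y)" for y
      proof -
        have "((\<lambda>x. U' E' x - U' E x) has_real_derivative (V y - E') * U E' y - (V y - E) * U E y) (at y)"
          using U unfolding ode_solution_def by (simp add: DERIV_diff)
        then show ?thesis by (simp add: algebra_simps)
      qed
      show "\<bar>V y - E'\<bar> \<le> Q" for y using V[of y] E' unfolding Q_def \<delta>_def by linarith
      show "\<bar>(E - E') * U E y\<bar> \<le> \<bar>E' - E\<bar> * M" if "0 \<le> y" "y \<le> X" for y
        using M(1)[of y] that by (auto simp: abs_mult abs_minus_commute intro!: mult_left_mono)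
    qed (use init x in \<open>auto intro!: continuous_on_diff ode_solution_continuous[OF U]\<close>)
    also have "\<dots> \<le> (\<bar>E' - E\<bar> * M)\<^sup>2 * L"
      unfolding L_def using x B0 by (intro mult_left_mono) (auto simp: Q_def intro!: mult_left_mono)
    also have "\<dots> \<le> (\<bar>E' - E\<bar> * M)\<^sup>2 * L\<^sup>2"
      using L by (intro mult_left_mono) (auto simp: power2_eq_square)
    also have "\<dots> = (\<bar>E' - E\<bar> * M * L)\<^sup>2" by (simp add: power_mult_distrib)
    also have "\<dots> < e\<^sup>2"
    proof (rule power_strict_mono)
      have "\<bar>E' - E\<bar> < e / (M * L)" using E' unfolding \<delta>_def by simp
      then show "\<bar>E' - E\<bar> * M * L < e" using M(2) L by (simp add: field_simps)
    qed (use M L in auto)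
    finally have *: "(U E' x - U E x)\<^sup>2 + (U' E' x - U' E x)\<^sup>2 < e\<^sup>2" .
    have "(U E' x - U E x)\<^sup>2 < e\<^sup>2" "(U' E' x - U' E x)\<^sup>2 < e\<^sup>2"
      using * by (smt (verit) zero_le_power2)+
    then show ?thesis using e by (metis abs_le_square_iff abs_of_pos linorder_not_le)
  qed
  moreover have "\<delta> > 0" using e M L by (auto simp: \<delta>_def)
  ultimately show ?thesis by blast
qed

section \<open>Periodic potentials and Floquet solutions\<close>

lemma periodic_int:
  fixes f :: "real \<Rightarrow> 'a"
  assumes "\<And>x. f (x + d) = f x"
  shows "f (x + of_int k * d) = f x"
proof (induction k rule: int_induct[where k = 0])
  case (step1 i)
  then show ?case using assms[of "x + of_int i * d"] by (simp add: algebra_simps)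
next
  case (step2 i)
  then show ?case using assms[of "x + of_int (i - 1) * d"] by (simp add: algebra_simps)
qed simp

lemma reduce_mod_period:
  assumes "(d::real) > 0"
  obtains k :: int where "0 \<le> x + of_int k * d" "x + of_int k * d < d"
proof
  show "0 \<le> x + of_int (- \<lfloor>x / d\<rfloor>) * d" "x + of_int (- \<lfloor>x / d\<rfloor>) * d < d"
    using floor_divide_lower[OF assms, of x] floor_divide_upper[OF assms, of x]
    by (auto simp: algebra_simps)
qed

lemma periodic_bounded:
  fixes f :: "real \<Rightarrow> real"
  assumes d: "d > 0" and per: "\<And>x. f (x + d) = f x" and cont: "continuous_on UNIV f"
  shows "\<exists>M>0. \<forall>x. \<bar>f x\<bar> \<le> M"
proof -
  have "compact (f ` {0..d})"
    by (intro compact_continuous_image continuous_on_subset[OF cont]) auto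
  then obtain M where M: "M > 0" "\<And>x. x \<in> {0..d} \<Longrightarrow> \<bar>f x\<bar> \<le> M"
    by (metis bounded_pos compact_imp_bounded imageI real_norm_def)
  have "\<bar>f x\<bar> \<le> M" for x
  proof -
    obtain k :: int where k: "0 \<le> x + of_int k * d" "x + of_int k * d < d"
      by (rule reduce_mod_period[OF d])
    then show ?thesis using M(2)[of "x + of_int k * d"] periodic_int[of f d x k, OF per] by simp
  qed
  with M(1) show ?thesis by blast
qed

text \<open>The derivative of \<open>u u' - u\<^sup>2 r\<close> is \<open>(u' - u r)\<^sup>2 + u\<^sup>2 (q - s - r\<^sup>2)\<close>, a sum of two nonnegative terms. In the
  applications \<open>r\<close> is either \<open>0\<close> or the logarithmic derivative of the ground state, and \<open>\<delta>\<close> is the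
  distance of the energy from the bottom of the spectrum. Strictness comes from the left end point, where
  one of the two terms is positive.\<close>

lemma riccati_strict_increase:
  assumes u: "ode_solution q u u'"
    and r: "\<And>x. (r has_real_derivative s x) (at x)" and s: "\<And>x. s x + (r x)\<^sup>2 + \<delta> \<le> q x"
    and ab: "a < b" and nz: "\<delta> \<ge> 0" "u a \<noteq> 0 \<and> \<delta> > 0 \<or> u a = 0 \<and> u' a \<noteq> 0"
  shows "u a * u' a - (u a)\<^sup>2 * r a < u b * u' b - (u b)\<^sup>2 * r b"
proof -
  define F where "F x = u x * u' x - (u x)\<^sup>2 * r x" for x
  define F' where "F' x = (u' x - u x * r x)\<^sup>2 + (u x)\<^sup>2 * (q x - s x - (r x)\<^sup>2)" for x
  have du: "(u has_real_derivative u' x) (at x)" "(u' has_real_derivative q x * u x) (at x)" for x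
    using u by (auto simp: ode_solution_def)
  have dF: "(F has_real_derivative F' x) (at x)" for x
    unfolding F_def[abs_def] F'_def
    by (rule derivative_eq_intros du r refl)+ (simp add: power2_eq_square algebra_simps)
  have F'_ge: "F' x \<ge> (u' x - u x * r x)\<^sup>2 + (u x)\<^sup>2 * \<delta>" for x
    unfolding F'_def using s[of x] by (intro add_left_mono mult_left_mono) auto
  have "F' x \<ge> 0" for x
    using F'_ge[of x] nz(1) by (smt (verit) mult_nonneg_nonneg zero_le_power2)
  then have mono: "F x \<le> F y" if "x \<le> y" for x y
    using DERIV_nonneg_imp_nondecreasing[of x y F] that dF by blast
  have "(u' a - u a * r a)\<^sup>2 + (u a)\<^sup>2 * \<delta> > 0"
  proof (cases "u a = 0")
    case False
    then have "(u a)\<^sup>2 * \<delta> > 0" using nz by simp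
    then show ?thesis by (smt (verit) zero_le_power2)
  qed (use nz in simp)
  then have "F' a > 0" using F'_ge[of a] by linarith
  then obtain e where e: "e > 0" "\<And>h. h > 0 \<Longrightarrow> h < e \<Longrightarrow> F a < F (a + h)"
    using DERIV_pos_inc_right[OF dF] by blast
  define h where "h = min (e / 2) (b - a)"
  have "F a < F (a + h)" using e ab by (auto simp: h_def)
  also have "\<dots> \<le> F b" by (rule mono) (auto simp: h_def)
  finally show ?thesis by (simp add: F_def)
qed

lemma wronskian_constant:
  assumes u: "ode_solution q u u'" and v: "ode_solution q v v'"
  shows "u x * v' x - u' x * v x = u y * v' y - u' y * v y"
proof -
  have du: "(u has_real_derivative u' x) (at x)" "(u' has_real_derivative q x * u x) (at x)"
    and dv: "(v has_real_derivative v' x) (at x)" "(v' has_real_derivative q x * v x) (at x)" for x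
    using u v by (auto simp: ode_solution_def)
  have "((\<lambda>x. u x * v' x - u' x * v x) has_real_derivative 0) (at x)" for x
    by (rule derivative_eq_intros du dv refl)+ (simp add: algebra_simps)
  then show ?thesis by (intro DERIV_isconst_all[of "\<lambda>x. u x * v' x - u' x * v x"]) auto
qed

locale periodic_potential =
  fixes V :: "real \<Rightarrow> real" and d :: real
  assumes d_pos: "d > 0" and cont_V: "continuous_on UNIV V"
    and even_V: "V (- x) = V x" and periodic_V: "V (x + d) = V x"
begin

definition fundamental :: "real \<Rightarrow> real \<Rightarrow> real \<Rightarrow> (real \<Rightarrow> real) \<times> (real \<Rightarrow> real)" where
  "fundamental a b E =
    (SOME p. ode_solution (\<lambda>x. V x - E) (fst p) (snd p) \<and> fst p 0 = a \<and> snd p 0 = b)"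

text \<open>The analogues of cosine and sine, which are even and odd, with their derivatives.\<close>

definition "C E = fst (fundamental 1 0 E)"
definition "C' E = snd (fundamental 1 0 E)"
definition "S E = fst (fundamental 0 1 E)"
definition "S' E = snd (fundamental 0 1 E)"

lemma bounded_V: "\<exists>B>0. \<forall>x. \<bar>V x\<bar> \<le> B"
  by (rule periodic_bounded[OF d_pos periodic_V cont_V])

lemma bounded_q: "\<exists>Q. \<forall>x. \<bar>V x - E\<bar> \<le> Q"
proof -
  obtain B where "\<forall>x. \<bar>V x\<bar> \<le> B" using bounded_V by blast
  then have "\<bar>V x - E\<bar> \<le> B + \<bar>E\<bar>" for x by (meson abs_triangle_ineq4 add_right_mono order_trans)
  then show ?thesis by blast
qed

lemma fundamental:
  "ode_solution (\<lambda>x. V x - E) (fst (fundamental a b E)) (snd (fundamental a b E))"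
  "fst (fundamental a b E) 0 = a" "snd (fundamental a b E) 0 = b"
proof -
  obtain Q where Q: "\<And>x. \<bar>V x - E\<bar> \<le> Q" using bounded_q by blast
  have "continuous_on UNIV (\<lambda>x. V x - E)" using cont_V by (intro continuous_intros)
  from ode_solution_exists[OF this Q, of a b]
  have "\<exists>p. ode_solution (\<lambda>x. V x - E) (fst p) (snd p) \<and> fst p 0 = a \<and> snd p 0 = b" by auto
  from someI_ex[OF this]
  show "ode_solution (\<lambda>x. V x - E) (fst (fundamental a b E)) (snd (fundamental a b E))"
    "fst (fundamental a b E) 0 = a" "snd (fundamental a b E) 0 = b"
    unfolding fundamental_def by blast+
qed

lemma C_sol: "ode_solution (\<lambda>x. V x - E) (C E) (C' E)" and S_sol: "ode_solution (\<lambda>x. V x - E) (S E) (S' E)"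
  and init [simp]: "C E 0 = 1" "C' E 0 = 0" "S E 0 = 0" "S' E 0 = 1"
  unfolding C_def C'_def S_def S'_def by (rule fundamental)+

lemma solution_unique:
  assumes "ode_solution (\<lambda>x. V x - E) u u'" "ode_solution (\<lambda>x. V x - E) v v'" "u a = v a" "u' a = v' a"
  shows "u x = v x" "u' x = v' x"
proof -
  obtain Q where Q: "\<And>x. \<bar>V x - E\<bar> \<le> Q" using bounded_q by blast
  show "u x = v x" "u' x = v' x"
    using ode_solution_unique[OF assms(1,2) Q assms(3,4)] by auto
qed

lemma solution_nontrivial:
  assumes "ode_solution (\<lambda>x. V x - E) u u'" "u a = 0" "u' a = 0"
  shows "u x = 0" "u' x = 0"
proof -
  have "ode_solution (\<lambda>x. V x - E) (\<lambda>_. 0) (\<lambda>_. 0)" by (simp add: ode_solution_def)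
  from solution_unique[OF assms(1) this, where a = a] assms(2,3)
  show "u x = 0" "u' x = 0" by simp_all
qed

lemma solution_expand:
  assumes "ode_solution (\<lambda>x. V x - E) u u'"
  shows "u x = u 0 * C E x + u' 0 * S E x" "u' x = u 0 * C' E x + u' 0 * S' E x"
proof -
  have eq: "ode_solution (\<lambda>x. V x - E) (\<lambda>x. u 0 * C E x + u' 0 * S E x) (\<lambda>x. u 0 * C' E x + u' 0 * S' E x)"
    by (rule ode_solution_linear[OF C_sol S_sol])
  show "u x = u 0 * C E x + u' 0 * S E x" "u' x = u 0 * C' E x + u' 0 * S' E x"
    by (rule solution_unique[OF assms eq, where a = 0]; simp)+
qed

lemma solution_neg:
  assumes "ode_solution (\<lambda>x. V x - E) u u'"
  shows "ode_solution (\<lambda>x. V x - E) (\<lambda>x. u (- x)) (\<lambda>x. - u' (- x))"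
  using ode_solution_reflect[OF assms, of 0] even_V by simp

lemma solution_period:
  assumes "ode_solution (\<lambda>x. V x - E) u u'"
  shows "ode_solution (\<lambda>x. V x - E) (\<lambda>x. u (x + d)) (\<lambda>x. u' (x + d))"
  using ode_solution_shift[OF assms, of d] periodic_V by simp

lemma parity: "C E (- x) = C E x" "C' E (- x) = - C' E x" "S E (- x) = - S E x" "S' E (- x) = S' E x"
proof -
  show "C E (- x) = C E x" "C' E (- x) = - C' E x"
    using solution_unique[OF solution_neg[OF C_sol] C_sol, of E 0 x] by auto
  have "ode_solution (\<lambda>x. V x - E) (\<lambda>x. - S E x) (\<lambda>x. - S' E x)"
    using ode_solution_linear[OF S_sol S_sol, of E "-1" 0] by simp
  from solution_unique[OF solution_neg[OF S_sol] this, of 0 x]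
  show "S E (- x) = - S E x" "S' E (- x) = S' E x" by auto
qed

lemma wronskian: "C E x * S' E x - C' E x * S E x = 1"
  using wronskian_constant[OF C_sol S_sol, of E x 0] by simp

text \<open>Since \<open>C C' > C\<^sup>2 r\<close> to the right of the origin, \<open>C\<close> has no zero there.\<close>

lemma C_pos_of_riccati:
  assumes r: "\<And>x. (r has_real_derivative s x) (at x)" and s: "\<And>x. s x + (r x)\<^sup>2 + \<delta> \<le> V x - E"
    and \<delta>: "\<delta> > 0" and r0: "r 0 = 0" and x: "x > 0"
  shows "C E x > 0" "C E x * C' E x > (C E x)\<^sup>2 * r x"
proof -
  have F: "C E y * C' E y > (C E y)\<^sup>2 * r y" if "y > 0" for y
    using riccati_strict_increase[OF C_sol r s that] \<delta> r0 by simp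
  from F[OF x] show "C E x * C' E x > (C E x)\<^sup>2 * r x" .
  show "C E x > 0"
  proof (rule ccontr)
    assume "\<not> C E x > 0"
    then obtain y where "0 \<le> y" "y \<le> x" "C E y = 0"
      using IVT2'[of "C E" x 0 0] x ode_solution_continuous[OF C_sol] by auto
    with F[of y] show False by (cases "y = 0") auto
  qed
qed

text \<open>Shooting: take the supremum of all energies for which \<open>C\<close> is positive and still has positive slope at \<open>d/2\<close>. At very
  negative energies \<open>C\<close> is convex and these conditions hold; above the maximum of the potential it is concave and they fail.
  At the supremum \<open>C\<close> is nonnegative by continuity; it has no zero, because a zero would be a minimum, at \<open>d/2\<close> one with
  nonnegative slope, and force \<open>C = C' = 0\<close>; and a positive slope at \<open>d/2\<close> would allow a larger energy. So the slope at \<open>d/2\<close> is \<open>0\<close>.\<close>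

lemma ground_state_exists:
  "\<exists>E. (\<forall>x\<in>{0..d/2}. C E x > 0) \<and> C' E (d/2) = 0"
proof -
  obtain B where B: "B > 0" "\<And>x. \<bar>V x\<bar> \<le> B" using bounded_V by blast
  define A where "A = {E. (\<forall>x\<in>{0..d/2}. C E x > 0) \<and> C' E (d/2) > 0}"
  have near: "\<exists>\<delta>>0. \<forall>E'. \<bar>E' - E\<bar> < \<delta> \<longrightarrow> (\<forall>x\<in>{0..d/2}. \<bar>C E' x - C E x\<bar> < e \<and> \<bar>C' E' x - C' E x\<bar> < e)"
    if "e > 0" for e E
    by (rule ode_solution_continuous_parameter[OF C_sol B(2) _ _ that]) auto
  have "- B - 1 \<in> A"
  proof -
    have *: "0 + 0\<^sup>2 + 1 \<le> V x - (- B - 1)" for x using B(2)[of x] by auto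
    have C: "C (- B - 1) x > 0" "C (- B - 1) x * C' (- B - 1) x > 0" if "x > 0" for x
      using C_pos_of_riccati[of "\<lambda>_. 0" "\<lambda>_. 0" 1 "- B - 1" x, OF _ * _ _ that] by auto
    have "C (- B - 1) x > 0" if "x \<in> {0..d/2}" for x
      using that C(1)[of x] by (cases "x = 0") auto
    moreover have "C' (- B - 1) (d/2) > 0"
      using zero_less_mult_pos[OF C(2) C(1), of "d/2"] d_pos by simp
    ultimately show ?thesis by (simp add: A_def)
  qed
  moreover have ub: "E \<le> B" if "E \<in> A" for E
  proof (rule ccontr)
    assume "\<not> E \<le> B"
    have "C' E (d/2) \<le> C' E 0"
    proof (rule DERIV_nonpos_imp_nonincreasing[where f = "C' E"])
      fix x assume x: "0 \<le> x" "x \<le> d/2"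
      have "(V x - E) * C E x \<le> 0"
        using that x B(2)[of x] \<open>\<not> E \<le> B\<close> by (intro mult_nonpos_nonneg) (auto simp: A_def less_imp_le)
      then show "\<exists>y. (C' E has_real_derivative y) (at x) \<and> y \<le> 0"
        using C_sol unfolding ode_solution_def by blast
    qed (use d_pos in auto)
    with that show False by (simp add: A_def)
  qed
  ultimately have bdd: "bdd_above A" "A \<noteq> {}" by (auto simp: bdd_above_def)
  define E where "E = Sup A"
  have approx: "\<exists>E'\<in>A. \<forall>x\<in>{0..d/2}. \<bar>C E' x - C E x\<bar> < e \<and> \<bar>C' E' x - C' E x\<bar> < e" if e: "e > 0" for e
  proof -
    obtain \<delta> where \<delta>: "\<delta> > 0" "\<And>E'. \<bar>E' - E\<bar> < \<delta> \<Longrightarrow> \<forall>x\<in>{0..d/2}. \<bar>C E' x - C E x\<bar> < e \<and> \<bar>C' E' x - C' E x\<bar> < e"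
      using near[OF e, of E] by blast
    obtain E' where E': "E' \<in> A" "E - \<delta> < E'" using less_cSupD[of A "E - \<delta>"] bdd \<delta> by (auto simp: E_def)
    have "E' \<le> E" unfolding E_def by (rule cSup_upper[OF E'(1) bdd(1)])
    with E' \<delta> show ?thesis by (intro bexI[of _ E']) auto
  qed
  have C_ge: "C E x \<ge> 0" if "x \<in> {0..d/2}" for x
  proof (rule ccontr)
    assume "\<not> C E x \<ge> 0"
    then have "- C E x > 0" by simp
    then obtain E' where E': "E' \<in> A" "\<forall>y\<in>{0..d/2}. \<bar>C E' y - C E y\<bar> < - C E x \<and> \<bar>C' E' y - C' E y\<bar> < - C E x"
      by (rule bexE[OF approx])
    then have "\<bar>C E' x - C E x\<bar> < - C E x" using that by blast
    moreover have "C E' x > 0" using E'(1) that by (simp add: A_def)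
    ultimately show False by linarith
  qed
  have C'_ge: "C' E (d/2) \<ge> 0"
  proof (rule ccontr)
    assume "\<not> C' E (d/2) \<ge> 0"
    then have "- C' E (d/2) > 0" by simp
    then obtain E' where E': "E' \<in> A" "\<forall>y\<in>{0..d/2}. \<bar>C E' y - C E y\<bar> < - C' E (d/2) \<and> \<bar>C' E' y - C' E y\<bar> < - C' E (d/2)"
      by (rule bexE[OF approx])
    have "d/2 \<in> {0..d/2}" using d_pos by simp
    with E'(2) have "\<bar>C' E' (d/2) - C' E (d/2)\<bar> < - C' E (d/2)" by blast
    then show False using E'(1) by (auto simp: A_def)
  qed
  have C_pos: "C E x > 0" if x: "x \<in> {0..d/2}" for x
  proof (rule ccontr)
    assume "\<not> C E x > 0"
    with C_ge[OF x] have Cx: "C E x = 0" by simp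
    then have x0: "x > 0" using x by (cases "x = 0") auto
    have D: "(C E has_real_derivative C' E x) (at x)" using C_sol by (auto simp: ode_solution_def)
    have "\<not> C' E x > 0"
    proof
      assume "C' E x > 0"
      from DERIV_pos_inc_left[OF D this] obtain e where e: "e > 0" "\<And>h. h > 0 \<Longrightarrow> h < e \<Longrightarrow> C E (x - h) < C E x" by blast
      define h where "h = min (e/2) x"
      have "C E (x - h) < 0" using e x0 Cx by (auto simp: h_def)
      moreover have "x - h \<in> {0..d/2}" using x e x0 by (auto simp: h_def min_def)
      ultimately show False using C_ge[of "x - h"] by simp
    qed
    moreover have "\<not> C' E x < 0"
    proof
      assume neg: "C' E x < 0"
      with C'_ge have "x < d/2" using x by (cases "x = d/2") auto
      from DERIV_neg_dec_right[OF D neg] obtain e where e: "e > 0" "\<And>h. h > 0 \<Longrightarrow> h < e \<Longrightarrow> C E x > C E (x + h)" by blast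
      define h where "h = min (e/2) (d/2 - x)"
      have "C E (x + h) < 0" using e \<open>x < d/2\<close> Cx by (auto simp: h_def)
      moreover have "x + h \<in> {0..d/2}" using x e \<open>x < d/2\<close> by (auto simp: h_def min_def)
      ultimately show False using C_ge[of "x + h"] by simp
    qed
    ultimately have "C' E x = 0" by simp
    from solution_nontrivial[OF C_sol Cx this, of 0] show False by simp
  qed
  have "C' E (d/2) = 0"
  proof (rule ccontr)
    assume "C' E (d/2) \<noteq> 0"
    with C'_ge have pos: "C' E (d/2) > 0" by simp
    obtain y where y: "y \<in> {0..d/2}" "\<And>x. x \<in> {0..d/2} \<Longrightarrow> C E y \<le> C E x"
      using continuous_attains_inf[of "{0..d/2}" "C E"] ode_solution_continuous[OF C_sol] d_pos by auto
    obtain \<delta> where \<delta>: "\<delta> > 0" "\<And>E'. \<bar>E' - E\<bar> < \<delta> \<Longrightarrow> \<forall>x\<in>{0..d/2}.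
        \<bar>C E' x - C E x\<bar> < min (C E y) (C' E (d/2)) \<and> \<bar>C' E' x - C' E x\<bar> < min (C E y) (C' E (d/2))"
      using near[of "min (C E y) (C' E (d/2))" E] C_pos[OF y(1)] pos by auto
    have *: "\<bar>C (E + \<delta>/2) x - C E x\<bar> < C E y \<and> \<bar>C' (E + \<delta>/2) x - C' E x\<bar> < C' E (d/2)" if "x \<in> {0..d/2}" for x
      using \<delta>(2)[of "E + \<delta>/2"] \<delta>(1) that by auto
    have "C (E + \<delta>/2) x > 0" if "x \<in> {0..d/2}" for x
      using *[OF that] y(2)[OF that] by linarith
    moreover have "C' (E + \<delta>/2) (d/2) > 0" using *[of "d/2"] d_pos by simp linarith
    ultimately have "E + \<delta>/2 \<in> A" by (auto simp: A_def)
    then have "E + \<delta>/2 \<le> E" unfolding E_def by (rule cSup_upper[OF _ bdd(1)])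
    with \<delta>(1) show False by simp
  qed
  with C_pos show ?thesis by blast
qed

end

section \<open>The ground state and the decaying solutions\<close>

text \<open>The two conditions say that the reflections of \<open>C E0\<close> at \<open>0\<close> and \<open>d/2\<close> fit together to a positive periodic function.\<close>

locale ground_state = periodic_potential +
  fixes E0 :: real
  assumes C0_pos_half: "x \<in> {0..d/2} \<Longrightarrow> C E0 x > 0" and C'0_half: "C' E0 (d/2) = 0"
begin

abbreviation "p \<equiv> C E0"
abbreviation "p' \<equiv> C' E0"

text \<open>Both sides solve the same equation, and they agree at \<open>d/2\<close> because the slope vanishes there.\<close>

lemma p_symmetric: "p (d - x) = p x" "p' (d - x) = - p' x"
proof -
  have "V (d - x) = V x" for x
    using periodic_V[of "- x"] even_V[of x] by (simp add: algebra_simps)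
  then have refl: "ode_solution (\<lambda>x. V x - E0) (\<lambda>x. p (d - x)) (\<lambda>x. - p' (d - x))"
    using ode_solution_reflect[OF C_sol, of d E0] by simp
  have half: "d - d/2 = d/2" by simp
  show "p (d - x) = p x"
    by (rule solution_unique(1)[OF refl C_sol, where a = "d/2"]) (simp_all add: half C'0_half)
  have "- p' (d - x) = p' x"
    by (rule solution_unique(2)[OF refl C_sol, where a = "d/2"]) (simp_all add: half C'0_half)
  then show "p' (d - x) = - p' x" by simp
qed

lemma p_periodic: "p (x + d) = p x" "p' (x + d) = p' x"
  using p_symmetric[of "- x"] parity[of E0 x] by (simp_all add: add.commute)

lemma p_pos: "p x > 0"
proof -
  obtain k :: int where k: "0 \<le> x + of_int k * d" "x + of_int k * d < d"
    by (rule reduce_mod_period[OF d_pos])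
  define y where "y = x + of_int k * d"
  have "p y > 0"
  proof (cases "y \<le> d/2")
    case False
    then have "d - y \<in> {0..d/2}" using k by (auto simp: y_def)
    from C0_pos_half[OF this] show ?thesis using p_symmetric(1)[of y] by simp
  qed (use k in \<open>auto simp: y_def intro: C0_pos_half\<close>)
  then show ?thesis using periodic_int[of p d x k, OF p_periodic(1)] by (simp add: y_def)
qed

definition "r x = p' x / p x"

lemma r_periodic: "r (x + d) = r x" and r_0 [simp]: "r 0 = 0" and r_d [simp]: "r d = 0"
proof -
  show *: "r (x + d) = r x" for x by (simp add: r_def p_periodic)
  show "r 0 = 0" by (simp add: r_def)
  with *[of 0] show "r d = 0" by simp
qed

lemma r_riccati: "(r has_real_derivative V x - E0 - (r x)\<^sup>2) (at x)"
proof -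
  have dp: "(p has_real_derivative p' x) (at x)" "(p' has_real_derivative (V x - E0) * p x) (at x)"
    using C_sol by (auto simp: ode_solution_def)
  have "p x \<noteq> 0" using p_pos[of x] by simp
  then show ?thesis unfolding r_def[abs_def]
    using DERIV_divide[OF dp(2) dp(1)] by (simp add: power2_eq_square field_simps)
qed

text \<open>The instance for the Riccati function of the ground state, \<open>r' + r\<^sup>2 = V - E0\<close>. The case \<open>E = E0\<close> is included
  since \<open>S E0 d > 0\<close> is required for continuity up to the bottom of the spectrum.\<close>

lemma jacobi_strict_increase:
  assumes u: "ode_solution (\<lambda>x. V x - E) u u'" and E: "E \<le> E0" and ab: "a < b"
    and nz: "u a \<noteq> 0 \<and> E < E0 \<or> u a = 0 \<and> u' a \<noteq> 0"
  shows "u a * u' a - (u a)\<^sup>2 * r a < u b * u' b - (u b)\<^sup>2 * r b"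
  by (rule riccati_strict_increase[OF u r_riccati, where \<delta> = "E0 - E"]) (use E ab nz in auto)

lemma C_pos: "E < E0 \<Longrightarrow> x \<ge> 0 \<Longrightarrow> C E x > 0"
  using C_pos_of_riccati(1)[OF r_riccati, of "E0 - E" E x] by (cases "x = 0") auto

lemma C_d_pos: "E \<le> E0 \<Longrightarrow> C E d > 0"
  using C_pos[of E d] p_pos[of d] d_pos by (cases "E = E0") auto

text \<open>Evaluating the addition formula \<open>S (x + d) = S d C x + S' d S x\<close> at \<open>x = - d\<close> gives \<open>S d (C d - S' d) = 0\<close>, and the
  strict increase of \<open>u u' - u\<^sup>2 r\<close> gives \<open>S d S' d > 0\<close>.\<close>

lemma S_d: assumes "E \<le> E0" shows "S' E d = C E d" "S E d > 0"
proof -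
  have F: "S E d * S' E d > 0"
    using jacobi_strict_increase[OF S_sol assms d_pos] by simp
  have "S E (- d + d) = S E d * C E (- d) + S' E d * S E (- d)"
    using solution_expand(1)[OF solution_period[OF S_sol], of E "- d"] by simp
  then have "S E d * (C E d - S' E d) = 0" unfolding parity by (simp add: right_diff_distrib)
  moreover have "S E d \<noteq> 0" using F by auto
  ultimately show eq: "S' E d = C E d" by simp
  show "S E d > 0" using F C_d_pos[OF assms] unfolding eq by (simp add: zero_less_mult_iff)
qed

lemma C_squared: "E \<le> E0 \<Longrightarrow> (C E d)\<^sup>2 = 1 + C' E d * S E d"
  using wronskian[of E d] S_d(1)[of E] by (simp add: power2_eq_square)

lemma C'_d_pos: assumes "E < E0" shows "C' E d > 0"
proof -
  have "C E d * C' E d > 0"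
    using jacobi_strict_increase[OF C_sol _ d_pos, of E] assms by simp
  then show ?thesis using zero_less_mult_pos C_d_pos[of E] assms by auto
qed

lemma C'_0_d: "p' d = 0" using p_periodic(2)[of 0] by simp

text \<open>With \<open>\<kappa>\<^sup>2 = C' d / S d\<close> the combination \<open>C - \<kappa> S\<close> is an eigenvector of the translation by a period. Its Floquet
  multiplier \<open>\<rho>\<close> and the multiplier of the reflected solution \<open>C + \<kappa> S\<close> have product \<open>1\<close>, so \<open>\<rho>\<close> is the one below \<open>1\<close>. At
  the bottom of the spectrum \<open>\<kappa> = 0\<close> and \<open>\<psi>\<close> becomes the ground state.\<close>

definition "\<kappa> E = sqrt (C' E d / S E d)"
definition "\<psi> E x = C E x - \<kappa> E * S E x"
definition "\<psi>' E x = C' E x - \<kappa> E * S' E x"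
definition "\<rho> E = C E d - \<kappa> E * S E d"

lemma psi_sol: "ode_solution (\<lambda>x. V x - E) (\<psi> E) (\<psi>' E)"
  using ode_solution_linear[OF C_sol S_sol, of E 1 "- \<kappa> E"]
  by (simp add: \<psi>_def[abs_def] \<psi>'_def[abs_def])

lemma psi_0 [simp]: "\<psi> E 0 = 1" by (simp add: \<psi>_def)

lemma kappa: assumes "E < E0" shows "\<kappa> E > 0" "(\<kappa> E)\<^sup>2 * S E d = C' E d"
  using C'_d_pos[OF assms] S_d(2)[of E] assms by (auto simp: \<kappa>_def)

lemma rho: assumes "E < E0" shows "0 < \<rho> E" "\<rho> E < 1"
proof -
  let ?s = "\<kappa> E * S E d"
  have s: "?s > 0" using kappa[OF assms] S_d(2)[of E] assms by simp
  have "?s\<^sup>2 = C' E d * S E d" using kappa(2)[OF assms] by (simp add: power_mult_distrib power2_eq_square)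
  then have eq: "(C E d)\<^sup>2 = 1 + ?s\<^sup>2" using C_squared[of E] assms by simp
  have C: "C E d > 0" using C_d_pos[of E] assms by simp
  have "?s < C E d" by (rule power2_less_imp_less[OF _ less_imp_le[OF C]]) (use eq in simp)
  then show "0 < \<rho> E" by (simp add: \<rho>_def)
  have "(C E d)\<^sup>2 < (1 + ?s)\<^sup>2" using eq s by (simp add: power2_eq_square algebra_simps)
  then have "C E d < 1 + ?s" by (rule power2_less_imp_less) (use s in simp)
  then show "\<rho> E < 1" by (simp add: \<rho>_def)
qed

lemma psi_floquet: assumes "E < E0" shows "\<psi> E (x + d) = \<rho> E * \<psi> E x" "\<psi>' E (x + d) = \<rho> E * \<psi>' E x"
proof -
  have d0: "\<psi> E d = \<rho> E" by (simp add: \<psi>_def \<rho>_def)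
  have d1: "\<psi>' E d = - \<rho> E * \<kappa> E"
    using kappa(2)[OF assms] S_d(1)[of E] assms by (simp add: \<psi>'_def \<rho>_def power2_eq_square algebra_simps)
  show "\<psi> E (x + d) = \<rho> E * \<psi> E x"
    using solution_expand(1)[OF solution_period[OF psi_sol], of E x] by (simp add: d0 d1) (simp add: \<psi>_def algebra_simps)
  show "\<psi>' E (x + d) = \<rho> E * \<psi>' E x"
    using solution_expand(2)[OF solution_period[OF psi_sol], of E x] by (simp add: d0 d1) (simp add: \<psi>'_def algebra_simps)
qed

text \<open>With \<open>k = - ln \<rho> / d\<close> the function \<open>\<psi> x exp (k x)\<close> is periodic, hence bounded.\<close>

lemma psi_decay:
  assumes "E < E0"
  shows "\<exists>k>0. \<exists>M>0. \<forall>x. \<bar>\<psi> E x\<bar> \<le> M * exp (- k * x) \<and> \<bar>\<psi>' E x\<bar> \<le> M * exp (- k * x)"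
proof -
  define k where "k = - ln (\<rho> E) / d"
  have k: "k > 0" using rho[OF assms] d_pos by (simp add: k_def field_simps)
  have ekd: "exp (k * d) * \<rho> E = 1"
    using rho[OF assms] d_pos by (simp add: k_def exp_minus)
  have bdd: "\<exists>M>0. \<forall>x. \<bar>f x\<bar> \<le> M * exp (- k * x)"
    if f: "\<And>x. f (x + d) = \<rho> E * f x" and cont: "continuous_on UNIV f" for f
  proof -
    have "f (x + d) * exp (k * (x + d)) = f x * exp (k * x)" for x
    proof -
      have "f (x + d) * exp (k * (x + d)) = f x * exp (k * x) * (exp (k * d) * \<rho> E)"
        unfolding f distrib_left exp_add by (simp only: mult_ac)
      then show ?thesis unfolding ekd by simp
    qed
    moreover have "continuous_on UNIV (\<lambda>x. f x * exp (k * x))" using cont by (intro continuous_intros)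
    ultimately obtain M where M: "M > 0" "\<And>x. \<bar>f x * exp (k * x)\<bar> \<le> M"
      using periodic_bounded[OF d_pos, of "\<lambda>x. f x * exp (k * x)"] by blast
    have "\<bar>f x\<bar> \<le> M * exp (- k * x)" for x
    proof -
      have "\<bar>f x\<bar> * exp (k * x) \<le> M" using M(2)[of x] by (simp add: abs_mult)
      then show ?thesis by (simp add: exp_minus divide_inverse[symmetric] pos_le_divide_eq)
    qed
    with M(1) show ?thesis by blast
  qed
  obtain M where M: "M > 0" "\<And>x. \<bar>\<psi> E x\<bar> \<le> M * exp (- k * x)"
    using bdd[OF psi_floquet(1)[OF assms] ode_solution_continuous(1)[OF psi_sol]] by blast
  obtain M' where M': "M' > 0" "\<And>x. \<bar>\<psi>' E x\<bar> \<le> M' * exp (- k * x)"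
    using bdd[OF psi_floquet(2)[OF assms] ode_solution_continuous(2)[OF psi_sol]] by blast
  have "\<bar>\<psi> E x\<bar> \<le> (M + M') * exp (- k * x) \<and> \<bar>\<psi>' E x\<bar> \<le> (M + M') * exp (- k * x)" for x
  proof -
    have "0 \<le> M * exp (- k * x)" "0 \<le> M' * exp (- k * x)" using M(1) M'(1) by simp_all
    with M(2)[of x] M'(2)[of x] show ?thesis unfolding distrib_right by linarith
  qed
  then show ?thesis using k M(1) M'(1) by (intro exI[of _ k] conjI exI[of _ "M + M'"]) auto
qed

text \<open>\<open>F (x + d) = \<rho>\<^sup>2 F x\<close> and \<open>F x < F (x + d)\<close> force \<open>F x < 0\<close>. This compares \<open>\<psi>\<close> with the ground state: since \<open>F < 0\<close> excludes
  \<open>\<psi> x = 0\<close>, it says that \<open>\<psi>'/\<psi> < p'/p\<close>.\<close>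

lemma psi_log_derivative_less:
  assumes "E < E0"
  shows "\<psi> E x * \<psi>' E x < (\<psi> E x)\<^sup>2 * r x"
proof -
  define F where "F y = \<psi> E y * \<psi>' E y - (\<psi> E y)\<^sup>2 * r y" for y
  have nz: "\<psi> E x \<noteq> 0 \<and> E < E0 \<or> \<psi> E x = 0 \<and> \<psi>' E x \<noteq> 0"
    using solution_nontrivial[OF psi_sol, of E x 0] assms by auto
  have "F x < F (x + d)" unfolding F_def
    by (rule jacobi_strict_increase[OF psi_sol _ _ nz]) (use assms d_pos in auto)
  also have "F (x + d) = (\<rho> E)\<^sup>2 * F x"
    unfolding F_def psi_floquet[OF assms] r_periodic by (simp add: power2_eq_square algebra_simps)
  finally have "F x * (1 - (\<rho> E)\<^sup>2) < 0" by (simp add: algebra_simps)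
  moreover have "(\<rho> E)\<^sup>2 < 1" using rho[OF assms] by (simp add: power_less_one_iff)
  ultimately have "F x < 0" by (simp add: mult_less_0_iff)
  then show ?thesis by (simp add: F_def)
qed

lemma psi_nonzero: "E < E0 \<Longrightarrow> \<psi> E x \<noteq> 0"
  using psi_log_derivative_less[of E x] by auto

lemma psi_pos: assumes "E < E0" shows "\<psi> E x > 0"
proof (rule ccontr)
  have c: "continuous_on A (\<psi> E)" for A by (rule ode_solution_continuous[OF psi_sol])
  assume "\<not> \<psi> E x > 0"
  then have "\<exists>y. \<psi> E y = 0"
    using IVT'[of "\<psi> E" x 0 0, OF _ _ _ c] IVT2'[of "\<psi> E" x 0 0, OF _ _ _ c] by (cases "x \<le> 0") auto
  with psi_nonzero[OF assms] show False by blast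
qed

lemma no_neumann:
  assumes "E < E0" "p' t \<le> 0"
  shows "\<psi>' E t \<noteq> 0"
proof
  assume "\<psi>' E t = 0"
  with psi_log_derivative_less[OF assms(1), of t] have "(\<psi> E t)\<^sup>2 * r t > 0" by simp
  moreover have "r t \<le> 0" using assms(2) p_pos[of t] by (simp add: r_def divide_nonpos_pos)
  ultimately show False by (simp add: zero_less_mult_iff)
qed

text \<open>The Wronskian of \<open>\<psi> E1\<close> and \<open>\<psi> E2\<close> has derivative \<open>(E2 - E1) \<psi> E1 \<psi> E2 > 0\<close>, but it would vanish both at \<open>t\<close> and one
  period later.\<close>

lemma neumann_unique:
  assumes E: "E1 < E2" "E2 < E0" and z: "\<psi>' E1 t = 0" "\<psi>' E2 t = 0"
  shows False
proof -
  define w where "w x = \<psi>' E1 x * \<psi> E2 x - \<psi> E1 x * \<psi>' E2 x" for x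
  have d1: "(\<psi> E has_real_derivative \<psi>' E x) (at x)"
    "(\<psi>' E has_real_derivative (V x - E) * \<psi> E x) (at x)" for x E
    using psi_sol by (auto simp: ode_solution_def)
  have dw: "(w has_real_derivative (E2 - E1) * (\<psi> E1 x * \<psi> E2 x)) (at x)" for x
    unfolding w_def[abs_def] by (rule derivative_eq_intros d1 refl)+ (simp add: algebra_simps)
  have "w t < w (t + d)"
    by (rule DERIV_pos_imp_increasing[where f = w]) (use d_pos dw psi_pos E in \<open>auto intro!: exI dw mult_pos_pos\<close>)
  then show False using psi_floquet[of _ t] E z by (simp add: w_def)
qed

text \<open>Intermediate value theorem in the energy between a very negative \<open>E1\<close> and \<open>E0\<close>, where \<open>\<psi>' E0 = p'\<close>.\<close>

lemma neumann_exists: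
  assumes "p' t > 0"
  shows "\<exists>E<E0. \<psi>' E t = 0"
proof -
  obtain B where B: "B > 0" "\<And>x. \<bar>V x\<bar> \<le> B" using bounded_V by blast
  define E1 where "E1 = min (- B) (E0 - 1)"
  have E1: "E1 < E0" "E1 \<le> - B" by (auto simp: E1_def)
  have conv: "V x - E1 \<ge> 0" for x using B(2)[of x] E1 by linarith
  have d1: "(\<psi> E1 has_real_derivative \<psi>' E1 x) (at x)"
    "(\<psi>' E1 has_real_derivative (V x - E1) * \<psi> E1 x) (at x)" for x
    using psi_sol by (auto simp: ode_solution_def)
  \<comment> \<open>At energy \<open>E1\<close> the positive function \<open>\<psi>\<close> is convex; with a positive slope at \<open>t\<close> it would grow, but it decreases over a period.\<close>
  have neg: "\<psi>' E1 t \<le> 0"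
  proof (rule ccontr)
    assume pos: "\<not> \<psi>' E1 t \<le> 0"
    have "\<psi>' E1 t \<le> \<psi>' E1 x" if "t \<le> x" for x
      by (rule DERIV_nonneg_imp_nondecreasing[OF that, of "\<psi>' E1"])
        (use conv less_imp_le[OF psi_pos[OF E1(1)]] d1 in \<open>auto intro!: exI[of _ "(V _ - E1) * \<psi> E1 _"] mult_nonneg_nonneg\<close>)
    then have "\<psi> E1 t < \<psi> E1 (t + d)"
      using pos d1 d_pos by (intro DERIV_pos_imp_increasing[where f = "\<psi> E1"]) (force intro!: exI[of _ "\<psi>' E1 _"])+
    moreover have "\<psi> E1 (t + d) < \<psi> E1 t"
      using psi_floquet(1)[OF E1(1), of t] rho[OF E1(1)] psi_pos[OF E1(1), of t] by simp
    ultimately show False by simp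
  qed
  have cont_param: "continuous_on A (\<lambda>E. C E x) \<and> continuous_on A (\<lambda>E. C' E x) \<and>
      continuous_on A (\<lambda>E. S E x) \<and> continuous_on A (\<lambda>E. S' E x)" if x: "x \<ge> 0" for A x
  proof -
    have near: "\<exists>\<delta>>0. \<forall>E'. \<bar>E' - E\<bar> < \<delta> \<longrightarrow> \<bar>C E' x - C E x\<bar> < e \<and> \<bar>C' E' x - C' E x\<bar> < e"
      "\<exists>\<delta>>0. \<forall>E'. \<bar>E' - E\<bar> < \<delta> \<longrightarrow> \<bar>S E' x - S E x\<bar> < e \<and> \<bar>S' E' x - S' E x\<bar> < e"
      if e: "e > 0" for e E
      using ode_solution_continuous_parameter[OF C_sol B(2) init(1,2) e, of E x]
        ode_solution_continuous_parameter[OF S_sol B(2) init(3,4) e, of E x] x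
      by (meson atLeastAtMost_iff order_refl)+
    show ?thesis
      unfolding continuous_on_iff dist_real_def using near by meson
  qed
  \<comment> \<open>Continuity in the energy has been shown to the right of the origin only, so \<open>t\<close> is moved there by whole periods.\<close>
  have t0: "\<exists>s\<ge>0. p' s > 0 \<and> (\<forall>E<E0. \<psi>' E s = 0 \<longrightarrow> \<psi>' E t = 0) \<and> \<psi>' E1 s \<le> 0"
  proof -
    obtain n :: nat where n: "real n * d \<ge> - t" using ex_less_of_nat_mult[OF d_pos, of "- t"] less_imp_le by blast
    have fl: "\<psi>' E (t + real n * d) = \<rho> E ^ n * \<psi>' E t" if "E < E0" for E
    proof (induction n)
      case (Suc n)
      have eq: "t + real (Suc n) * d = (t + real n * d) + d" by (simp add: algebra_simps)
      show ?case unfolding eq psi_floquet(2)[OF that] Suc by (simp only: power_Suc mult.assoc)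
    qed simp
    have "p' (t + real n * d) = p' t" using periodic_int[of p' d t "int n", OF p_periodic(2)] by simp
    moreover have "\<psi>' E t = 0" if "E < E0" "\<psi>' E (t + real n * d) = 0" for E
      using fl[OF that(1)] that(2) rho(1)[OF that(1)] by simp
    moreover have "\<psi>' E1 (t + real n * d) \<le> 0"
      unfolding fl[OF E1(1)] using neg rho(1)[OF E1(1)] by (intro mult_nonneg_nonpos) auto
    ultimately show ?thesis using n assms by (intro exI[of _ "t + real n * d"]) auto
  qed
  then obtain s where s: "s \<ge> 0" "p' s > 0" "\<And>E. E < E0 \<Longrightarrow> \<psi>' E s = 0 \<Longrightarrow> \<psi>' E t = 0" "\<psi>' E1 s \<le> 0" by blast
  have "continuous_on {E1..E0} (\<lambda>E. \<psi>' E s)"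
    unfolding \<psi>'_def \<kappa>_def using cont_param[OF s(1)] cont_param[OF less_imp_le[OF d_pos]] S_d(2)
    by (intro continuous_intros) (auto, fastforce)
  moreover have E0s: "\<psi>' E0 s = p' s" by (simp add: \<psi>'_def \<kappa>_def C'_0_d)
  ultimately obtain E where E: "E1 \<le> E" "E \<le> E0" "\<psi>' E s = 0"
    using IVT'[of "\<lambda>E. \<psi>' E s" E1 0 E0] s E1 by auto
  then have "E < E0" using E0s s(2) by (cases "E = E0") auto
  with s(3) E(3) show ?thesis by blast
qed

text \<open>Mean value theorem for \<open>p'\<close>, which vanishes at \<open>0\<close> and \<open>d/2\<close>, to the left and to the right of \<open>x\<close>. A sign of \<open>p' x\<close> forces
  \<open>V - E0\<close> to take opposite signs at \<open>y\<close> and \<open>z\<close>, in an order that contradicts one kind of monotonicity.\<close>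

lemma p'_mean_values:
  assumes x: "0 < x" "x < d/2"
  obtains y z where "0 < y" "y < x" "x < z" "z < d/2"
    "p' x \<ge> 0 \<longrightarrow> V z \<le> E0 \<and> E0 \<le> V y" "p' x \<le> 0 \<longrightarrow> V y \<le> E0 \<and> E0 \<le> V z"
proof -
  have dp: "(p' has_real_derivative (V x - E0) * p x) (at x)" for x
    using C_sol by (auto simp: ode_solution_def)
  obtain y where y: "0 < y" "y < x" "p' x - p' 0 = (x - 0) * ((V y - E0) * p y)"
    using MVT2[OF x(1), of p' "\<lambda>x. (V x - E0) * p x"] dp by blast
  obtain z where z: "x < z" "z < d/2" "p' (d/2) - p' x = (d/2 - x) * ((V z - E0) * p z)"
    using MVT2[OF x(2), of p' "\<lambda>x. (V x - E0) * p x"] dp by blast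
  have y_eq: "p' x = x * ((V y - E0) * p y)" using y(3) by simp
  have z_eq: "- p' x = (d/2 - x) * ((V z - E0) * p z)" using z(3) C'0_half by simp
  have "p' x \<ge> 0 \<longleftrightarrow> E0 \<le> V y" "p' x \<le> 0 \<longleftrightarrow> V y \<le> E0"
    unfolding y_eq using x p_pos[of y] by (auto simp: zero_le_mult_iff mult_le_0_iff)
  moreover have "- p' x \<ge> 0 \<longleftrightarrow> E0 \<le> V z" "- p' x \<le> 0 \<longleftrightarrow> V z \<le> E0"
    unfolding z_eq using x p_pos[of z] by (auto simp: zero_le_mult_iff mult_le_0_iff)
  ultimately show ?thesis using y(1,2) z(1,2) by (intro that[of y z]) auto
qed

lemma p'_sign_mono:
  assumes mono: "strict_mono_on {0..d/2} V" and x: "0 < x" "x < d/2"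
  shows "p' x < 0"
proof (rule ccontr)
  assume neg: "\<not> p' x < 0"
  obtain y z where yz: "0 < y" "y < x" "x < z" "z < d/2"
    "p' x \<ge> 0 \<longrightarrow> V z \<le> E0 \<and> E0 \<le> V y" "p' x \<le> 0 \<longrightarrow> V y \<le> E0 \<and> E0 \<le> V z"
    by (rule p'_mean_values[OF x])
  then have "V y < V z" by (intro strict_mono_onD[OF mono]) auto
  with yz(5) neg show False by simp
qed

lemma p'_sign_antimono:
  assumes anti: "strict_antimono_on {0..d/2} V" and x: "0 < x" "x < d/2"
  shows "p' x > 0"
proof (rule ccontr)
  assume neg: "\<not> p' x > 0"
  obtain y z where yz: "0 < y" "y < x" "x < z" "z < d/2"
    "p' x \<ge> 0 \<longrightarrow> V z \<le> E0 \<and> E0 \<le> V y" "p' x \<le> 0 \<longrightarrow> V y \<le> E0 \<and> E0 \<le> V z"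
    by (rule p'_mean_values[OF x])
  then have "V z < V y" by (intro monotone_onD[OF anti]) auto
  with yz(6) neg show False by simp
qed

end

section \<open>Test functions and mollification\<close>

text \<open>A set of functions that is closed under differentiation consists of smooth functions. This replaces
  computing higher derivatives.\<close>

lemma iterated_deriv_closed:
  assumes S: "\<And>f. f \<in> S \<Longrightarrow> \<exists>g\<in>S. \<forall>x. (f has_real_derivative g x) (at x)" and f: "f \<in> S"
  shows "(deriv ^^ n) f \<in> S"
proof (induction n)
  case (Suc n)
  obtain g where g: "g \<in> S" "\<forall>x. ((deriv ^^ n) f has_real_derivative g x) (at x)"
    using S[OF Suc] by blast
  then have "deriv ((deriv ^^ n) f) = g" by (intro ext DERIV_imp_deriv) blast
  with g(1) show ?case by simp
qed (simp add: f)

lemma iterated_deriv_differentiable: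
  assumes S: "\<And>f. f \<in> S \<Longrightarrow> \<exists>g\<in>S. \<forall>x. (f has_real_derivative g x) (at x)" and f: "f \<in> S"
  shows "(deriv ^^ n) f differentiable_on UNIV"
proof -
  obtain g where g: "\<forall>x. ((deriv ^^ n) f has_real_derivative g x) (at x)"
    using S[OF iterated_deriv_closed[OF S f]] by blast
  show ?thesis
    unfolding differentiable_on_def using g by (auto simp: real_differentiable_def)
qed

lemma DERIV_iterated_deriv:
  fixes f :: "real \<Rightarrow> real"
  assumes "(deriv ^^ n) f differentiable_on UNIV"
  shows "((deriv ^^ n) f has_real_derivative (deriv ^^ Suc n) f x) (at x)"
  using assms by (auto simp: differentiable_on_def DERIV_deriv_iff_real_differentiable)

lemma smooth_continuous:
  fixes f :: "real \<Rightarrow> real"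
  assumes "\<And>n. (deriv ^^ n) f differentiable_on UNIV"
  shows "continuous_on A ((deriv ^^ n) f)"
  using differentiable_imp_continuous_on[OF assms] continuous_on_subset by blast

text \<open>The linear span of these functions is closed under differentiation, also at the origin, where all of them are flat.\<close>

definition exp_decay :: "nat \<Rightarrow> real \<Rightarrow> real" where
  "exp_decay i x = (if x > 0 then (1 / x) ^ i * exp (- (1 / x)) else 0)"

lemma exp_decay_tendsto_0: "(exp_decay i \<longlongrightarrow> 0) (at_right 0)"
proof -
  have "((\<lambda>x::real. x ^ i / exp x) \<longlongrightarrow> 0) at_top" by (rule tendsto_power_div_exp_0)
  from filterlim_compose[OF this filterlim_inverse_at_top_right]
  have "((\<lambda>x::real. inverse x ^ i / exp (inverse x)) \<longlongrightarrow> 0) (at_right 0)" .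
  then show ?thesis
    by (rule Lim_transform_eventually)
      (auto simp: eventually_at_filter exp_decay_def exp_minus divide_inverse)
qed

lemma DERIV_exp_decay:
  "(exp_decay i has_real_derivative exp_decay (i + 2) x - real i * exp_decay (i + 1) x) (at x)"
proof -
  consider "x > 0" | "x < 0" | "x = 0" by linarith
  then show ?thesis
  proof cases
    case 1
    have "((\<lambda>x. (1 / x) ^ i * exp (- (1 / x))) has_real_derivative
        (1 / x) ^ (i + 2) * exp (- (1 / x)) - real i * ((1 / x) ^ (i + 1) * exp (- (1 / x)))) (at x)"
    proof -
      have inv: "((\<lambda>x. 1 / x) has_real_derivative - ((1 / x) * (1 / x))) (at x)"
        using 1 by (auto intro!: derivative_eq_intros simp: field_simps power2_eq_square)
      have "((\<lambda>y. y ^ i * exp (- y)) has_real_derivative (real i * y ^ (i - 1) - y ^ i) * exp (- y)) (at y)" for y :: real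
        by (auto intro!: derivative_eq_intros simp: algebra_simps)
      from DERIV_chain2[where f = "\<lambda>y. y ^ i * exp (- y)" and g = "\<lambda>x. 1 / x", OF this inv]
      have d: "((\<lambda>x. (1 / x) ^ i * exp (- (1 / x))) has_real_derivative
        (real i * (1 / x) ^ (i - 1) - (1 / x) ^ i) * exp (- (1 / x)) * - ((1 / x) * (1 / x))) (at x)" .
      have eq: "(real i * y ^ (i - 1) - y ^ i) * E * - (y * y) = y ^ (i + 2) * E - real i * (y ^ (i + 1) * E)" for y E :: real
        by (cases i) (simp_all add: algebra_simps)
      show ?thesis using d unfolding eq .
    qed
    then have "((\<lambda>x. (1 / x) ^ i * exp (- (1 / x))) has_real_derivative
        exp_decay (i + 2) x - real i * exp_decay (i + 1) x) (at x)"
      using 1 by (simp add: exp_decay_def)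
    then show ?thesis
      by (rule has_field_derivative_transform_within_open[of _ _ _ "{0<..}"]) (use 1 in \<open>auto simp: exp_decay_def\<close>)
  next
    case 2
    have "((\<lambda>x. 0) has_real_derivative exp_decay (i + 2) x - real i * exp_decay (i + 1) x) (at x)"
      using 2 by (simp add: exp_decay_def)
    then show ?thesis
      by (rule has_field_derivative_transform_within_open[of _ _ _ "{..<0}"]) (use 2 in \<open>auto simp: exp_decay_def\<close>)
  next
    case 3
    have "((\<lambda>h. (exp_decay i (0 + h) - exp_decay i 0) / h) \<longlongrightarrow> 0) (at 0)"
    proof (rule filterlim_split_at)
      show "((\<lambda>h. (exp_decay i (0 + h) - exp_decay i 0) / h) \<longlongrightarrow> 0) (at_left 0)"
        by (rule Lim_transform_eventually[OF tendsto_const]) (auto simp: eventually_at_filter exp_decay_def)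
      show "((\<lambda>h. (exp_decay i (0 + h) - exp_decay i 0) / h) \<longlongrightarrow> 0) (at_right 0)"
        by (rule Lim_transform_eventually[OF exp_decay_tendsto_0[of "Suc i"]])
          (auto simp: eventually_at_filter exp_decay_def)
    qed
    then show ?thesis unfolding 3 DERIV_def by (simp add: exp_decay_def)
  qed
qed


text \<open>The linear span of the products that vanish outside \<open>(0, 1)\<close>; it is closed under differentiation and contains a
  bump function.\<close>

inductive_set bump_space :: "(real \<Rightarrow> real) set" where
  base: "(\<lambda>x. exp_decay i x * exp_decay j (1 - x)) \<in> bump_space"
| add: "f \<in> bump_space \<Longrightarrow> g \<in> bump_space \<Longrightarrow> (\<lambda>x. f x + g x) \<in> bump_space"
| scale: "f \<in> bump_space \<Longrightarrow> (\<lambda>x. c * f x) \<in> bump_space"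

lemma bump_space_deriv:
  "f \<in> bump_space \<Longrightarrow> \<exists>g\<in>bump_space. \<forall>x. (f has_real_derivative g x) (at x)"
proof (induction rule: bump_space.induct)
  case (base i j)
  let ?P = "\<lambda>i j x. exp_decay i x * exp_decay j (1 - x)"
  let ?g = "\<lambda>x. (?P (i + 2) j x + (- real i) * ?P (i + 1) j x) + ((-1) * ?P i (j + 2) x + real j * ?P i (j + 1) x)"
  have "(?P i j has_real_derivative ?g x) (at x)" for x
    using DERIV_mult[OF DERIV_exp_decay[of i x] DERIV_reflect[OF DERIV_exp_decay[of j], of 1 x]]
    by (simp add: algebra_simps)
  moreover have "?g \<in> bump_space"
    by (intro bump_space.intros)
  ultimately show ?case by (intro bexI[of _ ?g] allI)
next
  case (add f g)
  then obtain f' g' where "f' \<in> bump_space" "g' \<in> bump_space"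
    "\<forall>x. (f has_real_derivative f' x) (at x)" "\<forall>x. (g has_real_derivative g' x) (at x)" by blast
  then show ?case by (intro bexI[of _ "\<lambda>x. f' x + g' x"] allI DERIV_add bump_space.intros) auto
next
  case (scale f c)
  then obtain f' where "f' \<in> bump_space" "\<forall>x. (f has_real_derivative f' x) (at x)" by blast
  then show ?case by (intro bexI[of _ "\<lambda>x. c * f' x"] allI DERIV_cmult bump_space.intros) auto
qed

lemma compact_support_integral:
  fixes f :: "real \<Rightarrow> real"
  assumes cont: "continuous_on UNIV f" and supp: "\<And>x. x \<notin> {a..b} \<Longrightarrow> f x = 0"
  shows "integrable lborel f" "(LINT x|lborel. f x) = integral {a..b} f"
proof -
  have eq: "f = (\<lambda>x. indicator {a..b} x *\<^sub>R f x)" using supp by (auto simp: fun_eq_iff indicator_def)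
  have c: "continuous_on {a..b} f" using cont continuous_on_subset by blast
  have 1: "set_integrable lborel {a..b} f" by (rule borel_integrable_atLeastAtMost'[OF c])
  then show "integrable lborel f" unfolding set_integrable_def using eq by simp
  show "(LINT x|lborel. f x) = integral {a..b} f"
    using set_borel_integral_eq_integral(2)[OF 1] eq unfolding set_lebesgue_integral_def by metis
qed

lemma bump_exists:
  "\<exists>\<eta>::real \<Rightarrow> real. (\<forall>n. (deriv ^^ n) \<eta> differentiable_on UNIV) \<and> (\<forall>x. \<eta> x \<ge> 0) \<and>
     (\<forall>x. x \<notin> {0..1} \<longrightarrow> \<eta> x = 0) \<and> integral {0..1} \<eta> = 1"
proof -
  define b where "b x = exp_decay 0 x * exp_decay 0 (1 - x)" for x
  have b: "b \<in> bump_space" using bump_space.base[of 0 0] by (simp add: b_def[abs_def])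
  have supp: "b x = 0" if "x \<notin> {0..1}" for x using that by (auto simp: b_def exp_decay_def)
  have nn: "b x \<ge> 0" for x by (simp add: b_def exp_decay_def)
  have cont: "continuous_on A b" for A
    using bump_space_deriv[OF b] DERIV_imp_continuous_on[of b] by blast
  have "b (1/2) > 0" by (simp add: b_def exp_decay_def)
  then have "integral {0..1} b \<noteq> 0"
    using integral_eq_0_iff[of 0 1 b] cont nn by force
  moreover have "integral {0..1} b \<ge> 0" by (intro integral_nonneg integrable_continuous_real cont nn)
  ultimately have pos: "integral {0..1} b > 0" by simp
  define \<eta> where "\<eta> x = (1 / integral {0..1} b) * b x" for x
  have \<eta>: "\<eta> \<in> bump_space" unfolding \<eta>_def[abs_def] by (rule bump_space.scale[OF b])
  have "integral {0..1} \<eta> = 1" unfolding \<eta>_def[abs_def] using pos by (subst integral_mult_right) simp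
  moreover have "(deriv ^^ n) \<eta> differentiable_on UNIV" for n
    by (rule iterated_deriv_differentiable[OF bump_space_deriv \<eta>])
  moreover have "\<eta> x \<ge> 0" "x \<notin> {0..1} \<Longrightarrow> \<eta> x = 0" for x using nn[of x] supp[of x] pos by (auto simp: \<eta>_def)
  ultimately show ?thesis by blast
qed

definition bump :: "real \<Rightarrow> real" where
  "bump = (SOME \<eta>. (\<forall>n. (deriv ^^ n) \<eta> differentiable_on UNIV) \<and> (\<forall>x. \<eta> x \<ge> 0) \<and>
     (\<forall>x. x \<notin> {0..1} \<longrightarrow> \<eta> x = 0) \<and> integral {0..1} \<eta> = 1)"

lemma bump:
  "(deriv ^^ n) bump differentiable_on UNIV" "bump x \<ge> 0" "x \<notin> {0..1} \<Longrightarrow> bump x = 0"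
  "integral {0..1} bump = 1"
  using someI_ex[OF bump_exists] unfolding bump_def[symmetric] by auto

text \<open>Averaging over a one-sided window \<open>[x - e, x]\<close>. In this form the derivative falls on \<open>g\<close>; \<open>mollify_eq\<close> is
  the form in which it falls on the smooth bump.\<close>

definition mollify :: "real \<Rightarrow> (real \<Rightarrow> real) \<Rightarrow> real \<Rightarrow> real" where
  "mollify e g x = integral {0..1} (\<lambda>z. g (x - e * z) * bump z)"

lemma continuous_bump: "continuous_on A bump"
  using smooth_continuous[of bump A 0] bump(1) by simp

lemma DERIV_mollify:
  assumes g: "\<And>x. (g has_real_derivative g' x) (at x)" and g': "continuous_on UNIV g'"
  shows "(mollify e g has_real_derivative mollify e g' x) (at x)"
proof -
  have cg: "continuous_on A g" for A by (rule DERIV_imp_continuous_on[OF g])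
  have "((\<lambda>x. integral (cbox 0 1) (\<lambda>z. g (x - e * z) * bump z)) has_real_derivative
     integral (cbox 0 1) (\<lambda>z. g' (x - e * z) * bump z)) (at x within UNIV)"
  proof (rule leibniz_rule_field_derivative)
    show "((\<lambda>x. g (x - e * t) * bump t) has_real_derivative g' (x - e * t) * bump t) (at x within UNIV)" for x t
      using DERIV_cmult_right[OF DERIV_translate[OF g, of "- (e * t)" x], of "bump t"] by simp
    show "(\<lambda>z. g (x - e * z) * bump z) integrable_on cbox 0 1" for x
      unfolding cbox_interval
      by (intro integrable_continuous_real continuous_intros continuous_bump continuous_on_compose2[OF cg[of UNIV]]) auto
    show "continuous_on (UNIV \<times> cbox 0 1) (\<lambda>(x, z). g' (x - e * z) * bump z)"
      unfolding split_beta
      by (intro continuous_intros continuous_on_compose2[OF g'] continuous_on_compose2[OF continuous_bump[of UNIV]]) auto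
  qed auto
  then show ?thesis by (simp add: mollify_def[abs_def] cbox_interval)
qed

lemma mollify_eq:
  assumes e: "e > 0" and cont: "continuous_on UNIV g" and supp: "\<And>x. x \<notin> {a..b} \<Longrightarrow> g x = 0"
  shows "mollify e g x = (1 / e) * integral {a..b} (\<lambda>y. g y * bump ((x - y) / e))"
proof -
  have c1: "continuous_on UNIV (\<lambda>z. g (x - e * z) * bump z)"
    by (intro continuous_intros continuous_bump continuous_on_compose2[OF cont]) auto
  have c2: "continuous_on UNIV (\<lambda>y. g y * bump ((x - y) / e))"
    using e by (intro continuous_intros cont continuous_on_compose2[OF continuous_bump[of UNIV]]) auto
  have "mollify e g x = (LINT z|lborel. g (x - e * z) * bump z)"
    unfolding mollify_def by (rule compact_support_integral(2)[symmetric, OF c1]) (use bump(3) in auto)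
  also have "(LINT y|lborel. g y * bump ((x - y) / e)) = \<bar>- e\<bar> *\<^sub>R (LINT z|lborel. g (x + (- e) * z) * bump ((x - (x + (- e) * z)) / e))"
    using e by (intro lborel_integral_real_affine) auto
  then have "(LINT z|lborel. g (x - e * z) * bump z) = (1 / e) * (LINT y|lborel. g y * bump ((x - y) / e))"
    using e by simp
  also have "(LINT y|lborel. g y * bump ((x - y) / e)) = integral {a..b} (\<lambda>y. g y * bump ((x - y) / e))"
    by (rule compact_support_integral(2)[OF c2]) (use supp in auto)
  finally show ?thesis .
qed

lemma mollify_support:
  assumes e: "0 < e" "e \<le> 1" and supp: "\<And>x. \<bar>x\<bar> > R \<Longrightarrow> g x = 0" and x: "\<bar>x\<bar> > R + 1"
  shows "mollify e g x = 0"
proof -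
  have "((\<lambda>z. g (x - e * z) * bump z) has_integral 0) {0..1}"
  proof (rule has_integral_is_0)
    fix z :: real assume z: "z \<in> {0..1}"
    have "\<bar>e * z\<bar> \<le> 1" using e z by (auto simp: abs_mult intro: mult_le_one)
    then have "\<bar>x - e * z\<bar> > R" using x by linarith
    then show "g (x - e * z) * bump z = 0" using supp by simp
  qed
  then show ?thesis unfolding mollify_def by (rule integral_unique)
qed

lemma mollify_approx:
  assumes cont: "continuous_on UNIV g" and w: "\<And>y. y \<in> {x - e..x} \<Longrightarrow> \<bar>g y - g x\<bar> \<le> w" and e: "e > 0"
  shows "\<bar>mollify e g x - g x\<bar> \<le> w"
proof -
  have c1: "(\<lambda>z. g (x - e * z) * bump z) integrable_on {0..1}"
    by (intro integrable_continuous_real continuous_intros continuous_bump continuous_on_compose2[OF cont]) auto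
  have c2: "(\<lambda>z. g x * bump z) integrable_on {0..1}"
    by (intro integrable_continuous_real continuous_intros continuous_bump)
  have c3: "(\<lambda>z. w * bump z) integrable_on {0..1}"
    by (intro integrable_continuous_real continuous_intros continuous_bump)
  have "mollify e g x - g x = integral {0..1} (\<lambda>z. g (x - e * z) * bump z) - integral {0..1} (\<lambda>z. g x * bump z)"
    by (simp add: mollify_def bump(4))
  also have "\<dots> = integral {0..1} (\<lambda>z. (g (x - e * z) - g x) * bump z)"
    using integral_diff[OF c1 c2] by (simp add: left_diff_distrib)
  also have "norm \<dots> \<le> integral {0..1} (\<lambda>z. w * bump z)"
  proof (rule integral_norm_bound_integral[OF _ c3])
    show "(\<lambda>z. (g (x - e * z) - g x) * bump z) integrable_on {0..1}"
      using integrable_diff[OF c1 c2] by (simp add: left_diff_distrib)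
    fix z :: real assume "z \<in> {0..1}"
    then have "x - e * z \<in> {x - e..x}" using e by (auto simp: mult_left_le)
    from mult_right_mono[OF w[OF this] bump(2)[of z]]
    show "norm ((g (x - e * z) - g x) * bump z) \<le> w * bump z"
      using bump(2)[of z] by (simp add: abs_mult)
  qed
  also have "\<dots> = w" by (simp add: bump(4))
  finally show ?thesis by simp
qed

lemma test_function_mollify:
  assumes e: "0 < e" "e \<le> 1" and cont: "continuous_on UNIV g" and supp: "\<And>x. \<bar>x\<bar> > R \<Longrightarrow> g x = 0"
  shows "test_function (mollify e g)"
proof -
  define H where "H c n x = c * integral {-R..R} (\<lambda>y. g y * (deriv ^^ n) bump ((x - y) / e))" for c n x
  have D: "\<exists>g\<in>{H c n |c n. True}. \<forall>x. (f has_real_derivative g x) (at x)" if f: "f \<in> {H c n |c n. True}" for f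
  proof -
    obtain c n where f: "f = H c n" using f by blast
    have cb: "continuous_on UNIV ((deriv ^^ n) bump)" for n by (rule smooth_continuous[OF bump(1)])
    have "((\<lambda>x. integral (cbox (-R) R) (\<lambda>y. g y * (deriv ^^ n) bump ((x - y) / e))) has_real_derivative
       integral (cbox (-R) R) (\<lambda>y. g y * ((deriv ^^ Suc n) bump ((x - y) / e) * (1 / e)))) (at x within UNIV)" for x
    proof (rule leibniz_rule_field_derivative)
      fix x t
      have "((\<lambda>x. (x - t) / e) has_real_derivative 1 / e) (at x)"
        using e by (auto intro!: derivative_eq_intros)
      from DERIV_cmult[OF DERIV_chain2[where f = "(deriv ^^ n) bump" and g = "\<lambda>x. (x - t) / e", OF DERIV_iterated_deriv[OF bump(1)] this], of "g t"]
      show "((\<lambda>x. g t * (deriv ^^ n) bump ((x - t) / e)) has_real_derivative g t * ((deriv ^^ Suc n) bump ((x - t) / e) * (1 / e)))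
         (at x within UNIV)" by simp
    next
      show "(\<lambda>y. g y * (deriv ^^ n) bump ((x - y) / e)) integrable_on cbox (- R) R" for x
        unfolding cbox_interval using e
        by (intro integrable_continuous_real continuous_intros continuous_on_compose2[OF cb] continuous_on_subset[OF cont]) auto
      show "continuous_on (UNIV \<times> cbox (- R) R) (\<lambda>(x, y). g y * ((deriv ^^ Suc n) bump ((x - y) / e) * (1 / e)))"
        unfolding split_beta using e
        by (intro continuous_intros continuous_on_compose2[OF cb] continuous_on_compose2[OF cont]) auto
    qed auto
    then have d: "((\<lambda>x. integral {-R..R} (\<lambda>y. g y * (deriv ^^ n) bump ((x - y) / e))) has_real_derivative
       (1 / e) * integral {-R..R} (\<lambda>y. g y * (deriv ^^ Suc n) bump ((x - y) / e))) (at x)" for x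
      by (simp add: cbox_interval)
    have "(H c n has_real_derivative H (c / e) (Suc n) x) (at x)" for x
      unfolding H_def[abs_def] using DERIV_cmult[OF d, of c x] by simp
    then show ?thesis unfolding f by blast
  qed
  have "mollify e g = H (1 / e) 0"
    unfolding H_def[abs_def] by (rule ext, subst mollify_eq[OF e(1) cont, of "-R" R]) (use supp in auto)
  then have m: "mollify e g \<in> {H c n |c n. True}" by blast
  have "closure {x. mollify e g x \<noteq> 0} \<subseteq> {- (R + 1)..R + 1}"
    using mollify_support[OF e supp] by (intro closure_minimal) (force simp: abs_le_iff not_less[symmetric])+
  then have "compact (closure {x. mollify e g x \<noteq> 0})"
    by (metis closed_closure compact_Icc compact_Int_closed inf.absorb_iff2)
  then show ?thesis unfolding test_function_def
    using iterated_deriv_differentiable[OF D m] by blast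
qed

lemma compact_support_uniformly_continuous:
  fixes g :: "real \<Rightarrow> real"
  assumes cont: "continuous_on UNIV g" and supp: "\<And>x. \<bar>x\<bar> > R \<Longrightarrow> g x = 0" and w: "w > 0"
  shows "\<exists>e>0. \<forall>x y. \<bar>y - x\<bar> \<le> e \<longrightarrow> \<bar>g y - g x\<bar> \<le> w"
proof -
  have "uniformly_continuous_on {-R-1..R+1} g"
    by (intro compact_uniformly_continuous continuous_on_subset[OF cont]) auto
  then obtain e where e: "e > 0" "\<And>x y. x \<in> {-R-1..R+1} \<Longrightarrow> y \<in> {-R-1..R+1} \<Longrightarrow> \<bar>y - x\<bar> < e \<Longrightarrow> \<bar>g y - g x\<bar> < w"
    unfolding uniformly_continuous_on_def dist_real_def using w by meson
  have "\<bar>g y - g x\<bar> \<le> w" if "\<bar>y - x\<bar> \<le> min (e/2) 1" for x y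
  proof (cases "\<bar>x\<bar> \<le> R \<or> \<bar>y\<bar> \<le> R")
    case True
    then have "x \<in> {-R-1..R+1}" "y \<in> {-R-1..R+1}" using that by (auto simp: abs_le_iff)
    then show ?thesis using e(2)[of x y] that e(1) by force
  next
    case False
    then show ?thesis using supp[of x] supp[of y] w by simp
  qed
  then show ?thesis using e(1) by (intro exI[of _ "min (e/2) 1"]) auto
qed

text \<open>Mollification commutes with differentiation, so one mollified function approximates \<open>g\<close> together with \<open>g''\<close>. This is
  how weak equations, which are tested with smooth functions only, are extended to twice differentiable ones.\<close>

lemma C2_approx_test_function:
  assumes D: "\<And>x. (g has_real_derivative g1 x) (at x)" "\<And>x. (g1 has_real_derivative g2 x) (at x)"
    and cont: "continuous_on UNIV g2" and supp: "\<And>x. \<bar>x\<bar> > R \<Longrightarrow> g x = 0 \<and> g2 x = 0" and w: "w > 0"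
  shows "\<exists>\<phi>. test_function \<phi> \<and> (\<forall>x. \<bar>x\<bar> > R + 1 \<longrightarrow> \<phi> x = 0 \<and> (deriv ^^ 2) \<phi> x = 0) \<and>
    (\<forall>x. \<bar>\<phi> x - g x\<bar> \<le> w \<and> \<bar>(deriv ^^ 2) \<phi> x - g2 x\<bar> \<le> w)"
proof -
  have c: "continuous_on UNIV g" "continuous_on UNIV g1"
    by (rule DERIV_imp_continuous_on, rule D)+
  obtain e1 where e1: "e1 > 0" "\<And>x y. \<bar>y - x\<bar> \<le> e1 \<Longrightarrow> \<bar>g y - g x\<bar> \<le> w"
    using compact_support_uniformly_continuous[OF c(1) _ w, of R] supp by blast
  obtain e2 where e2: "e2 > 0" "\<And>x y. \<bar>y - x\<bar> \<le> e2 \<Longrightarrow> \<bar>g2 y - g2 x\<bar> \<le> w"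
    using compact_support_uniformly_continuous[OF cont _ w, of R] supp by blast
  define e where "e = min 1 (min e1 e2)"
  have e: "0 < e" "e \<le> 1" "e \<le> e1" "e \<le> e2" using e1(1) e2(1) by (auto simp: e_def)
  have "deriv (mollify e g) = mollify e g1" "deriv (mollify e g1) = mollify e g2"
    by (intro ext DERIV_imp_deriv DERIV_mollify D c cont)+
  then have d2: "(deriv ^^ 2) (mollify e g) = mollify e g2" by (simp add: numeral_2_eq_2)
  have "\<bar>mollify e g x - g x\<bar> \<le> w" for x
    by (rule mollify_approx[OF c(1) _ e(1)]) (use e1(2) e in auto)
  moreover have "\<bar>mollify e g2 x - g2 x\<bar> \<le> w" for x
    by (rule mollify_approx[OF cont _ e(1)]) (use e2(2) e in auto)
  ultimately show ?thesis
    using mollify_support[OF e(1,2), of R g] mollify_support[OF e(1,2), of R g2] supp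
      test_function_mollify[OF e(1,2) c(1), of R]
    by (intro exI[of _ "mollify e g"]) (auto simp: d2)
qed

lemma continuous_approx_test_function:
  assumes cont: "continuous_on UNIV g" and supp: "\<And>x. \<bar>x\<bar> > R \<Longrightarrow> g x = 0" and w: "w > 0"
  shows "\<exists>\<phi>. test_function \<phi> \<and> (\<forall>x. \<bar>x\<bar> > R + 1 \<longrightarrow> \<phi> x = 0) \<and> (\<forall>x. \<bar>\<phi> x - g x\<bar> \<le> w)"
proof -
  obtain e1 where e1: "e1 > 0" "\<And>x y. \<bar>y - x\<bar> \<le> e1 \<Longrightarrow> \<bar>g y - g x\<bar> \<le> w"
    using compact_support_uniformly_continuous[OF cont _ w, of R] supp by blast
  define e where "e = min 1 e1"
  have e: "0 < e" "e \<le> 1" "e \<le> e1" using e1(1) by (auto simp: e_def)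
  have "\<bar>mollify e g x - g x\<bar> \<le> w" for x
    by (rule mollify_approx[OF cont _ e(1)]) (use e1(2) e in auto)
  moreover have "mollify e g x = 0" if "\<bar>x\<bar> > R + 1" for x
    by (rule mollify_support[OF e(1,2) supp that])
  moreover have "test_function (mollify e g)" by (rule test_function_mollify[OF e(1,2) cont supp])
  ultimately show ?thesis by (intro exI[of _ "mollify e g"]) simp
qed

section \<open>Square-integrable functions and weak derivatives\<close>

lemma L2D: "u \<in> L2 \<Longrightarrow> u \<in> borel_measurable borel" "u \<in> L2 \<Longrightarrow> integrable lborel (\<lambda>x. (cmod (u x))\<^sup>2)"
  by (auto simp: L2_def)

lemma L2_dominated:
  assumes v: "v \<in> L2" and u: "u \<in> borel_measurable borel" and le: "\<And>x. cmod (u x) \<le> c * cmod (v x)"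
  shows "u \<in> L2"
proof -
  have "integrable lborel (\<lambda>x. (cmod (u x))\<^sup>2)"
  proof (rule Bochner_Integration.integrable_bound)
    show "integrable lborel (\<lambda>x. c\<^sup>2 * (cmod (v x))\<^sup>2)" using L2D(2)[OF v] by simp
    show "(\<lambda>x. (cmod (u x))\<^sup>2) \<in> borel_measurable lborel" using u by measurable
    show "AE x in lborel. norm ((cmod (u x))\<^sup>2) \<le> norm (c\<^sup>2 * (cmod (v x))\<^sup>2)"
      using power_mono[OF le norm_ge_zero, of _ 2] by (auto simp: power_mult_distrib)
  qed
  then show ?thesis using u by (simp add: L2_def)
qed

lemma L2_diff:
  assumes u: "u \<in> L2" and v: "v \<in> L2"
  shows "(\<lambda>x. u x - v x) \<in> L2"
proof -
  note [measurable] = L2D(1)[OF u] L2D(1)[OF v]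
  have "integrable lborel (\<lambda>x. (cmod (u x - v x))\<^sup>2)"
  proof (rule Bochner_Integration.integrable_bound)
    show "integrable lborel (\<lambda>x. 2 * (cmod (u x))\<^sup>2 + 2 * (cmod (v x))\<^sup>2)"
      using L2D(2)[OF u] L2D(2)[OF v] by simp
    have "(cmod (a - b))\<^sup>2 \<le> 2 * (cmod a)\<^sup>2 + 2 * (cmod b)\<^sup>2" for a b
    proof -
      have "(cmod (a - b))\<^sup>2 \<le> (cmod a + cmod b)\<^sup>2" by (intro power_mono norm_triangle_ineq4) auto
      also have "\<dots> \<le> 2 * (cmod a)\<^sup>2 + 2 * (cmod b)\<^sup>2"
        using sum_squares_bound[of "cmod a" "cmod b"] by (simp add: power2_sum)
      finally show ?thesis .
    qed
    then show "AE x in lborel. norm ((cmod (u x - v x))\<^sup>2) \<le> norm (2 * (cmod (u x))\<^sup>2 + 2 * (cmod (v x))\<^sup>2)"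
      by auto
  qed measurable
  then show ?thesis by (simp add: L2_def)
qed

lemma L2_mult_integrable:
  assumes u: "u \<in> L2" and v: "v \<in> L2"
  shows "integrable lborel (\<lambda>x. u x * v x)"
proof -
  note [measurable] = L2D(1)[OF u] L2D(1)[OF v]
  show ?thesis
  proof (rule Bochner_Integration.integrable_bound)
    show "integrable lborel (\<lambda>x. (cmod (u x))\<^sup>2 + (cmod (v x))\<^sup>2)"
      using L2D(2)[OF u] L2D(2)[OF v] by simp
    have "a * b \<le> a\<^sup>2 + b\<^sup>2" if "a \<ge> 0" "b \<ge> 0" for a b :: real
      using sum_squares_bound[of a b] mult_nonneg_nonneg[OF that] by linarith
    then show "AE x in lborel. norm (u x * v x) \<le> norm ((cmod (u x))\<^sup>2 + (cmod (v x))\<^sup>2)"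
      by (auto simp: norm_mult)
  qed measurable
qed

lemma nn_integral_exp_abs_finite:
  assumes k: "k > 0"
  shows "(\<integral>\<^sup>+y. ennreal (exp (- k * \<bar>y\<bar>)) \<partial>lborel) < \<infinity>"
proof -
  define I where "I = (\<integral>\<^sup>+y. ennreal (exp (- k * y)) * indicator {0..} y \<partial>lborel)"
  have "((\<lambda>y. - exp (- k * y) / k) \<longlongrightarrow> - 0 / k) at_top"
  proof (intro tendsto_intros)
    have "filterlim (\<lambda>y. - k * y) at_bot at_top"
      by (rule filterlim_tendsto_neg_mult_at_bot[OF tendsto_const _ filterlim_ident]) (use k in simp)
    then show "((\<lambda>y. exp (- k * y)) \<longlongrightarrow> 0) at_top" by (rule filterlim_compose[OF exp_at_bot])
  qed (use k in simp)
  then have "I = ennreal (0 - (- exp (- k * 0) / k))" unfolding I_def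
    by (intro nn_integral_FTC_atLeast) (use k in \<open>auto intro!: derivative_eq_intros simp: field_simps\<close>)
  then have I: "I < \<infinity>" by simp
  have I2: "I = (\<integral>\<^sup>+y. ennreal (exp (k * y)) * indicator {..0} y \<partial>lborel)"
    unfolding I_def
    by (subst nn_integral_real_affine[of _ "-1" 0]) (auto intro!: nn_integral_cong simp: indicator_def)
  have "(\<integral>\<^sup>+y. ennreal (exp (- k * \<bar>y\<bar>)) \<partial>lborel) \<le>
     (\<integral>\<^sup>+y. ennreal (exp (- k * y)) * indicator {0..} y + ennreal (exp (k * y)) * indicator {..0} y \<partial>lborel)"
    by (intro nn_integral_mono) (auto simp: indicator_def abs_if)
  also have "\<dots> = I + I" by (subst nn_integral_add, measurable) (simp only: I_def[symmetric] I2[symmetric])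
  also have "\<dots> < \<infinity>" using I by simp
  finally show ?thesis .
qed

lemma L2_exp_bound:
  assumes f: "f \<in> borel_measurable borel" and k: "k > 0" and le: "\<And>x. cmod (f x) \<le> M * exp (- k * \<bar>x\<bar>)"
  shows "f \<in> L2"
proof -
  have "integrable lborel (\<lambda>x. exp (- (2 * k) * \<bar>x\<bar>))"
    using nn_integral_exp_abs_finite[of "2 * k"] k by (intro integrableI_nonneg) auto
  then have "integrable lborel (\<lambda>x. M\<^sup>2 * exp (- (2 * k) * \<bar>x\<bar>))" by simp
  then have "integrable lborel (\<lambda>x. (cmod (f x))\<^sup>2)"
  proof (rule Bochner_Integration.integrable_bound)
    have "(cmod (f x))\<^sup>2 \<le> M\<^sup>2 * exp (- (2 * k) * \<bar>x\<bar>)" for x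
      using power_mono[OF le norm_ge_zero, of x 2] by (simp add: power_mult_distrib exp_double[symmetric] mult.assoc)
    then show "AE x in lborel. norm ((cmod (f x))\<^sup>2) \<le> norm (M\<^sup>2 * exp (- (2 * k) * \<bar>x\<bar>))"
      by auto
  qed (use f in measurable)
  then show ?thesis using f by (simp add: L2_def)
qed

lemma L2_bounded_support:
  assumes f: "f \<in> borel_measurable borel" and le: "\<And>x. cmod (f x) \<le> M" and supp: "\<And>x. \<bar>x\<bar> > R \<Longrightarrow> f x = 0"
  shows "f \<in> L2"
proof (rule L2_exp_bound[OF f, where k = 1 and M = "M * exp R"])
  have M: "M \<ge> 0" using le[of 0] norm_ge_zero order_trans by blast
  show "cmod (f x) \<le> M * exp R * exp (- 1 * \<bar>x\<bar>)" for x
  proof (cases "\<bar>x\<bar> > R")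
    case False
    have "M * 1 \<le> M * exp (R - \<bar>x\<bar>)" using False M by (intro mult_left_mono) auto
    then show ?thesis using le[of x] by (simp add: exp_diff exp_minus divide_inverse)
  qed (use supp M in auto)
qed simp

lemma compact_support_bounded:
  fixes g :: "real \<Rightarrow> real"
  assumes cont: "continuous_on UNIV g" and supp: "\<And>x. \<bar>x\<bar> > R \<Longrightarrow> g x = 0"
  shows "\<exists>M>0. \<forall>x. \<bar>g x\<bar> \<le> M"
proof -
  have "compact (g ` {-R..R})"
    by (intro compact_continuous_image continuous_on_subset[OF cont]) auto
  then obtain M where M: "M > 0" "\<And>x. x \<in> {-R..R} \<Longrightarrow> \<bar>g x\<bar> \<le> M"
    by (metis bounded_pos compact_imp_bounded imageI real_norm_def)
  have "\<bar>g x\<bar> \<le> M" for x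
  proof (cases "\<bar>x\<bar> > R")
    case False
    then have "-R \<le> x" "x \<le> R" by linarith+
    then show ?thesis using M(2)[of x] by simp
  qed (use supp M in simp)
  with M(1) show ?thesis by blast
qed

lemma borel_measurable_continuous:
  fixes g :: "real \<Rightarrow> real" assumes "continuous_on UNIV g" shows "g \<in> borel_measurable borel"
  by (rule borel_measurable_continuous_onI[OF assms])

lemma L2_continuous_support:
  assumes cont: "continuous_on UNIV g" and supp: "\<And>x. \<bar>x\<bar> > R \<Longrightarrow> g x = 0"
  shows "(\<lambda>x. complex_of_real (g x)) \<in> L2"
proof -
  note [measurable] = borel_measurable_continuous[OF cont]
  obtain M where "\<And>x. \<bar>g x\<bar> \<le> M" using compact_support_bounded[OF cont supp] by blast
  then show ?thesis by (intro L2_bounded_support[of _ M R]) (use supp in auto)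
qed

text \<open>On a bounded set a square-integrable function is integrable, so uniform convergence suffices.\<close>

lemma L2_uniform_limit_integral:
  assumes u: "u \<in> L2" and h: "continuous_on UNIV h" and hn: "\<And>n. continuous_on UNIV (s n)"
    and supp: "\<And>x. \<bar>x\<bar> > R \<Longrightarrow> h x = 0" "\<And>n x. \<bar>x\<bar> > R \<Longrightarrow> s n x = 0"
    and le: "\<And>n x. \<bar>s n x - h x\<bar> \<le> 1 / real (Suc n)"
  shows "(\<lambda>n. LINT x|lborel. u x * complex_of_real (s n x)) \<longlonglongrightarrow> (LINT x|lborel. u x * complex_of_real (h x))"
proof -
  note [measurable] = L2D(1)[OF u] borel_measurable_continuous[OF h] borel_measurable_continuous[OF hn]
  obtain M where M: "M > 0" "\<And>x. \<bar>h x\<bar> \<le> M" using compact_support_bounded[OF h supp(1)] by blast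
  show ?thesis
  proof (rule integral_dominated_convergence)
    let ?w = "\<lambda>x. complex_of_real ((M + 1) * indicator {-R..R} x)"
    have "?w \<in> L2"
      by (rule L2_bounded_support[of _ "M + 1" R]) (use M(1) in \<open>auto simp: indicator_def\<close>)
    from L2_mult_integrable[OF u this]
    show "integrable lborel (\<lambda>x. cmod (u x * ?w x))" by (rule integrable_norm)
    show "(\<lambda>x. u x * complex_of_real (h x)) \<in> borel_measurable lborel" by measurable
    show "(\<lambda>x. u x * complex_of_real (s n x)) \<in> borel_measurable lborel" for n by measurable
    have "(\<lambda>n. s n x) \<longlonglongrightarrow> h x" for x
    proof -
      have "(\<lambda>n. s n x - h x) \<longlonglongrightarrow> 0"
        by (rule Lim_null_comparison[OF _ LIMSEQ_Suc[OF lim_1_over_n]]) (use le in auto)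
      then show ?thesis by (simp add: LIM_zero_iff)
    qed
    then show "AE x in lborel. (\<lambda>n. u x * complex_of_real (s n x)) \<longlonglongrightarrow> u x * complex_of_real (h x)"
      by (intro always_eventually allI tendsto_intros)
    have "\<bar>s n x\<bar> \<le> (M + 1) * indicator {-R..R} x" for n x
    proof (cases "\<bar>x\<bar> > R")
      case False
      have "1 / real (Suc n) \<le> 1" by simp
      with le[of n x] M(2)[of x] have "\<bar>s n x\<bar> \<le> M + 1" by linarith
      then show ?thesis using False by (auto simp: indicator_def abs_le_iff)
    qed (use supp(2) M(1) in \<open>auto simp: indicator_def\<close>)
    then have "cmod (u x * complex_of_real (s n x)) \<le> cmod (u x * ?w x)" for n x
      using M(1) by (auto simp: norm_mult intro!: mult_left_mono simp del: of_real_mult)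
    then show "AE x in lborel. cmod (u x * complex_of_real (s n x)) \<le> cmod (u x * ?w x)" for n by blast
  qed
qed

lemma test_function_support:
  assumes "test_function \<phi>"
  shows "\<exists>R>0. \<forall>n x. \<bar>x\<bar> > R \<longrightarrow> (deriv ^^ n) \<phi> x = 0"
proof -
  have "bounded (closure {x. \<phi> x \<noteq> 0})" using assms by (auto simp: test_function_def compact_imp_bounded)
  then obtain R where R: "R > 0" "\<And>x. x \<in> closure {x. \<phi> x \<noteq> 0} \<Longrightarrow> \<bar>x\<bar> \<le> R"
    unfolding bounded_pos by auto
  have "\<forall>x. \<bar>x\<bar> > R \<longrightarrow> (deriv ^^ n) \<phi> x = 0" for n
  proof (induction n)
    case 0
    have "\<phi> x = 0" if "\<bar>x\<bar> > R" for x
    proof (rule ccontr)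
      assume "\<phi> x \<noteq> 0"
      then have "x \<in> closure {x. \<phi> x \<noteq> 0}" by (intro subsetD[OF closure_subset]) simp
      from R(2)[OF this] that show False by simp
    qed
    then show ?case by simp
  next
    case (Suc n)
    have "((deriv ^^ n) \<phi> has_real_derivative 0) (at x)" if "\<bar>x\<bar> > R" for x
    proof -
      have "open {x::real. \<bar>x\<bar> > R}" by (intro open_Collect_less continuous_intros)
      then show ?thesis
        by (rule has_field_derivative_transform_within_open[where f = "\<lambda>_. 0", OF DERIV_const]) (use that Suc in auto)
    qed
    then show ?case by (auto intro: DERIV_imp_deriv)
  qed
  then show ?thesis using R(1) by blast
qed

lemma test_functionD:
  assumes "test_function \<phi>"
  shows "continuous_on A ((deriv ^^ n) \<phi>)"
    "((deriv ^^ n) \<phi> has_real_derivative (deriv ^^ Suc n) \<phi> x) (at x)"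
  using assms smooth_continuous[of \<phi>] DERIV_iterated_deriv[of n \<phi>] by (auto simp: test_function_def)

lemma L2_test_function: assumes "test_function \<phi>" shows "(\<lambda>x. complex_of_real ((deriv ^^ n) \<phi> x)) \<in> L2"
proof -
  obtain R where "\<forall>n x. \<bar>x\<bar> > R \<longrightarrow> (deriv ^^ n) \<phi> x = 0" using test_function_support[OF assms] by blast
  then show ?thesis by (intro L2_continuous_support[where R = R] test_functionD[OF assms]) auto
qed

lemma weak_deriv_2_test_C2:
  assumes u: "u \<in> L2" and b: "b \<in> L2" and w: "is_weak_deriv 2 u b"
    and D: "\<And>x. (g has_real_derivative g1 x) (at x)" "\<And>x. (g1 has_real_derivative g2 x) (at x)"
    and cont: "continuous_on UNIV g2" and supp: "\<And>x. \<bar>x\<bar> > R \<Longrightarrow> g x = 0 \<and> g2 x = 0"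
  shows "(LINT x|lborel. u x * complex_of_real (g2 x)) = (LINT x|lborel. b x * complex_of_real (g x))"
proof -
  have "\<exists>\<phi>. test_function \<phi> \<and> (\<forall>x. \<bar>x\<bar> > R + 1 \<longrightarrow> \<phi> x = 0 \<and> (deriv ^^ 2) \<phi> x = 0) \<and>
    (\<forall>x. \<bar>\<phi> x - g x\<bar> \<le> 1 / real (Suc n) \<and> \<bar>(deriv ^^ 2) \<phi> x - g2 x\<bar> \<le> 1 / real (Suc n))" for n
    by (rule C2_approx_test_function[OF D cont supp]) auto
  then obtain \<phi> where \<phi>: "\<And>n. test_function (\<phi> n)" "\<And>n x. \<bar>x\<bar> > R + 1 \<Longrightarrow> \<phi> n x = 0"
    "\<And>n x. \<bar>x\<bar> > R + 1 \<Longrightarrow> (deriv ^^ 2) (\<phi> n) x = 0"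
    "\<And>n x. \<bar>\<phi> n x - g x\<bar> \<le> 1 / real (Suc n)" "\<And>n x. \<bar>(deriv ^^ 2) (\<phi> n) x - g2 x\<bar> \<le> 1 / real (Suc n)"
    by metis
  have c: "continuous_on UNIV g" by (rule DERIV_imp_continuous_on[OF D(1)])
  have cn: "continuous_on UNIV (\<phi> n)" for n using test_functionD(1)[OF \<phi>(1), of UNIV 0] by simp
  have 1: "(\<lambda>n. LINT x|lborel. u x * complex_of_real ((deriv ^^ 2) (\<phi> n) x)) \<longlonglongrightarrow> (LINT x|lborel. u x * complex_of_real (g2 x))"
    by (rule L2_uniform_limit_integral[OF u cont test_functionD(1)[OF \<phi>(1)], of "R + 1"])
      (use supp \<phi> in auto)
  have 2: "(\<lambda>n. LINT x|lborel. b x * complex_of_real (\<phi> n x)) \<longlonglongrightarrow> (LINT x|lborel. b x * complex_of_real (g x))"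
    by (rule L2_uniform_limit_integral[OF b c cn, of "R + 1"]) (use supp \<phi> in auto)
  have "(LINT x|lborel. u x * complex_of_real ((deriv ^^ 2) (\<phi> n) x)) = (LINT x|lborel. b x * complex_of_real (\<phi> n x))" for n
    using w \<phi>(1)[of n] by (simp add: is_weak_deriv_def)
  with 1 2 show ?thesis by (simp add: LIMSEQ_unique)
qed

text \<open>The bounded measurable function \<open>sgn b\<close> is an almost-everywhere limit of continuous functions; truncating and cutting
  these off gives admissible \<open>g\<close>, and in the limit the integral of \<open>\<bar>b\<bar>\<close> against each cutoff vanishes.\<close>

lemma real_fundamental_lemma:
  fixes b :: "real \<Rightarrow> real"
  assumes b: "(\<lambda>x. complex_of_real (b x)) \<in> L2" and bm: "b \<in> borel_measurable borel"
    and z: "\<And>g R. continuous_on UNIV g \<Longrightarrow> (\<And>x. \<bar>x\<bar> > R \<Longrightarrow> g x = 0) \<Longrightarrow> (LINT x|lborel. b x * g x) = 0"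
  shows "AE x in lborel. b x = 0"
proof -
  note [measurable] = bm
  have "(\<lambda>x. sgn (b x)) \<in> borel_measurable lebesgue"
    by (rule measurable_completion) simp
  then have "(\<lambda>x. sgn (b x)) measurable_on UNIV" by (rule lebesgue_measurable_imp_measurable_on) auto
  then obtain N h where N: "negligible N" and h: "\<And>n. continuous_on UNIV (h n)"
    "\<And>x. x \<notin> N \<Longrightarrow> (\<lambda>n. h n x) \<longlonglongrightarrow> sgn (b x)"
    unfolding measurable_on_def by auto
  have AEN: "AE x in lborel. x \<notin> N"
    using N AE_not_in[of N lebesgue] by (simp add: negligible_iff_null_sets AE_completion_iff)
  have "AE x in lborel. \<bar>b x\<bar> * max 0 (min 1 (real R + 1 - \<bar>x\<bar>)) = 0" for R :: nat
  proof -
    define c where "c x = max 0 (min 1 (real R + 1 - \<bar>x\<bar>))" for x :: real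
    have cc: "continuous_on UNIV c" unfolding c_def by (intro continuous_intros)
    have csupp: "c x = 0" if "\<bar>x\<bar> > real R + 1" for x using that by (simp add: c_def)
    have c01: "0 \<le> c x" "c x \<le> 1" for x by (auto simp: c_def)
    note [measurable] = borel_measurable_continuous[OF cc]
    define s where "s n x = max (-1) (min 1 (h n x)) * c x" for n x
    have cs: "continuous_on UNIV (s n)" for n unfolding s_def by (intro continuous_intros h cc)
    note [measurable] = borel_measurable_continuous[OF cs]
    have int: "integrable lborel (\<lambda>x. \<bar>b x\<bar> * c x)"
    proof -
      from integrable_norm[OF L2_mult_integrable[OF b L2_continuous_support[OF cc csupp]]]
      show ?thesis using c01 by (simp add: norm_mult)
    qed
    have "(\<lambda>n. LINT x|lborel. b x * s n x) \<longlonglongrightarrow> (LINT x|lborel. \<bar>b x\<bar> * c x)"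
    proof (rule integral_dominated_convergence[OF _ _ int])
      have "(\<lambda>n. b x * s n x) \<longlonglongrightarrow> \<bar>b x\<bar> * c x" if "x \<notin> N" for x
      proof -
        have "(\<lambda>n. b x * s n x) \<longlonglongrightarrow> b x * (max (-1) (min 1 (sgn (b x))) * c x)"
          unfolding s_def by (intro tendsto_intros h(2) that)
        moreover have "b x * max (-1) (min 1 (sgn (b x))) = \<bar>b x\<bar>" by (auto simp: sgn_if)
        ultimately show ?thesis by (simp add: mult.assoc[symmetric])
      qed
      then show "AE x in lborel. (\<lambda>n. b x * s n x) \<longlonglongrightarrow> \<bar>b x\<bar> * c x" using AEN by (auto elim: eventually_mono)
      have "\<bar>s n x\<bar> \<le> c x" for n x
      proof -
        have "\<bar>max (-1) (min 1 (h n x))\<bar> \<le> 1" by auto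
        from mult_right_mono[OF this c01(1)[of x]] show ?thesis using c01(1)[of x] by (simp add: s_def abs_mult)
      qed
      then show "AE x in lborel. norm (b x * s n x) \<le> \<bar>b x\<bar> * c x" for n
        by (auto simp: abs_mult intro!: mult_left_mono)
    qed measurable
    moreover have "(LINT x|lborel. b x * s n x) = 0" for n
      by (rule z[OF cs, of "real R + 1"]) (simp add: s_def csupp)
    ultimately have eq: "(LINT x|lborel. \<bar>b x\<bar> * c x) = 0" by (simp add: LIMSEQ_const_iff)
    have "AE x in lborel. 0 \<le> \<bar>b x\<bar> * c x" using c01 by simp
    from iffD1[OF integral_nonneg_eq_0_iff_AE[OF int this] eq] show ?thesis by (simp only: c_def)
  qed
  then have "AE x in lborel. \<forall>R::nat. \<bar>b x\<bar> * max 0 (min 1 (real R + 1 - \<bar>x\<bar>)) = 0"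
    unfolding AE_all_countable by blast
  then show ?thesis
  proof eventually_elim
    case (elim x)
    obtain R :: nat where "\<bar>x\<bar> \<le> real R" using real_arch_simple by blast
    then show ?case using elim[rule_format, of R] by (auto simp: max_def min_def split: if_splits)
  qed
qed

lemma fundamental_lemma:
  assumes a: "a \<in> L2" and z: "\<And>\<phi>. test_function \<phi> \<Longrightarrow> (LINT x|lborel. a x * complex_of_real (\<phi> x)) = 0"
  shows "AE x in lborel. a x = 0"
proof -
  note [measurable] = L2D(1)[OF a]
  have zc: "(LINT x|lborel. a x * complex_of_real (g x)) = 0"
    if g: "continuous_on UNIV g" and supp: "\<And>x. \<bar>x\<bar> > R \<Longrightarrow> g x = 0" for g R
  proof -
    have "\<exists>\<phi>. test_function \<phi> \<and> (\<forall>x. \<bar>x\<bar> > R + 1 \<longrightarrow> \<phi> x = 0) \<and> (\<forall>x. \<bar>\<phi> x - g x\<bar> \<le> 1 / real (Suc n))" for n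
      by (rule continuous_approx_test_function[OF g supp]) auto
    then obtain \<phi> where \<phi>: "\<And>n. test_function (\<phi> n)" "\<And>n x. \<bar>x\<bar> > R + 1 \<Longrightarrow> \<phi> n x = 0"
      "\<And>n x. \<bar>\<phi> n x - g x\<bar> \<le> 1 / real (Suc n)" by metis
    have "(\<lambda>n. LINT x|lborel. a x * complex_of_real (\<phi> n x)) \<longlonglongrightarrow> (LINT x|lborel. a x * complex_of_real (g x))"
      by (rule L2_uniform_limit_integral[OF a g, of _ "R + 1"])
        (use test_functionD(1)[OF \<phi>(1), of UNIV 0] \<phi> supp in auto)
    then show ?thesis by (simp add: z[OF \<phi>(1)] LIMSEQ_const_iff)
  qed
  have int: "integrable lborel (\<lambda>x. a x * complex_of_real (g x))"
    if "continuous_on UNIV g" "\<And>x. \<bar>x\<bar> > R \<Longrightarrow> g x = 0" for g R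
    by (rule L2_mult_integrable[OF a L2_continuous_support[OF that]])
  have "AE x in lborel. Re (a x) = 0"
  proof (rule real_fundamental_lemma)
    show "(\<lambda>x. complex_of_real (Re (a x))) \<in> L2"
      by (rule L2_dominated[OF a, where c = 1]) (auto simp: abs_Re_le_cmod)
    fix g :: "real \<Rightarrow> real" and R assume g: "continuous_on UNIV g" "\<And>x. \<bar>x\<bar> > R \<Longrightarrow> g x = 0"
    show "(LINT x|lborel. Re (a x) * g x) = 0"
      using integral_Re[OF int[OF g]] zc[OF g] by simp
  qed measurable
  moreover have "AE x in lborel. Im (a x) = 0"
  proof (rule real_fundamental_lemma)
    show "(\<lambda>x. complex_of_real (Im (a x))) \<in> L2"
      by (rule L2_dominated[OF a, where c = 1]) (auto simp: abs_Im_le_cmod)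
    fix g :: "real \<Rightarrow> real" and R assume g: "continuous_on UNIV g" "\<And>x. \<bar>x\<bar> > R \<Longrightarrow> g x = 0"
    show "(LINT x|lborel. Im (a x) * g x) = 0"
      using integral_Im[OF int[OF g]] zc[OF g] by simp
  qed measurable
  ultimately show ?thesis by eventually_elim (simp add: complex_eq_iff)
qed

lemma weak_deriv_unique:
  assumes v: "v \<in> L2" "is_weak_deriv n u v" and w: "w \<in> L2" "is_weak_deriv n u w"
  shows "AE x in lborel. v x = w x"
proof -
  have "AE x in lborel. v x - w x = 0"
  proof (rule fundamental_lemma[OF L2_diff[OF v(1) w(1)]])
    fix \<phi> assume \<phi>: "test_function \<phi>"
    have int: "integrable lborel (\<lambda>x. v x * complex_of_real (\<phi> x))" "integrable lborel (\<lambda>x. w x * complex_of_real (\<phi> x))"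
      using L2_mult_integrable[OF _ L2_test_function[OF \<phi>, of 0]] v(1) w(1) by auto
    have "(LINT x|lborel. v x * complex_of_real (\<phi> x)) = (LINT x|lborel. w x * complex_of_real (\<phi> x))"
      using v(2) w(2) \<phi> by (simp add: is_weak_deriv_def)
    then show "(LINT x|lborel. (v x - w x) * complex_of_real (\<phi> x)) = 0"
      using Bochner_Integration.integral_diff[OF int] by (simp add: left_diff_distrib)
  qed
  then show ?thesis by eventually_elim simp
qed

lemma weak_deriv:
  assumes "v \<in> L2" "is_weak_deriv n u v"
  shows "weak_deriv n u \<in> L2" "is_weak_deriv n u (weak_deriv n u)" "AE x in lborel. weak_deriv n u x = v x"
proof -
  have "\<exists>v. v \<in> L2 \<and> is_weak_deriv n u v" using assms by blast
  from someI_ex[OF this] show "weak_deriv n u \<in> L2" "is_weak_deriv n u (weak_deriv n u)"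
    by (auto simp: weak_deriv_def)
  then show "AE x in lborel. weak_deriv n u x = v x" using weak_deriv_unique assms by blast
qed

lemma integral_total_derivative:
  assumes D: "\<And>x. (F has_real_derivative f x) (at x)" and cont: "continuous_on UNIV f"
    and supp: "\<And>x. \<bar>x\<bar> > R \<Longrightarrow> F x = 0 \<and> f x = 0" and R: "R > 0"
  shows "(LINT x|lborel. f x) = 0"
proof -
  have "(f has_integral (F (R + 1) - F (- R - 1))) {- R - 1..R + 1}"
    using R D by (intro fundamental_theorem_of_calculus)
      (auto simp: has_real_derivative_iff_has_vector_derivative[symmetric] has_field_derivative_at_within)
  then have "integral {- R - 1..R + 1} f = 0" using supp[of "R + 1"] supp[of "- R - 1"] R by (simp add: integral_unique)
  moreover have "f x = 0" if "x \<notin> {- R - 1..R + 1}" for x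
  proof -
    have "\<bar>x\<bar> > R" using that R by auto
    then show ?thesis using supp by blast
  qed
  ultimately show ?thesis
    using compact_support_integral(2)[OF cont, of "- R - 1" "R + 1"] by simp
qed

text \<open>The total derivative of \<open>u\<close> times a derivative of the test function integrates to \<open>0\<close>.\<close>

lemma classical_weak_deriv_step:
  assumes D: "\<And>x. (u has_real_derivative u' x) (at x)" and cont: "continuous_on UNIV u'"
    and \<phi>: "test_function \<phi>"
  shows "(LINT x|lborel. complex_of_real (u x) * complex_of_real ((deriv ^^ Suc n) \<phi> x)) =
    - (LINT x|lborel. complex_of_real (u' x) * complex_of_real ((deriv ^^ n) \<phi> x))"
proof -
  obtain R where R: "R > 0" "\<And>n x. \<bar>x\<bar> > R \<Longrightarrow> (deriv ^^ n) \<phi> x = 0" using test_function_support[OF \<phi>] by blast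
  note c = test_functionD(1)[OF \<phi>, of UNIV]
  have cu: "continuous_on UNIV u" by (rule DERIV_imp_continuous_on[OF D])
  have c1: "continuous_on UNIV (\<lambda>x. u x * (deriv ^^ Suc n) \<phi> x)" using c[of "Suc n"] cu by (intro continuous_intros)
  have c2: "continuous_on UNIV (\<lambda>x. u' x * (deriv ^^ n) \<phi> x)" using c cont by (intro continuous_intros)
  have supp: "x \<notin> {-R..R} \<Longrightarrow> u x * (deriv ^^ Suc n) \<phi> x = 0" "x \<notin> {-R..R} \<Longrightarrow> u' x * (deriv ^^ n) \<phi> x = 0" for x
    using R(2)[of x] by (auto simp: abs_if not_le simp del: funpow.simps)
  have i1: "integrable lborel (\<lambda>x. u x * (deriv ^^ Suc n) \<phi> x)"
    by (rule compact_support_integral(1)[OF c1 supp(1)])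
  have i2: "integrable lborel (\<lambda>x. u' x * (deriv ^^ n) \<phi> x)"
    by (rule compact_support_integral(1)[OF c2 supp(2)])
  have "(LINT x|lborel. u' x * (deriv ^^ n) \<phi> x + u x * (deriv ^^ Suc n) \<phi> x) = 0"
  proof (rule integral_total_derivative[OF _ _ _ R(1)])
    show "((\<lambda>x. u x * (deriv ^^ n) \<phi> x) has_real_derivative u' x * (deriv ^^ n) \<phi> x + u x * (deriv ^^ Suc n) \<phi> x) (at x)" for x
      using DERIV_mult[OF D[of x] test_functionD(2)[OF \<phi>, of n x]] by (simp add: mult.commute add.commute)
    show "continuous_on UNIV (\<lambda>x. u' x * (deriv ^^ n) \<phi> x + u x * (deriv ^^ Suc n) \<phi> x)"
      by (intro continuous_on_add c1 c2)
  qed (use R(2) in \<open>simp del: funpow.simps\<close>)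
  then have "(LINT x|lborel. u x * (deriv ^^ Suc n) \<phi> x) = - (LINT x|lborel. u' x * (deriv ^^ n) \<phi> x)"
    using Bochner_Integration.integral_add[OF i2 i1] by simp
  then show ?thesis by (simp only: of_real_mult[symmetric] integral_complex_of_real of_real_minus[symmetric])
qed

text \<open>This makes \<open>H\<^sup>2\<close> accessible for decaying solutions, whose derivatives decay as well.\<close>

lemma classical_sobolev:
  assumes D: "\<And>x. (u has_real_derivative u1 x) (at x)" "\<And>x. (u1 has_real_derivative u2 x) (at x)"
    and cont: "continuous_on UNIV u2"
    and L2: "(\<lambda>x. complex_of_real (u x)) \<in> L2" "(\<lambda>x. complex_of_real (u1 x)) \<in> L2" "(\<lambda>x. complex_of_real (u2 x)) \<in> L2"
  shows "(\<lambda>x. complex_of_real (u x)) \<in> sobolev_H 2"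
    "AE x in lborel. weak_deriv 2 (\<lambda>x. complex_of_real (u x)) x = complex_of_real (u2 x)"
proof -
  have c1: "continuous_on UNIV u1" by (rule DERIV_imp_continuous_on[OF D(2)])
  have w0: "is_weak_deriv 0 (\<lambda>x. complex_of_real (u x)) (\<lambda>x. complex_of_real (u x))"
    by (simp add: is_weak_deriv_def)
  have w1: "is_weak_deriv 1 (\<lambda>x. complex_of_real (u x)) (\<lambda>x. complex_of_real (u1 x))"
    using classical_weak_deriv_step[OF D(1) c1, of _ 0] by (simp add: is_weak_deriv_def)
  have w2: "is_weak_deriv 2 (\<lambda>x. complex_of_real (u x)) (\<lambda>x. complex_of_real (u2 x))"
    using classical_weak_deriv_step[OF D(1) c1, of _ 1] classical_weak_deriv_step[OF D(2) cont, of _ 0]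
    by (simp add: is_weak_deriv_def numeral_2_eq_2)
  have "\<exists>v\<in>L2. is_weak_deriv n (\<lambda>x. complex_of_real (u x)) v" if "n \<le> 2" for n
  proof -
    from that consider "n = 0" | "n = 1" | "n = 2" by linarith
    then show ?thesis using w0 w1 w2 L2 by cases blast+
  qed
  then show "(\<lambda>x. complex_of_real (u x)) \<in> sobolev_H 2" using L2(1) by (simp add: sobolev_H_def)
  show "AE x in lborel. weak_deriv 2 (\<lambda>x. complex_of_real (u x)) x = complex_of_real (u2 x)"
    by (rule weak_deriv(3)[OF L2(3) w2])
qed

section \<open>Integral operators with exponentially decaying kernels\<close>

definition kernel_op :: "(real \<Rightarrow> real \<Rightarrow> real) \<Rightarrow> (real \<Rightarrow> complex) \<Rightarrow> real \<Rightarrow> complex" where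
  "kernel_op K f x = (LINT y|lborel. complex_of_real (K x y) * f y)"

locale decaying_kernel =
  fixes K :: "real \<Rightarrow> real \<Rightarrow> real" and M k :: real
  assumes K_measurable [measurable]: "case_prod K \<in> borel_measurable (borel \<Otimes>\<^sub>M borel)"
    and k_pos: "k > 0" and K_bound: "\<bar>K x y\<bar> \<le> M * exp (- k * \<bar>x - y\<bar>)"
begin

lemma M_nonneg: "M \<ge> 0"
  using K_bound[of 0 0] by (simp add: abs_le_iff)

definition mass :: real where "mass = enn2real (\<integral>\<^sup>+y. ennreal (exp (- k * \<bar>y\<bar>)) \<partial>lborel)"

lemma mass_nonneg: "mass \<ge> 0" by (simp add: mass_def)

lemma mass: "(\<integral>\<^sup>+y. ennreal (exp (- k * \<bar>x - y\<bar>)) \<partial>lborel) = ennreal mass"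
  "(\<integral>\<^sup>+x. ennreal (exp (- k * \<bar>x - y\<bar>)) \<partial>lborel) = ennreal mass"
proof -
  have m: "(\<integral>\<^sup>+y. ennreal (exp (- k * \<bar>y\<bar>)) \<partial>lborel) = ennreal mass"
    using nn_integral_exp_abs_finite[OF k_pos] by (simp add: mass_def)
  show "(\<integral>\<^sup>+y. ennreal (exp (- k * \<bar>x - y\<bar>)) \<partial>lborel) = ennreal mass"
    unfolding m[symmetric] by (subst (2) nn_integral_real_affine[of _ "-1" x]) auto
  show "(\<integral>\<^sup>+x. ennreal (exp (- k * \<bar>x - y\<bar>)) \<partial>lborel) = ennreal mass"
    unfolding m[symmetric] by (subst (2) nn_integral_real_affine[of _ 1 "- y"]) auto
qed

context
  fixes f assumes f: "f \<in> L2"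
begin

lemma f_measurable [measurable]: "f \<in> borel_measurable borel" by (rule L2D(1)[OF f])

lemma f_finite: "(\<integral>\<^sup>+y. ennreal ((cmod (f y))\<^sup>2) \<partial>lborel) = ennreal (LINT y|lborel. (cmod (f y))\<^sup>2)"
  by (rule nn_integral_eq_integral[OF L2D(2)[OF f]]) simp

text \<open>Uniform in \<open>x\<close> by \<open>\<bar>f\<bar> \<le> 1 + \<bar>f\<bar>\<^sup>2\<close>; this provides the integrability for Fubini's theorem in
  \<open>kernel_op_transpose\<close>.\<close>

lemma kernel_section_bound:
  "(\<integral>\<^sup>+y. ennreal (cmod (complex_of_real (K x y) * f y)) \<partial>lborel)
     \<le> ennreal (M * (mass + (LINT y|lborel. (cmod (f y))\<^sup>2)))"
proof -
  have "(\<integral>\<^sup>+y. ennreal (cmod (complex_of_real (K x y) * f y)) \<partial>lborel)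
    \<le> (\<integral>\<^sup>+y. ennreal M * (ennreal (exp (- k * \<bar>x - y\<bar>)) + ennreal ((cmod (f y))\<^sup>2)) \<partial>lborel)"
  proof (intro nn_integral_mono)
    fix y
    let ?e = "exp (- k * \<bar>x - y\<bar>)" and ?c = "cmod (f y)"
    have e: "0 \<le> ?e" "?e \<le> 1" using k_pos by auto
    have "2 * ?c \<le> 1 + ?c\<^sup>2" using sum_squares_bound[of 1 ?c] by simp
    then have "?c \<le> 1 + ?c\<^sup>2" using norm_ge_zero[of "f y"] by linarith
    then have "?e * ?c \<le> ?e * (1 + ?c\<^sup>2)" by (intro mult_left_mono e)
    also have "\<dots> \<le> ?e + ?c\<^sup>2" using mult_right_mono[OF e(2), of "?c\<^sup>2"] by (simp add: algebra_simps)
    finally have "M * (?e * ?c) \<le> M * (?e + ?c\<^sup>2)" by (rule mult_left_mono[OF _ M_nonneg])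
    moreover have "cmod (complex_of_real (K x y) * f y) \<le> M * (?e * ?c)"
      using mult_right_mono[OF K_bound[of x y], of ?c] by (simp add: norm_mult mult.assoc)
    ultimately have "cmod (complex_of_real (K x y) * f y) \<le> M * (?e + ?c\<^sup>2)" by linarith
    then show "ennreal (cmod (complex_of_real (K x y) * f y)) \<le> ennreal M * (ennreal ?e + ennreal (?c\<^sup>2))"
      using M_nonneg e by (simp add: ennreal_mult[symmetric] ennreal_plus[symmetric] ennreal_leI del: ennreal_plus)
  qed
  also have "\<dots> = ennreal M * (ennreal mass + ennreal (LINT y|lborel. (cmod (f y))\<^sup>2))"
    by (subst nn_integral_cmult, measurable, subst nn_integral_add, measurable) (simp only: mass f_finite)
  also have "\<dots> = ennreal (M * (mass + (LINT y|lborel. (cmod (f y))\<^sup>2)))"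
    using M_nonneg mass_nonneg by (simp add: ennreal_mult[symmetric] ennreal_plus[symmetric] del: ennreal_plus)
  finally show ?thesis .
qed

lemma kernel_op_measurable [measurable]: "kernel_op K f \<in> borel_measurable borel"
  unfolding kernel_op_def[abs_def] by measurable

text \<open>Schur's test: split the kernel into two square roots, apply the Cauchy-Schwarz inequality in \<open>y\<close> and then
  integrate over \<open>x\<close> first.\<close>

lemma kernel_op_nn_bound:
  "(\<integral>\<^sup>+x. ennreal ((cmod (kernel_op K f x))\<^sup>2) \<partial>lborel) \<le> ennreal ((M * mass)\<^sup>2 * (LINT y|lborel. (cmod (f y))\<^sup>2))"
proof -
  let ?e = "\<lambda>x y. exp (- k * \<bar>x - y\<bar>)" and ?h = "\<lambda>x y. exp (- (k / 2) * \<bar>x - y\<bar>)"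
  have h: "ennreal (?h x y) ^ 2 = ennreal (?e x y)" for x y
    by (simp add: ennreal_power exp_double[symmetric])
  have pt: "ennreal ((cmod (kernel_op K f x))\<^sup>2) \<le>
      ennreal (M\<^sup>2 * mass) * (\<integral>\<^sup>+y. ennreal (?e x y) * ennreal ((cmod (f y))\<^sup>2) \<partial>lborel)" for x
  proof -
    have "ennreal (cmod (kernel_op K f x)) \<le> (\<integral>\<^sup>+y. ennreal (cmod (complex_of_real (K x y) * f y)) \<partial>lborel)"
    proof (cases "integrable lborel (\<lambda>y. complex_of_real (K x y) * f y)")
      case True
      then show ?thesis unfolding kernel_op_def by (rule integral_norm_bound_ennreal)
    qed (simp add: kernel_op_def not_integrable_integral_eq)
    also have "\<dots> \<le> (\<integral>\<^sup>+y. ennreal M * (ennreal (?h x y) * (ennreal (?h x y) * ennreal (cmod (f y)))) \<partial>lborel)"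
    proof (intro nn_integral_mono)
      fix y
      have "cmod (complex_of_real (K x y) * f y) \<le> M * (?e x y * cmod (f y))"
        using mult_right_mono[OF K_bound[of x y], of "cmod (f y)"] by (simp add: norm_mult mult.assoc)
      also have "?e x y = ?h x y * ?h x y" by (simp flip: exp_add)
      finally show "ennreal (cmod (complex_of_real (K x y) * f y)) \<le> ennreal M * (ennreal (?h x y) * (ennreal (?h x y) * ennreal (cmod (f y))))"
        using M_nonneg by (simp add: ennreal_mult[symmetric] ennreal_leI mult.assoc)
    qed
    also have "\<dots> = ennreal M * (\<integral>\<^sup>+y. ennreal (?h x y) * (ennreal (?h x y) * ennreal (cmod (f y))) \<partial>lborel)"
      by (subst nn_integral_cmult) auto
    finally have "(ennreal (cmod (kernel_op K f x)))\<^sup>2 \<le>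
        (ennreal M * (\<integral>\<^sup>+y. ennreal (?h x y) * (ennreal (?h x y) * ennreal (cmod (f y))) \<partial>lborel))\<^sup>2"
      by (rule power_mono) simp
    also have "\<dots> = ennreal (M\<^sup>2) * (\<integral>\<^sup>+y. ennreal (?h x y) * (ennreal (?h x y) * ennreal (cmod (f y))) \<partial>lborel)\<^sup>2"
      using M_nonneg by (simp add: power_mult_distrib ennreal_power)
    also have "\<dots> \<le> ennreal (M\<^sup>2) * ((\<integral>\<^sup>+y. ennreal (?h x y) ^ 2 \<partial>lborel) * (\<integral>\<^sup>+y. (ennreal (?h x y) * ennreal (cmod (f y))) ^ 2 \<partial>lborel))"
      by (intro mult_left_mono Cauchy_Schwarz_nn_integral) auto
    also have "\<dots> = ennreal (M\<^sup>2) * (ennreal mass * (\<integral>\<^sup>+y. ennreal (?e x y) * ennreal ((cmod (f y))\<^sup>2) \<partial>lborel))"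
      by (simp only: power_mult_distrib h mass ennreal_power[OF norm_ge_zero])
    finally show ?thesis
      using mass_nonneg by (simp add: ennreal_power ennreal_mult mult.assoc)
  qed
  have "(\<integral>\<^sup>+x. ennreal ((cmod (kernel_op K f x))\<^sup>2) \<partial>lborel) \<le>
     (\<integral>\<^sup>+x. ennreal (M\<^sup>2 * mass) * (\<integral>\<^sup>+y. ennreal (?e x y) * ennreal ((cmod (f y))\<^sup>2) \<partial>lborel) \<partial>lborel)"
    by (intro nn_integral_mono pt)
  also have "\<dots> = ennreal (M\<^sup>2 * mass) * (\<integral>\<^sup>+x. (\<integral>\<^sup>+y. ennreal (?e x y) * ennreal ((cmod (f y))\<^sup>2) \<partial>lborel) \<partial>lborel)"
    by (rule nn_integral_cmult) measurable
  also have "(\<integral>\<^sup>+x. (\<integral>\<^sup>+y. ennreal (?e x y) * ennreal ((cmod (f y))\<^sup>2) \<partial>lborel) \<partial>lborel) =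
     (\<integral>\<^sup>+y. (\<integral>\<^sup>+x. ennreal (?e x y) * ennreal ((cmod (f y))\<^sup>2) \<partial>lborel) \<partial>lborel)"
    by (rule lborel_pair.Fubini'[symmetric]) measurable
  also have "\<dots> = (\<integral>\<^sup>+y. ennreal mass * ennreal ((cmod (f y))\<^sup>2) \<partial>lborel)"
    by (intro nn_integral_cong, subst nn_integral_multc, measurable) (simp only: mass)
  also have "\<dots> = ennreal mass * ennreal (LINT y|lborel. (cmod (f y))\<^sup>2)"
    by (subst nn_integral_cmult, measurable) (simp only: f_finite)
  also have "ennreal (M\<^sup>2 * mass) * \<dots> = ennreal ((M * mass)\<^sup>2 * (LINT y|lborel. (cmod (f y))\<^sup>2))"
  proof -
    have "0 \<le> M\<^sup>2 * mass" "0 \<le> mass * (LINT y|lborel. (cmod (f y))\<^sup>2)" using mass_nonneg by auto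
    then have "ennreal (M\<^sup>2 * mass) * (ennreal mass * ennreal (LINT y|lborel. (cmod (f y))\<^sup>2)) =
        ennreal (M\<^sup>2 * mass * (mass * (LINT y|lborel. (cmod (f y))\<^sup>2)))"
      using mass_nonneg by (subst ennreal_mult[symmetric], simp, simp, subst ennreal_mult) auto
    then show ?thesis by (simp add: power_mult_distrib power2_eq_square mult_ac)
  qed
  finally show ?thesis .
qed

lemma kernel_op_L2: "kernel_op K f \<in> L2"
proof -
  have "integrable lborel (\<lambda>x. (cmod (kernel_op K f x))\<^sup>2)"
    by (rule integrableI_nonneg) (auto intro: le_less_trans[OF kernel_op_nn_bound])
  then show ?thesis by (simp add: L2_def)
qed

lemma kernel_op_norm: "L2_norm (kernel_op K f) \<le> M * mass * L2_norm f"
proof -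
  have "ennreal (LINT x|lborel. (cmod (kernel_op K f x))\<^sup>2) \<le> ennreal ((M * mass)\<^sup>2 * (LINT y|lborel. (cmod (f y))\<^sup>2))"
    using kernel_op_nn_bound nn_integral_eq_integral[OF L2D(2)[OF kernel_op_L2]] by simp
  then have "(LINT x|lborel. (cmod (kernel_op K f x))\<^sup>2) \<le> (M * mass)\<^sup>2 * (LINT y|lborel. (cmod (f y))\<^sup>2)"
    by (subst (asm) ennreal_le_iff) (auto intro!: mult_nonneg_nonneg)
  then have "L2_norm (kernel_op K f) \<le> sqrt ((M * mass)\<^sup>2 * (LINT y|lborel. (cmod (f y))\<^sup>2))"
    unfolding L2_norm_def by (rule real_sqrt_le_mono)
  also have "\<dots> = M * mass * L2_norm f"
    unfolding L2_norm_def real_sqrt_mult using M_nonneg mass_nonneg by simp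
  finally show ?thesis .
qed

lemma kernel_op_transpose:
  assumes cont: "continuous_on UNIV \<phi>" and supp: "\<And>x. \<bar>x\<bar> > R \<Longrightarrow> \<phi> x = 0"
  shows "(LINT x|lborel. kernel_op K f x * complex_of_real (\<phi> x)) =
    (LINT y|lborel. f y * complex_of_real (LINT x|lborel. K x y * \<phi> x))"
proof -
  note [measurable] = borel_measurable_continuous[OF cont]
  define F where "F x y = complex_of_real (K x y) * f y * complex_of_real (\<phi> x)" for x y
  define A where "A = M * (mass + (LINT y|lborel. (cmod (f y))\<^sup>2))"
  have A: "A \<ge> 0" unfolding A_def using M_nonneg mass_nonneg by simp
  have \<phi>int: "integrable lborel \<phi>"
    by (rule compact_support_integral(1)[OF cont, of "- R" R]) (use supp in \<open>auto simp: abs_if not_le\<close>)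
  have F_measurable [measurable]: "case_prod F \<in> borel_measurable (lborel \<Otimes>\<^sub>M lborel)"
    unfolding F_def by measurable
  have int: "integrable (lborel \<Otimes>\<^sub>M lborel) (case_prod F)"
  proof (rule integrableI_bounded)
    show "case_prod F \<in> borel_measurable (lborel \<Otimes>\<^sub>M lborel)" by (rule F_measurable)
    have "(\<integral>\<^sup>+z. ennreal (cmod (case_prod F z)) \<partial>(lborel \<Otimes>\<^sub>M lborel)) =
       (\<integral>\<^sup>+x. (\<integral>\<^sup>+y. ennreal (cmod (F x y)) \<partial>lborel) \<partial>lborel)"
      using lborel.nn_integral_fst[of "\<lambda>z. ennreal (cmod (case_prod F z))" lborel] by simp
    also have "\<dots> \<le> (\<integral>\<^sup>+x. ennreal A * ennreal \<bar>\<phi> x\<bar> \<partial>lborel)"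
    proof (rule nn_integral_mono)
      fix x
      have "(\<integral>\<^sup>+y. ennreal (cmod (F x y)) \<partial>lborel) =
         (\<integral>\<^sup>+y. ennreal (cmod (complex_of_real (K x y) * f y)) * ennreal \<bar>\<phi> x\<bar> \<partial>lborel)"
        by (intro nn_integral_cong) (simp add: F_def norm_mult ennreal_mult[symmetric])
      also have "\<dots> = (\<integral>\<^sup>+y. ennreal (cmod (complex_of_real (K x y) * f y)) \<partial>lborel) * ennreal \<bar>\<phi> x\<bar>"
        by (rule nn_integral_multc) measurable
      also have "\<dots> \<le> ennreal A * ennreal \<bar>\<phi> x\<bar>"
        unfolding A_def by (intro mult_right_mono kernel_section_bound) auto
      finally show "(\<integral>\<^sup>+y. ennreal (cmod (F x y)) \<partial>lborel) \<le> ennreal A * ennreal \<bar>\<phi> x\<bar>" .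
    qed
    also have "\<dots> = ennreal A * (\<integral>\<^sup>+x. ennreal \<bar>\<phi> x\<bar> \<partial>lborel)" by (rule nn_integral_cmult) measurable
    also have "(\<integral>\<^sup>+x. ennreal \<bar>\<phi> x\<bar> \<partial>lborel) = ennreal (LINT x|lborel. \<bar>\<phi> x\<bar>)"
      using \<phi>int by (intro nn_integral_eq_integral) auto
    finally show "(\<integral>\<^sup>+z. ennreal (norm (case_prod F z)) \<partial>(lborel \<Otimes>\<^sub>M lborel)) < \<infinity>"
      using A by (simp add: ennreal_mult[symmetric] le_less_trans)
  qed
  have "(LINT x|lborel. kernel_op K f x * complex_of_real (\<phi> x)) = (LINT x|lborel. LINT y|lborel. F x y)"
    unfolding kernel_op_def F_def by (simp only: Bochner_Integration.integral_mult_left_zero)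
  also have "\<dots> = (LINT y|lborel. LINT x|lborel. F x y)"
    by (rule lborel_pair.Fubini_integral[OF int, symmetric])
  also have "\<dots> = (LINT y|lborel. f y * complex_of_real (LINT x|lborel. K x y * \<phi> x))"
  proof (rule Bochner_Integration.integral_cong[OF refl])
    fix y
    have "F x y = f y * complex_of_real (K x y * \<phi> x)" for x by (simp add: F_def mult_ac)
    then show "(LINT x|lborel. F x y) = f y * complex_of_real (LINT x|lborel. K x y * \<phi> x)"
      by (simp only: Bochner_Integration.integral_mult_right_zero integral_complex_of_real)
  qed
  finally show ?thesis .
qed

end

end

section \<open>Resolvent of an equation with exponential dichotomy\<close>

lemma primitive_of_compact_support:
  fixes h :: "real \<Rightarrow> real"
  assumes cont: "continuous_on UNIV h" and supp: "\<And>x. \<bar>x\<bar> > R \<Longrightarrow> h x = 0" and R: "R > 0"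
  shows "\<exists>A c. (\<forall>x. (A has_real_derivative h x) (at x)) \<and> (\<forall>x\<le>-R. A x = 0) \<and> (\<forall>x\<ge>R. A x = A R) \<and> (\<forall>x. \<bar>A x\<bar> \<le> c)"
proof -
  define A where "A x = primitive h x - primitive h (- R)" for x
  have dA: "(A has_real_derivative h x) (at x)" for x
    unfolding A_def[abs_def] using DERIV_diff[OF has_real_derivative_primitive[OF cont] DERIV_const] by simp
  have cA: "continuous_on S A" for S by (rule DERIV_imp_continuous_on[OF dA])
  have const: "A b = A a" if "a < b" "b \<le> - R \<or> R \<le> a" for a b
  proof (rule DERIV_isconst_end[OF that(1) cA])
    fix x assume "a < x" "x < b"
    then have "h x = 0" using that(2) R by (intro supp) auto
    then show "(A has_real_derivative 0) (at x)" using dA[of x] by simp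
  qed
  have left: "A x = 0" if "x \<le> - R" for x
    using const[of x "- R"] that by (cases "x = - R") (auto simp: A_def)
  have right: "A x = A R" if "x \<ge> R" for x
    using const[of R x] that by (cases "x = R") auto
  have "compact (A ` {-R..R})" by (intro compact_continuous_image cA) auto
  then obtain c where c: "c > 0" "\<And>x. x \<in> {-R..R} \<Longrightarrow> \<bar>A x\<bar> \<le> c"
    by (metis bounded_pos compact_imp_bounded imageI real_norm_def)
  have "\<bar>A x\<bar> \<le> c" for x
  proof -
    consider "x \<le> - R" | "x \<ge> R" | "x \<in> {-R..R}" by force
    then show ?thesis
    proof cases
      case 2
      have "\<bar>A R\<bar> \<le> c" using c(2)[of R] R by simp
      then show ?thesis using right[OF 2] by simp
    qed (use left c in auto)
  qed
  with dA left right show ?thesis by blast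
qed

lemma FTC_real:
  fixes F :: "real \<Rightarrow> real"
  assumes "\<And>x. (F has_real_derivative f x) (at x)" "a \<le> b"
  shows "(f has_integral (F b - F a)) {a..b}"
  using assms by (intro fundamental_theorem_of_calculus)
      (auto simp: has_real_derivative_iff_has_vector_derivative[symmetric] has_field_derivative_at_within)

lemma LINT_eq_integral_compact_support:
  fixes f :: "real \<Rightarrow> real"
  assumes int: "integrable lborel f" and hi: "(f has_integral I) {a..b}" and supp: "\<And>x. x \<notin> {a..b} \<Longrightarrow> f x = 0"
  shows "(LINT x|lborel. f x) = I"
  using has_integral_unique[OF has_integral_integral_lborel[OF int] has_integral_on_superset[OF hi supp subset_UNIV]] .

text \<open>The dilations \<open>\<theta> (x / n)\<close> serve as cutoffs; they tend to the nonzero constant \<open>\<theta> 0\<close>.\<close>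

lemma cutoff_exists: "\<exists>\<theta>. test_function \<theta> \<and> \<theta> 0 \<noteq> 0"
proof -
  have "\<exists>\<phi>. test_function \<phi> \<and> (\<forall>x. \<bar>x\<bar> > 1 + 1 \<longrightarrow> \<phi> x = 0) \<and> (\<forall>x. \<bar>\<phi> x - max 0 (1 - \<bar>x\<bar>)\<bar> \<le> 1/2)"
    by (rule continuous_approx_test_function) (auto intro!: continuous_intros)
  then obtain \<phi> where "test_function \<phi>" "\<And>x. \<bar>\<phi> x - max 0 (1 - \<bar>x\<bar>)\<bar> \<le> 1/2" by blast
  from this(1) this(2)[of 0] show ?thesis by (intro exI[of _ \<phi>]) auto
qed

text \<open>Solutions \<open>fp\<close>, \<open>fm\<close> that decay at \<open>+\<infinity>\<close> and \<open>-\<infinity>\<close>. The bounds hold on the whole line, so each solution grows at the other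
  end no faster than the rate \<open>k\<close>; this makes the kernel of Green's function decay like \<open>exp (- k \<bar>x - y\<bar>)\<close>. The
  Wronskian is normalised to \<open>1\<close>.\<close>

locale dichotomy =
  fixes V fp fp' fm fm' :: "real \<Rightarrow> real" and E k M Q :: real
  assumes fp: "ode_solution (\<lambda>x. V x - E) fp fp'" and fm: "ode_solution (\<lambda>x. V x - E) fm fm'"
    and cont_V: "continuous_on UNIV V" and V_bound: "\<And>x. \<bar>V x\<bar> \<le> Q" and k_pos: "k > 0"
    and fp_bound: "\<bar>fp x\<bar> \<le> M * exp (- k * x)" "\<bar>fp' x\<bar> \<le> M * exp (- k * x)"
    and fm_bound: "\<bar>fm x\<bar> \<le> M * exp (k * x)" "\<bar>fm' x\<bar> \<le> M * exp (k * x)"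
    and wronskian: "fp x * fm' x - fp' x * fm x = 1"
begin

lemma DERIVs: "(fp has_real_derivative fp' x) (at x)" "(fp' has_real_derivative (V x - E) * fp x) (at x)"
    "(fm has_real_derivative fm' x) (at x)" "(fm' has_real_derivative (V x - E) * fm x) (at x)"
  using fp fm by (auto simp: ode_solution_def)

lemma conts: "continuous_on S fp" "continuous_on S fp'" "continuous_on S fm" "continuous_on S fm'"
  by (rule ode_solution_continuous[OF fp] ode_solution_continuous[OF fm])+

lemma measurables [measurable]: "fp \<in> borel_measurable borel" "fp' \<in> borel_measurable borel"
    "fm \<in> borel_measurable borel" "fm' \<in> borel_measurable borel" "V \<in> borel_measurable borel"
  by (intro borel_measurable_continuous conts cont_V)+

lemma M_nonneg: "M \<ge> 0" using fp_bound(1)[of 0] by simp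

lemma q_L2: "u \<in> L2 \<Longrightarrow> (\<lambda>x. complex_of_real (V x - E) * u x) \<in> L2"
proof -
  assume u: "u \<in> L2"
  note [measurable] = L2D(1)[OF u]
  have "\<bar>V x - E\<bar> \<le> Q + \<bar>E\<bar>" for x using V_bound[of x] by linarith
  then show ?thesis
    by (intro L2_dominated[OF u, of _ "Q + \<bar>E\<bar>"]) (auto simp: norm_mult simp flip: of_real_diff intro!: mult_right_mono)
qed

text \<open>Variation of constants: \<open>v = fp A + fm B\<close> with \<open>A' = fm g\<close> vanishing at \<open>-\<infinity>\<close> and \<open>B' = - fp g\<close> vanishing at \<open>+\<infinity>\<close>. To the left of
  the support of \<open>g\<close> only the second term remains, to the right only the first, and each of them decays there.\<close>

lemma inhomogeneous_classical:
  assumes cont: "continuous_on UNIV g" and supp: "\<And>x. \<bar>x\<bar> > R \<Longrightarrow> g x = 0" and R: "R > 0"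
  shows "\<exists>v v1 D. (\<forall>x. (v has_real_derivative v1 x) (at x)) \<and>
    (\<forall>x. (v1 has_real_derivative (V x - E) * v x - g x) (at x)) \<and>
    (\<forall>x. \<bar>v x\<bar> \<le> D * exp (- k * \<bar>x\<bar>) \<and> \<bar>v1 x\<bar> \<le> D * exp (- k * \<bar>x\<bar>))"
proof -
  obtain A cA where A: "\<And>x. (A has_real_derivative fm x * g x) (at x)" "\<And>x. x \<le> - R \<Longrightarrow> A x = 0" "\<And>x. \<bar>A x\<bar> \<le> cA"
    using primitive_of_compact_support[of "\<lambda>x. fm x * g x" R] continuous_on_mult[OF conts(3) cont] supp R by auto
  obtain B0 cB where B0: "\<And>x. (B0 has_real_derivative fp x * g x) (at x)" "\<And>x. x \<ge> R \<Longrightarrow> B0 x = B0 R" "\<And>x. \<bar>B0 x\<bar> \<le> cB"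
    using primitive_of_compact_support[of "\<lambda>x. fp x * g x" R] continuous_on_mult[OF conts(1) cont] supp R by auto
  define B where "B x = B0 R - B0 x" for x
  have dB: "(B has_real_derivative - (fp x * g x)) (at x)" for x
    unfolding B_def[abs_def] using DERIV_diff[OF DERIV_const B0(1)] by simp
  have B: "x \<ge> R \<Longrightarrow> B x = 0" "\<bar>B x\<bar> \<le> 2 * cB" for x
    using B0(2)[of x] B0(3)[of x] B0(3)[of R] by (auto simp: B_def)
  define v where "v x = fp x * A x + fm x * B x" for x
  define v1 where "v1 x = fp' x * A x + fm' x * B x" for x
  have dv: "(v has_real_derivative v1 x) (at x)" for x
    unfolding v_def[abs_def] v1_def
    by (rule derivative_eq_intros DERIVs A(1) dB refl)+ (simp add: algebra_simps)
  have dv1: "(v1 has_real_derivative (V x - E) * v x - g x) (at x)" for x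
  proof -
    have "(v1 has_real_derivative (V x - E) * v x - (fp x * fm' x - fp' x * fm x) * g x) (at x)"
      unfolding v1_def[abs_def] v_def
      by (rule derivative_eq_intros DERIVs A(1) dB refl)+ (simp add: algebra_simps)
    then show ?thesis by (simp add: wronskian)
  qed
  define D where "D = M * exp (2 * k * R) * (cA + 2 * cB)"
  have left: "\<bar>a * A x\<bar> \<le> M * exp (2 * k * R) * cA * exp (- k * \<bar>x\<bar>)" if a: "\<bar>a\<bar> \<le> M * exp (- k * x)" for a x
  proof (cases "x \<le> - R")
    case True
    have "cA \<ge> 0" using A(3)[of 0] by linarith
    then show ?thesis using A(2)[OF True] M_nonneg by simp
  next
    case False
    have "- k * x \<le> 2 * k * R + - k * \<bar>x\<bar>"
    proof -
      have "k * (\<bar>x\<bar> - x) \<le> k * (2 * R)" using False k_pos R by (intro mult_left_mono) auto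
      then show ?thesis by (simp add: algebra_simps)
    qed
    then have "exp (- k * x) \<le> exp (2 * k * R) * exp (- k * \<bar>x\<bar>)" by (simp add: exp_add[symmetric])
    then have "\<bar>a\<bar> \<le> M * (exp (2 * k * R) * exp (- k * \<bar>x\<bar>))"
      using a M_nonneg by (meson mult_left_mono order_trans)
    then have "\<bar>a\<bar> * \<bar>A x\<bar> \<le> M * (exp (2 * k * R) * exp (- k * \<bar>x\<bar>)) * cA"
      using A(3)[of x] M_nonneg by (intro mult_mono) auto
    then show ?thesis by (simp add: abs_mult mult_ac)
  qed
  have right: "\<bar>a * B x\<bar> \<le> M * exp (2 * k * R) * (2 * cB) * exp (- k * \<bar>x\<bar>)" if a: "\<bar>a\<bar> \<le> M * exp (k * x)" for a x
  proof (cases "x \<ge> R")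
    case True
    have "cB \<ge> 0" using B0(3)[of 0] by linarith
    then show ?thesis using B(1)[OF True] M_nonneg by simp
  next
    case False
    have "k * x \<le> 2 * k * R + - k * \<bar>x\<bar>"
    proof -
      have "k * (\<bar>x\<bar> + x) \<le> k * (2 * R)" using False k_pos R by (intro mult_left_mono) auto
      then show ?thesis by (simp add: algebra_simps)
    qed
    then have "exp (k * x) \<le> exp (2 * k * R) * exp (- k * \<bar>x\<bar>)" by (simp add: exp_add[symmetric])
    then have "\<bar>a\<bar> \<le> M * (exp (2 * k * R) * exp (- k * \<bar>x\<bar>))"
      using a M_nonneg by (meson mult_left_mono order_trans)
    then have "\<bar>a\<bar> * \<bar>B x\<bar> \<le> M * (exp (2 * k * R) * exp (- k * \<bar>x\<bar>)) * (2 * cB)"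
      using B(2)[of x] M_nonneg by (intro mult_mono) auto
    then show ?thesis by (simp add: abs_mult mult_ac)
  qed
  have D_eq: "M * exp (2 * k * R) * cA * exp (- k * \<bar>x\<bar>) + M * exp (2 * k * R) * (2 * cB) * exp (- k * \<bar>x\<bar>)
      = D * exp (- k * \<bar>x\<bar>)" for x by (simp add: D_def algebra_simps)
  have sum: "\<bar>a + b\<bar> \<le> a' + b'" if "\<bar>a\<bar> \<le> a'" "\<bar>b\<bar> \<le> b'" for a b a' b' :: real using that by linarith
  have "\<bar>v x\<bar> \<le> D * exp (- k * \<bar>x\<bar>) \<and> \<bar>v1 x\<bar> \<le> D * exp (- k * \<bar>x\<bar>)" for x
    using sum[OF left[OF fp_bound(1)] right[OF fm_bound(1)], of x x] sum[OF left[OF fp_bound(2)] right[OF fm_bound(2)], of x x]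
    unfolding D_eq v_def v1_def by blast
  with dv dv1 show ?thesis by blast
qed

text \<open>Duality instead of regularity: for a test function \<open>g\<close> let \<open>v\<close> solve \<open>- v'' + (V - E) v = g\<close>. Testing the weak equation for \<open>w\<close>
  with \<open>v\<close>, cut off at distance \<open>n\<close>, gives in the limit that \<open>w\<close> is orthogonal to \<open>g\<close>; the terms with derivatives of the
  cutoff disappear because \<open>v\<close> and \<open>v'\<close> decay.\<close>

lemma weak_solution_trivial:
  assumes w: "w \<in> L2" and weak: "is_weak_deriv 2 w (\<lambda>x. complex_of_real (V x - E) * w x)"
  shows "AE x in lborel. w x = 0"
proof (rule fundamental_lemma[OF w])
  fix g assume g: "test_function g"
  note [measurable] = L2D(1)[OF w]
  have cg: "continuous_on S g" for S using test_functionD(1)[OF g, of S 0] by simp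
  obtain R where R: "R > 0" "\<And>x. \<bar>x\<bar> > R \<Longrightarrow> g x = 0"
    using test_function_support[OF g] by (metis funpow_0)
  obtain v v1 D where v: "\<And>x. (v has_real_derivative v1 x) (at x)"
    "\<And>x. (v1 has_real_derivative (V x - E) * v x - g x) (at x)"
    "\<And>x. \<bar>v x\<bar> \<le> D * exp (- k * \<bar>x\<bar>)" "\<And>x. \<bar>v1 x\<bar> \<le> D * exp (- k * \<bar>x\<bar>)"
    using inhomogeneous_classical[OF cg R(2) R(1)] by blast
  have cv: "continuous_on S v" "continuous_on S v1" for S
    by (rule DERIV_imp_continuous_on, rule v)+
  obtain Mg where Mg: "Mg > 0" "\<And>x. \<bar>g x\<bar> \<le> Mg" using compact_support_bounded[OF cg R(2)] by blast
  obtain \<theta> where \<theta>: "test_function \<theta>" "\<theta> 0 \<noteq> 0" using cutoff_exists by blast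
  define \<theta>1 where "\<theta>1 = (deriv ^^ 1) \<theta>"
  define \<theta>2 where "\<theta>2 = (deriv ^^ 2) \<theta>"
  have d\<theta>: "(\<theta> has_real_derivative \<theta>1 x) (at x)" "(\<theta>1 has_real_derivative \<theta>2 x) (at x)" for x
    using test_functionD(2)[OF \<theta>(1), of 0 x] test_functionD(2)[OF \<theta>(1), of 1 x]
    by (simp_all add: \<theta>1_def \<theta>2_def numeral_2_eq_2)
  obtain r where r: "r > 0" "\<And>n x. \<bar>x\<bar> > r \<Longrightarrow> (deriv ^^ n) \<theta> x = 0" using test_function_support[OF \<theta>(1)] by blast
  have supp\<theta>: "\<theta> x = 0" "\<theta>1 x = 0" "\<theta>2 x = 0" if "\<bar>x\<bar> > r" for x
    using r(2)[OF that, of 0] r(2)[OF that, of 1] r(2)[OF that, of 2] by (auto simp: \<theta>1_def \<theta>2_def)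
  have c\<theta>: "continuous_on S \<theta>" "continuous_on S \<theta>1" "continuous_on S \<theta>2" for S
    using test_functionD(1)[OF \<theta>(1), of S 0] test_functionD(1)[OF \<theta>(1), of S 1] test_functionD(1)[OF \<theta>(1), of S 2]
    unfolding \<theta>1_def \<theta>2_def by simp_all
  obtain X where X: "\<And>x. \<bar>\<theta> x\<bar> \<le> X" "\<And>x. \<bar>\<theta>1 x\<bar> \<le> X" "\<And>x. \<bar>\<theta>2 x\<bar> \<le> X"
  proof -
    obtain X0 where "\<And>x. \<bar>\<theta> x\<bar> \<le> X0" using compact_support_bounded[OF c\<theta>(1) supp\<theta>(1)] by blast
    moreover obtain X1 where "\<And>x. \<bar>\<theta>1 x\<bar> \<le> X1" using compact_support_bounded[OF c\<theta>(2) supp\<theta>(2)] by blast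
    moreover obtain X2 where "\<And>x. \<bar>\<theta>2 x\<bar> \<le> X2" using compact_support_bounded[OF c\<theta>(3) supp\<theta>(3)] by blast
    ultimately show ?thesis by (intro that[of "max X0 (max X1 X2)"]) (auto simp: le_max_iff_disj)
  qed
  define c where "c n = 1 / real (Suc n)" for n
  have c01: "c n > 0" "c n \<le> 1" for n by (auto simp: c_def)
  have c0: "c \<longlonglongrightarrow> 0" unfolding c_def[abs_def] by (rule LIMSEQ_Suc[OF lim_1_over_n])
  \<comment> \<open>What is left of \<open>h'' - (V - E) h\<close> for the cut-off function \<open>h = v \<theta> (c x)\<close>.\<close>
  define e where "e n x = - (g x * \<theta> (x * c n)) + 2 * c n * (v1 x * \<theta>1 (x * c n)) + (c n)\<^sup>2 * (v x * \<theta>2 (x * c n))" for n x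
  have ce: "continuous_on UNIV (e n)" for n
    unfolding e_def by (intro continuous_intros cg cv continuous_on_compose2[OF c\<theta>(1)] continuous_on_compose2[OF c\<theta>(2)] continuous_on_compose2[OF c\<theta>(3)]) auto
  have zero: "(LINT x|lborel. w x * complex_of_real (e n x)) = 0" for n
  proof -
    define h where "h x = v x * \<theta> (x * c n)" for x
    define h1 where "h1 x = v1 x * \<theta> (x * c n) + c n * (v x * \<theta>1 (x * c n))" for x
    define h2 where "h2 x = (V x - E) * h x + e n x" for x
    have ds: "((\<lambda>x. x * c n) has_real_derivative c n) (at x)" for x by (auto intro!: derivative_eq_intros)
    have dc: "((\<lambda>x. \<theta> (x * c n)) has_real_derivative \<theta>1 (x * c n) * c n) (at x)"
      "((\<lambda>x. \<theta>1 (x * c n)) has_real_derivative \<theta>2 (x * c n) * c n) (at x)" for x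
      by (rule DERIV_chain2[where g = "\<lambda>x. x * c n", OF d\<theta>(1) ds] DERIV_chain2[where g = "\<lambda>x. x * c n", OF d\<theta>(2) ds])+
    have dh: "(h has_real_derivative h1 x) (at x)" for x
      unfolding h_def[abs_def] h1_def
      by (rule derivative_eq_intros v dc refl)+ (simp add: algebra_simps)
    have dh1: "(h1 has_real_derivative h2 x) (at x)" for x
      unfolding h1_def[abs_def] h2_def h_def e_def
      by (rule derivative_eq_intros v dc refl)+ (simp add: algebra_simps power2_eq_square)
    have ch: "continuous_on UNIV h" by (rule DERIV_imp_continuous_on[OF dh])
    have ch2: "continuous_on UNIV h2" unfolding h2_def by (intro continuous_intros cont_V ch ce)
    have supp: "h x = 0" "e n x = 0" if "\<bar>x\<bar> > r * real (Suc n)" for x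
    proof -
      have "\<bar>x * c n\<bar> > r" using that by (simp add: c_def abs_mult field_simps)
      from supp\<theta>[OF this] show "h x = 0" "e n x = 0" by (auto simp: h_def e_def)
    qed
    have "(LINT x|lborel. w x * complex_of_real (h2 x)) = (LINT x|lborel. complex_of_real (V x - E) * w x * complex_of_real (h x))"
      by (rule weak_deriv_2_test_C2[OF w q_L2[OF w] weak dh dh1 ch2, of "r * real (Suc n)"]) (use supp in \<open>auto simp: h2_def\<close>)
    moreover have "(LINT x|lborel. w x * complex_of_real (h2 x)) =
      (LINT x|lborel. complex_of_real (V x - E) * w x * complex_of_real (h x)) + (LINT x|lborel. w x * complex_of_real (e n x))"
    proof (subst Bochner_Integration.integral_add[symmetric])
      show "integrable lborel (\<lambda>x. complex_of_real (V x - E) * w x * complex_of_real (h x))"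
        by (rule L2_mult_integrable[OF q_L2[OF w] L2_continuous_support[OF ch supp(1)]])
      show "integrable lborel (\<lambda>x. w x * complex_of_real (e n x))"
        by (rule L2_mult_integrable[OF w L2_continuous_support[OF ce supp(2)]])
    qed (simp add: h2_def algebra_simps)
    ultimately show ?thesis by simp
  qed
  define D' where "D' = Mg * exp (k * R)"
  have g_exp: "\<bar>g x\<bar> \<le> D' * exp (- k * \<bar>x\<bar>)" for x
  proof (cases "\<bar>x\<bar> > R")
    case False
    have "Mg * 1 \<le> Mg * exp (k * (R - \<bar>x\<bar>))" using False Mg(1) k_pos by (intro mult_left_mono) auto
    then show ?thesis using Mg(2)[of x] unfolding D'_def
      by (simp add: right_diff_distrib exp_diff exp_minus divide_inverse mult.assoc)
  qed (use R(2) Mg(1) in \<open>simp add: D'_def\<close>)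
  let ?b = "\<lambda>x. X * (D' + 2 * D + D) * exp (- k * \<bar>x\<bar>)"
  have X0: "X \<ge> 0" using X(1)[of 0] by linarith
  have e_bound: "\<bar>e n x\<bar> \<le> ?b x" for n x
  proof -
    have 1: "\<bar>g x * \<theta> (x * c n)\<bar> \<le> D' * exp (- k * \<bar>x\<bar>) * X"
      unfolding abs_mult by (rule mult_mono[OF g_exp X(1) order_trans[OF abs_ge_zero g_exp] abs_ge_zero])
    have "\<bar>v1 x * \<theta>1 (x * c n)\<bar> \<le> D * exp (- k * \<bar>x\<bar>) * X"
      unfolding abs_mult by (rule mult_mono[OF v(4) X(2) order_trans[OF abs_ge_zero v(4)] abs_ge_zero])
    then have 2: "\<bar>2 * c n * (v1 x * \<theta>1 (x * c n))\<bar> \<le> 2 * (D * exp (- k * \<bar>x\<bar>) * X)"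
      using c01[of n] mult_mono[of "c n" 1 "\<bar>v1 x * \<theta>1 (x * c n)\<bar>" "D * exp (- k * \<bar>x\<bar>) * X"]
      by (simp add: abs_mult)
    have "\<bar>v x * \<theta>2 (x * c n)\<bar> \<le> D * exp (- k * \<bar>x\<bar>) * X"
      unfolding abs_mult by (rule mult_mono[OF v(3) X(3) order_trans[OF abs_ge_zero v(3)] abs_ge_zero])
    moreover have "(c n)\<^sup>2 \<le> 1" using c01[of n] by (simp add: power_le_one)
    ultimately have 3: "\<bar>(c n)\<^sup>2 * (v x * \<theta>2 (x * c n))\<bar> \<le> D * exp (- k * \<bar>x\<bar>) * X"
      using mult_mono[of "(c n)\<^sup>2" 1 "\<bar>v x * \<theta>2 (x * c n)\<bar>" "D * exp (- k * \<bar>x\<bar>) * X"]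
      by (simp add: abs_mult)
    have "?b x = D' * exp (- k * \<bar>x\<bar>) * X + 2 * (D * exp (- k * \<bar>x\<bar>) * X) + D * exp (- k * \<bar>x\<bar>) * X"
      by (simp add: algebra_simps)
    moreover have "\<bar>- a + b + c\<bar> \<le> a' + b' + c'" if "\<bar>a\<bar> \<le> a'" "\<bar>b\<bar> \<le> b'" "\<bar>c\<bar> \<le> c'" for a b c a' b' c' :: real
      using that by linarith
    from this[OF 1 2 3] have "\<bar>e n x\<bar> \<le> D' * exp (- k * \<bar>x\<bar>) * X + 2 * (D * exp (- k * \<bar>x\<bar>) * X) + D * exp (- k * \<bar>x\<bar>) * X"
      by (simp only: e_def)
    ultimately show ?thesis by (simp only:)
  qed
  have bL2: "(\<lambda>x. complex_of_real (?b x)) \<in> L2"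
    by (rule L2_exp_bound[OF _ k_pos, where M = "\<bar>X * (D' + 2 * D + D)\<bar>"])
      (measurable, simp add: abs_mult norm_mult del: of_real_mult)
  note [measurable] = borel_measurable_continuous[OF ce] borel_measurable_continuous[OF cg]
  have "(\<lambda>n. LINT x|lborel. w x * complex_of_real (e n x)) \<longlonglongrightarrow> (LINT x|lborel. w x * complex_of_real (- (g x * \<theta> 0)))"
  proof (rule integral_dominated_convergence)
    show "integrable lborel (\<lambda>x. cmod (w x * complex_of_real (?b x)))"
      by (rule integrable_norm[OF L2_mult_integrable[OF w bL2]])
    have lim: "(\<lambda>n. f (x * c n)) \<longlonglongrightarrow> f 0" if "continuous_on UNIV f" for f :: "real \<Rightarrow> real" and x
    proof -
      have "(\<lambda>n. x * c n) \<longlonglongrightarrow> x * 0" by (intro tendsto_intros c0)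
      then show ?thesis using that by (auto simp: continuous_on_eq_continuous_at intro: isCont_tendsto_compose)
    qed
    have "(\<lambda>n. e n x) \<longlonglongrightarrow> - (g x * \<theta> 0) + 2 * 0 * (v1 x * \<theta>1 0) + 0\<^sup>2 * (v x * \<theta>2 0)" for x
      unfolding e_def by (intro tendsto_intros c0 lim c\<theta>)
    then show "AE x in lborel. (\<lambda>n. w x * complex_of_real (e n x)) \<longlonglongrightarrow> w x * complex_of_real (- (g x * \<theta> 0))"
      by (intro always_eventually allI tendsto_mult tendsto_of_real tendsto_const) simp
    have "\<bar>e n x\<bar> \<le> \<bar>?b x\<bar>" for n x using e_bound[of n x] by linarith
    then show "AE x in lborel. cmod (w x * complex_of_real (e n x)) \<le> cmod (w x * complex_of_real (?b x))" for n
      unfolding norm_mult norm_of_real by (intro always_eventually allI mult_left_mono) auto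
  qed measurable
  then have "(LINT x|lborel. w x * complex_of_real (- (g x * \<theta> 0))) = 0"
    by (simp add: zero LIMSEQ_const_iff)
  moreover have "(LINT x|lborel. w x * complex_of_real (- (g x * \<theta> 0))) =
      (LINT x|lborel. w x * complex_of_real (g x)) * complex_of_real (- \<theta> 0)"
    by (subst Bochner_Integration.integral_mult_left_zero[symmetric]) (simp add: mult_ac)
  ultimately show "(LINT x|lborel. w x * complex_of_real (g x)) = 0" using \<theta>(2) by simp
qed

definition green :: "real \<Rightarrow> real \<Rightarrow> real" where
  "green x y = fp (max x y) * fm (min x y)"

text \<open>The derivative of \<open>green\<close> in its first argument; it jumps by \<open>-1\<close> on the diagonal.\<close>

definition green1 :: "real \<Rightarrow> real \<Rightarrow> real" where
  "green1 x y = (if y \<le> x then fp' x * fm y else fm' x * fp y)"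

lemma product_bound:
  assumes "\<bar>a\<bar> \<le> M * exp (- k * x)" "\<bar>b\<bar> \<le> M * exp (k * y)"
  shows "\<bar>a * b\<bar> \<le> M\<^sup>2 * exp (- k * (x - y))"
proof -
  have "\<bar>a * b\<bar> \<le> (M * exp (- k * x)) * (M * exp (k * y))"
    unfolding abs_mult using assms by (intro mult_mono) (auto intro: order_trans[OF abs_ge_zero])
  also have "\<dots> = M\<^sup>2 * exp (- k * (x - y))"
    by (simp add: power2_eq_square right_diff_distrib exp_diff exp_minus divide_inverse mult_ac)
  finally show ?thesis .
qed

sublocale green: decaying_kernel green "M\<^sup>2" k
proof
  show "case_prod green \<in> borel_measurable (borel \<Otimes>\<^sub>M borel)" unfolding green_def by measurable
  show "\<bar>green x y\<bar> \<le> M\<^sup>2 * exp (- k * \<bar>x - y\<bar>)" for x y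
    using product_bound[OF fp_bound(1)[of "max x y"] fm_bound(1)[of "min x y"]]
    by (cases "x \<le> y") (simp_all add: green_def max_absorb1 max_absorb2 min_absorb1 min_absorb2)
qed (rule k_pos)

sublocale green1: decaying_kernel green1 "M\<^sup>2" k
proof
  show "case_prod green1 \<in> borel_measurable (borel \<Otimes>\<^sub>M borel)" unfolding green1_def by measurable
  show "\<bar>green1 x y\<bar> \<le> M\<^sup>2 * exp (- k * \<bar>x - y\<bar>)" for x y
  proof (cases "y \<le> x")
    case True
    then show ?thesis using product_bound[OF fp_bound(2)[of x] fm_bound(1)[of y]] by (simp add: green1_def)
  next
    case False
    then show ?thesis using product_bound[OF fp_bound(1)[of y] fm_bound(2)[of x]]
      by (simp add: green1_def mult.commute)
  qed
qed (rule k_pos)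

lemma continuous_green: "continuous_on UNIV (\<lambda>x. green x y)"
  unfolding green_def
  by (intro continuous_intros continuous_on_compose2[OF conts(1)[of UNIV]] continuous_on_compose2[OF conts(3)[of UNIV]]) auto

text \<open>Integrate by parts on both sides of \<open>y\<close>; the boundary terms at \<open>y\<close> add up to \<open>- \<phi> y\<close> times the Wronskian.\<close>

lemma green_second_identity:
  assumes \<phi>: "test_function \<phi>"
  shows "(LINT x|lborel. green x y * ((deriv ^^ 2) \<phi> x - (V x - E) * \<phi> x)) = - \<phi> y"
proof -
  obtain R where R: "R > 0" "\<And>n x. \<bar>x\<bar> > R \<Longrightarrow> (deriv ^^ n) \<phi> x = 0" using test_function_support[OF \<phi>] by blast
  define T where "T = R + \<bar>y\<bar> + 1"
  have T: "- T \<le> y" "y \<le> T" "\<bar>T\<bar> > R" "\<bar>- T\<bar> > R" using R(1) by (auto simp: T_def)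
  have d: "(\<phi> has_real_derivative (deriv ^^ 1) \<phi> x) (at x)"
      "((deriv ^^ 1) \<phi> has_real_derivative (deriv ^^ 2) \<phi> x) (at x)" for x
    using test_functionD(2)[OF \<phi>, of 0 x] test_functionD(2)[OF \<phi>, of 1 x] by (simp_all add: numeral_2_eq_2)
  let ?h = "\<lambda>x. (deriv ^^ 2) \<phi> x - (V x - E) * \<phi> x"
  define Fm where "Fm x = fp y * (fm x * (deriv ^^ 1) \<phi> x - fm' x * \<phi> x)" for x
  define Fp where "Fp x = fm y * (fp x * (deriv ^^ 1) \<phi> x - fp' x * \<phi> x)" for x
  have dFm: "(Fm has_real_derivative fp y * (fm x * ?h x)) (at x)" for x
    unfolding Fm_def[abs_def] by (rule derivative_eq_intros DERIVs d refl)+ (simp add: algebra_simps)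
  have dFp: "(Fp has_real_derivative fm y * (fp x * ?h x)) (at x)" for x
    unfolding Fp_def[abs_def] by (rule derivative_eq_intros DERIVs d refl)+ (simp add: algebra_simps)
  have "((\<lambda>x. green x y * ?h x) has_integral (Fm y - Fm (- T))) {- T..y}"
    by (rule has_integral_eq[OF _ FTC_real[OF dFm T(1)]]) (simp add: green_def max_absorb2 min_absorb1)
  moreover have "((\<lambda>x. green x y * ?h x) has_integral (Fp T - Fp y)) {y..T}"
    by (rule has_integral_eq[OF _ FTC_real[OF dFp T(2)]]) (simp add: green_def max_absorb1 min_absorb2)
  ultimately have hi: "((\<lambda>x. green x y * ?h x) has_integral (Fm y - Fm (- T) + (Fp T - Fp y))) {- T..T}"
    by (rule has_integral_combine[OF T(1,2)])
  have c: "continuous_on UNIV (\<lambda>x. green x y * ?h x)"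
    using test_functionD(1)[OF \<phi>, of UNIV 0] test_functionD(1)[OF \<phi>, of UNIV 2]
    by (intro continuous_intros continuous_green cont_V) auto
  have supp: "green x y * ?h x = 0" if "x \<notin> {-T..T}" for x
  proof -
    have "\<bar>x\<bar> > R" using that by (auto simp: T_def)
    then show ?thesis using R(2)[of x 0] R(2)[of x 2] by simp
  qed
  have "Fm (- T) = 0" "Fp T = 0"
    using R(2)[OF T(4), of 0] R(2)[OF T(4), of 1] R(2)[OF T(3), of 0] R(2)[OF T(3), of 1]
    by (simp_all add: Fm_def Fp_def)
  moreover have "Fm y - Fp y = - (fp y * fm' y - fp' y * fm y) * \<phi> y"
    by (simp add: Fm_def Fp_def algebra_simps)
  ultimately have "Fm y - Fm (- T) + (Fp T - Fp y) = - \<phi> y" by (simp add: wronskian)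
  with LINT_eq_integral_compact_support[OF compact_support_integral(1)[OF c supp] hi supp]
  show ?thesis by simp
qed

text \<open>The boundary terms at \<open>y\<close> cancel since \<open>green\<close> is continuous across the diagonal.\<close>

lemma green_first_identity:
  assumes \<phi>: "test_function \<phi>"
  shows "(LINT x|lborel. green x y * (deriv ^^ 1) \<phi> x) = - (LINT x|lborel. green1 x y * \<phi> x)"
proof -
  obtain R where R: "R > 0" "\<And>n x. \<bar>x\<bar> > R \<Longrightarrow> (deriv ^^ n) \<phi> x = 0" using test_function_support[OF \<phi>] by blast
  define T where "T = R + \<bar>y\<bar> + 1"
  have T: "- T \<le> y" "y \<le> T" "\<bar>T\<bar> > R" "\<bar>- T\<bar> > R" using R(1) by (auto simp: T_def)
  have d: "(\<phi> has_real_derivative (deriv ^^ 1) \<phi> x) (at x)" for x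
    using test_functionD(2)[OF \<phi>, of 0 x] by simp
  have c0: "continuous_on UNIV \<phi>" using test_functionD(1)[OF \<phi>, of UNIV 0] by simp
  note [measurable] = borel_measurable_continuous[OF c0]
  define h where "h x = green x y * (deriv ^^ 1) \<phi> x + green1 x y * \<phi> x" for x
  have outside: "\<bar>x\<bar> > R" if "x \<notin> {-T..T}" for x using that by (auto simp: T_def)
  have i1: "integrable lborel (\<lambda>x. green x y * (deriv ^^ 1) \<phi> x)"
    by (rule compact_support_integral(1)[of _ "- T" T])
      (use outside R(2)[of _ 1] in \<open>auto intro!: continuous_on_mult continuous_green test_functionD(1)[OF \<phi>, of UNIV 1, simplified]\<close>)
  have i\<phi>: "integrable lborel \<phi>"
    by (rule compact_support_integral(1)[OF c0, of "- T" T]) (use outside R(2)[of _ 0] in auto)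
  have i2: "integrable lborel (\<lambda>x. green1 x y * \<phi> x)"
  proof (rule Bochner_Integration.integrable_bound)
    show "integrable lborel (\<lambda>x. M\<^sup>2 * \<phi> x)" using i\<phi> by simp
    show "(\<lambda>x. green1 x y * \<phi> x) \<in> borel_measurable lborel" unfolding green1_def by measurable
    have "\<bar>green1 x y\<bar> \<le> M\<^sup>2" for x
    proof -
      have "M\<^sup>2 * exp (- k * \<bar>x - y\<bar>) \<le> M\<^sup>2 * 1" using k_pos by (intro mult_left_mono) auto
      with green1.K_bound[of x y] show ?thesis by linarith
    qed
    then show "AE x in lborel. norm (green1 x y * \<phi> x) \<le> norm (M\<^sup>2 * \<phi> x)"
      by (auto simp: abs_mult intro!: mult_right_mono)
  qed
  have "((\<lambda>x. fp y * (fm' x * \<phi> x + fm x * (deriv ^^ 1) \<phi> x)) has_integral (fp y * (fm y * \<phi> y) - fp y * (fm (- T) * \<phi> (- T)))) {- T..y}"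
    by (rule FTC_real[OF _ T(1)]) (rule derivative_eq_intros DERIVs d refl | simp add: algebra_simps)+
  then have "(h has_integral (fp y * (fm y * \<phi> y) - fp y * (fm (- T) * \<phi> (- T)))) {- T..y}"
    by (rule has_integral_spike_finite[of "{y}", rotated 2]) (auto simp: h_def green_def green1_def max_def min_def algebra_simps)
  moreover have "((\<lambda>x. fm y * (fp' x * \<phi> x + fp x * (deriv ^^ 1) \<phi> x)) has_integral (fm y * (fp T * \<phi> T) - fm y * (fp y * \<phi> y))) {y..T}"
    by (rule FTC_real[OF _ T(2)]) (rule derivative_eq_intros DERIVs d refl | simp add: algebra_simps)+
  then have "(h has_integral (fm y * (fp T * \<phi> T) - fm y * (fp y * \<phi> y))) {y..T}"
    by (rule has_integral_eq[rotated]) (auto simp: h_def green_def green1_def max_def min_def algebra_simps)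
  ultimately have hi: "(h has_integral (fp y * (fm y * \<phi> y) - fp y * (fm (- T) * \<phi> (- T)) + (fm y * (fp T * \<phi> T) - fm y * (fp y * \<phi> y)))) {- T..T}"
    by (rule has_integral_combine[OF T(1,2)])
  have supp: "h x = 0" if "x \<notin> {-T..T}" for x
    using R(2)[OF outside[OF that], of 0] R(2)[OF outside[OF that], of 1] by (simp add: h_def)
  have ih: "integrable lborel h" unfolding h_def by (rule Bochner_Integration.integrable_add[OF i1 i2])
  have "(LINT x|lborel. h x) = 0"
    using LINT_eq_integral_compact_support[OF ih hi supp] R(2)[OF T(4), of 0] R(2)[OF T(3), of 0] by simp
  then show ?thesis using Bochner_Integration.integral_add[OF i1 i2] by (simp add: h_def)
qed

lemma green_weak_derivs:
  assumes f: "f \<in> L2"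
  shows "is_weak_deriv 1 (kernel_op green f) (kernel_op green1 f)"
    "is_weak_deriv 2 (kernel_op green f) (\<lambda>x. complex_of_real (V x - E) * kernel_op green f x - f x)"
proof -
  note u = green.kernel_op_L2[OF f]
  show "is_weak_deriv 1 (kernel_op green f) (kernel_op green1 f)"
    unfolding is_weak_deriv_def
  proof (intro allI impI)
    fix \<phi> assume \<phi>: "test_function \<phi>"
    obtain R where R: "\<And>n x. \<bar>x\<bar> > R \<Longrightarrow> (deriv ^^ n) \<phi> x = 0" using test_function_support[OF \<phi>] by blast
    have c0: "continuous_on UNIV \<phi>" using test_functionD(1)[OF \<phi>, of UNIV 0] by simp
    have R0: "\<bar>x\<bar> > R \<Longrightarrow> \<phi> x = 0" for x using R[of x 0] by simp
    have "(LINT x|lborel. kernel_op green f x * complex_of_real ((deriv ^^ 1) \<phi> x)) =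
       (LINT y|lborel. - (f y * complex_of_real (LINT x|lborel. green1 x y * \<phi> x)))"
      by (subst green.kernel_op_transpose[OF f test_functionD(1)[OF \<phi>] R], assumption)
        (simp only: green_first_identity[OF \<phi>] of_real_minus mult_minus_right)
    also have "\<dots> = - (LINT x|lborel. kernel_op green1 f x * complex_of_real (\<phi> x))"
      using green1.kernel_op_transpose[OF f c0 R0] by simp
    finally show "(LINT x|lborel. kernel_op green f x * complex_of_real ((deriv ^^ 1) \<phi> x)) =
       (- 1) ^ 1 * (LINT x|lborel. kernel_op green1 f x * complex_of_real (\<phi> x))" by simp
  qed
  show "is_weak_deriv 2 (kernel_op green f) (\<lambda>x. complex_of_real (V x - E) * kernel_op green f x - f x)"
    unfolding is_weak_deriv_def
  proof (intro allI impI)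
    fix \<phi> assume \<phi>: "test_function \<phi>"
    obtain R where R: "\<And>n x. \<bar>x\<bar> > R \<Longrightarrow> (deriv ^^ n) \<phi> x = 0" using test_function_support[OF \<phi>] by blast
    have c0: "continuous_on UNIV \<phi>" using test_functionD(1)[OF \<phi>, of UNIV 0] by simp
    have c: "continuous_on UNIV (\<lambda>x. (deriv ^^ 2) \<phi> x - (V x - E) * \<phi> x)"
      by (intro continuous_intros test_functionD(1)[OF \<phi>] cont_V c0)
    have supp: "(deriv ^^ 2) \<phi> x - (V x - E) * \<phi> x = 0" if "\<bar>x\<bar> > R" for x
      using R[OF that, of 2] R[OF that, of 0] by simp
    let ?u = "kernel_op green f"
    have L\<phi>: "(\<lambda>x. complex_of_real (\<phi> x)) \<in> L2" "(\<lambda>x. complex_of_real ((deriv ^^ 2) \<phi> x)) \<in> L2"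
      using L2_test_function[OF \<phi>, of 0] L2_test_function[OF \<phi>, of 2] by auto
    have i1: "integrable lborel (\<lambda>x. ?u x * complex_of_real ((deriv ^^ 2) \<phi> x))"
      by (rule L2_mult_integrable[OF u L\<phi>(2)])
    have i2: "integrable lborel (\<lambda>x. complex_of_real (V x - E) * ?u x * complex_of_real (\<phi> x))"
      by (rule L2_mult_integrable[OF q_L2[OF u] L\<phi>(1)])
    have i3: "integrable lborel (\<lambda>x. f x * complex_of_real (\<phi> x))"
      by (rule L2_mult_integrable[OF f L\<phi>(1)])
    have "(LINT x|lborel. ?u x * complex_of_real ((deriv ^^ 2) \<phi> x)) -
        (LINT x|lborel. complex_of_real (V x - E) * ?u x * complex_of_real (\<phi> x)) =
        (LINT x|lborel. ?u x * complex_of_real ((deriv ^^ 2) \<phi> x - (V x - E) * \<phi> x))"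
      by (subst Bochner_Integration.integral_diff[OF i1 i2, symmetric]) (simp add: algebra_simps)
    also have "\<dots> = (LINT y|lborel. - (f y * complex_of_real (\<phi> y)))"
      by (subst green.kernel_op_transpose[OF f c supp], assumption)
        (simp only: green_second_identity[OF \<phi>] of_real_minus mult_minus_right)
    finally have "(LINT x|lborel. ?u x * complex_of_real ((deriv ^^ 2) \<phi> x)) =
        (LINT x|lborel. complex_of_real (V x - E) * ?u x * complex_of_real (\<phi> x)) - (LINT y|lborel. f y * complex_of_real (\<phi> y))"
      by (simp add: diff_eq_eq)
    also have "\<dots> = (LINT x|lborel. (complex_of_real (V x - E) * ?u x - f x) * complex_of_real (\<phi> x))"
      using Bochner_Integration.integral_diff[OF i2 i3] by (simp add: left_diff_distrib)
    finally show "(LINT x|lborel. ?u x * complex_of_real ((deriv ^^ 2) \<phi> x)) =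
        (- 1)\<^sup>2 * (LINT x|lborel. (complex_of_real (V x - E) * ?u x - f x) * complex_of_real (\<phi> x))" by simp
  qed
qed

lemma green_sobolev: assumes f: "f \<in> L2" shows "kernel_op green f \<in> sobolev_H 2"
proof -
  note u = green.kernel_op_L2[OF f]
  have "\<exists>v\<in>L2. is_weak_deriv n (kernel_op green f) v" if "n \<le> 2" for n
  proof -
    from that consider "n = 0" | "n = 1" | "n = 2" by linarith
    then show ?thesis
    proof cases
      case 1
      then show ?thesis using u by (auto simp: is_weak_deriv_def)
    next
      case 2
      then show ?thesis using green_weak_derivs(1)[OF f] green1.kernel_op_L2[OF f] by blast
    next
      case 3
      then show ?thesis using green_weak_derivs(2)[OF f] L2_diff[OF q_L2[OF u] f] by blast
    qed
  qed
  then show ?thesis using u by (simp add: sobolev_H_def)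
qed

lemma sobolev_weak_equation:
  assumes u: "u \<in> sobolev_H 2"
  shows "(\<lambda>x. schroedinger V u x - complex_of_real E * u x) \<in> L2"
    "is_weak_deriv 2 u (\<lambda>x. complex_of_real (V x - E) * u x - (schroedinger V u x - complex_of_real E * u x))"
proof -
  have uL: "u \<in> L2" using u by (simp add: sobolev_H_def)
  obtain b where b: "b \<in> L2" "is_weak_deriv 2 u b" using u by (auto simp: sobolev_H_def)
  note wd = weak_deriv(1,2)[OF b]
  have eq: "schroedinger V u x - complex_of_real E * u x = complex_of_real (V x - E) * u x - weak_deriv 2 u x" for x
    by (simp add: schroedinger_def algebra_simps)
  show "(\<lambda>x. schroedinger V u x - complex_of_real E * u x) \<in> L2"
    unfolding eq by (rule L2_diff[OF q_L2[OF uL] wd(1)])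
  show "is_weak_deriv 2 u (\<lambda>x. complex_of_real (V x - E) * u x - (schroedinger V u x - complex_of_real E * u x))"
    unfolding eq using wd(2) by simp
qed

lemma weak_solution_unique:
  assumes u: "u \<in> L2" "is_weak_deriv 2 u (\<lambda>x. complex_of_real (V x - E) * u x - f x)"
    and v: "v \<in> L2" "is_weak_deriv 2 v (\<lambda>x. complex_of_real (V x - E) * v x - h x)"
    and f: "f \<in> L2" "h \<in> L2" and eq: "AE x in lborel. f x = h x"
  shows "AE x in lborel. u x = v x"
proof -
  note [measurable] = L2D(1)[OF u(1)] L2D(1)[OF v(1)] L2D(1)[OF f(1)] L2D(1)[OF f(2)]
  have "is_weak_deriv 2 (\<lambda>x. u x - v x) (\<lambda>x. complex_of_real (V x - E) * (u x - v x))"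
    unfolding is_weak_deriv_def
  proof (intro allI impI)
    fix \<phi> assume \<phi>: "test_function \<phi>"
    have L\<phi>: "(\<lambda>x. complex_of_real (\<phi> x)) \<in> L2" "(\<lambda>x. complex_of_real ((deriv ^^ 2) \<phi> x)) \<in> L2"
      using L2_test_function[OF \<phi>, of 0] L2_test_function[OF \<phi>, of 2] by auto
    note i = L2_mult_integrable[OF u(1) L\<phi>(2)] L2_mult_integrable[OF v(1) L\<phi>(2)]
      L2_mult_integrable[OF L2_diff[OF q_L2[OF u(1)] f(1)] L\<phi>(1)] L2_mult_integrable[OF L2_diff[OF q_L2[OF v(1)] f(2)] L\<phi>(1)]
    have "(LINT x|lborel. (u x - v x) * complex_of_real ((deriv ^^ 2) \<phi> x)) =
       (LINT x|lborel. u x * complex_of_real ((deriv ^^ 2) \<phi> x)) - (LINT x|lborel. v x * complex_of_real ((deriv ^^ 2) \<phi> x))"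
      using Bochner_Integration.integral_diff[OF i(1,2)] by (simp only: left_diff_distrib)
    also have "\<dots> = (LINT x|lborel. (complex_of_real (V x - E) * u x - f x) * complex_of_real (\<phi> x)) -
        (LINT x|lborel. (complex_of_real (V x - E) * v x - h x) * complex_of_real (\<phi> x))"
      using u(2) v(2) \<phi> by (simp add: is_weak_deriv_def)
    also have "\<dots> = (LINT x|lborel. (complex_of_real (V x - E) * u x - f x) * complex_of_real (\<phi> x) -
        (complex_of_real (V x - E) * v x - h x) * complex_of_real (\<phi> x))"
      by (rule Bochner_Integration.integral_diff[OF i(3,4), symmetric])
    also have "\<dots> = (LINT x|lborel. complex_of_real (V x - E) * (u x - v x) * complex_of_real (\<phi> x))"
    proof (rule integral_cong_AE)
      show "AE x in lborel. (complex_of_real (V x - E) * u x - f x) * complex_of_real (\<phi> x) -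
        (complex_of_real (V x - E) * v x - h x) * complex_of_real (\<phi> x) = complex_of_real (V x - E) * (u x - v x) * complex_of_real (\<phi> x)"
        using eq by eventually_elim (simp add: algebra_simps)
    qed (use L2D(1)[OF L\<phi>(1)] in measurable)
    finally show "(LINT x|lborel. (u x - v x) * complex_of_real ((deriv ^^ 2) \<phi> x)) =
       (- 1)\<^sup>2 * (LINT x|lborel. complex_of_real (V x - E) * (u x - v x) * complex_of_real (\<phi> x))" by simp
  qed
  from weak_solution_trivial[OF L2_diff[OF u(1) v(1)] this] show ?thesis by eventually_elim simp
qed

text \<open>Green's operator provides solutions in \<open>H\<^sup>2\<close>. By uniqueness of weak solutions every \<open>u\<close> in the domain is recovered from its
  residual by Green's operator, so injectivity and the a priori bound follow from the norm bound of that operator.\<close>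

theorem in_resolvent_set: "complex_of_real E \<in> resolvent_set (sobolev_H 2) (schroedinger V)"
proof -
  let ?T = "\<lambda>u x. schroedinger V u x - complex_of_real E * u x"
  have solve: "AE x in lborel. u x = kernel_op green (?T u) x" if u: "u \<in> sobolev_H 2" for u
  proof -
    note we = sobolev_weak_equation[OF u]
    have uL: "u \<in> L2" using u by (simp add: sobolev_H_def)
    show ?thesis
      by (rule weak_solution_unique[OF uL we(2) green.kernel_op_L2[OF we(1)] green_weak_derivs(2)[OF we(1)] we(1) we(1)]) simp
  qed
  show ?thesis
    unfolding resolvent_set_def
  proof (intro CollectI conjI ballI impI)
    fix u assume u: "u \<in> sobolev_H 2" and z: "AE x in lborel. schroedinger V u x - complex_of_real E * u x = 0"
    have "kernel_op green (?T u) x = 0" for x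
    proof -
      note [measurable] = L2D(1)[OF sobolev_weak_equation(1)[OF u]]
      have "kernel_op green (?T u) x = (LINT y::real|lborel. 0)"
        unfolding kernel_op_def
      proof (rule integral_cong_AE)
        show "AE y in lborel. complex_of_real (green x y) * ?T u y = 0" using z by eventually_elim simp
      qed (unfold green_def, measurable)
      then show ?thesis by simp
    qed
    with solve[OF u] show "AE x in lborel. u x = 0" by simp
  next
    fix f assume f: "f \<in> L2"
    let ?u = "kernel_op green f"
    have "AE x in lborel. weak_deriv 2 ?u x = complex_of_real (V x - E) * ?u x - f x"
      by (rule weak_deriv(3)[OF L2_diff[OF q_L2[OF green.kernel_op_L2[OF f]] f] green_weak_derivs(2)[OF f]])
    then have "AE x in lborel. ?T ?u x = f x"
      by eventually_elim (simp add: schroedinger_def algebra_simps)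
    with green_sobolev[OF f] show "\<exists>u\<in>sobolev_H 2. AE x in lborel. schroedinger V u x - complex_of_real E * u x = f x" by blast
  next
    show "\<exists>C. \<forall>u\<in>sobolev_H 2. L2_norm u \<le> C * L2_norm (\<lambda>x. schroedinger V u x - complex_of_real E * u x)"
    proof (intro exI ballI)
      fix u assume u: "u \<in> sobolev_H 2"
      have "u \<in> L2" using u by (simp add: sobolev_H_def)
      note m = L2D(1)[OF this]
      note f = sobolev_weak_equation(1)[OF u]
      note [measurable] = m L2D(1)[OF green.kernel_op_L2[OF f]]
      have "L2_norm u = L2_norm (kernel_op green (?T u))"
        unfolding L2_norm_def
      proof (rule arg_cong[where f = sqrt], rule integral_cong_AE)
        show "AE x in lborel. (cmod (u x))\<^sup>2 = (cmod (kernel_op green (?T u) x))\<^sup>2"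
          using solve[OF u] by eventually_elim simp
      qed measurable
      also have "\<dots> \<le> M\<^sup>2 * green.mass * L2_norm (?T u)" by (rule green.kernel_op_norm[OF f])
      finally show "L2_norm u \<le> M\<^sup>2 * green.mass * L2_norm (?T u)" .
    qed
  qed
qed

end

lemma resolvent_no_eigenvalue:
  assumes "z \<in> resolvent_set D T"
  shows "\<not> eigenvalue D T z"
proof
  assume "eigenvalue D T z"
  then obtain u where u: "u \<in> D" "\<not> (AE x in lborel. u x = 0)" "AE x in lborel. T u x = z * u x"
    by (auto simp: eigenvalue_def)
  from u(3) have "AE x in lborel. T u x - z * u x = 0" by eventually_elim simp
  with assms u(1,2) show False by (auto simp: resolvent_set_def)
qed

section \<open>The dislocated operator\<close>

lemma continuous_AE_zero_imp_zero:
  fixes u :: "real \<Rightarrow> real"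
  assumes cont: "continuous_on UNIV u" and ae: "AE x in lborel. u x = 0"
  shows "u a = 0"
proof (rule ccontr)
  assume nz: "u a \<noteq> 0"
  have "open {x. u x \<noteq> 0}" by (intro open_Collect_neq cont continuous_on_const)
  with nz obtain e where e: "e > 0" "ball a e \<subseteq> {x. u x \<noteq> 0}" unfolding open_contains_ball by blast
  have "AE x in lborel. x \<notin> {a - e<..<a + e}"
    using ae
  proof eventually_elim
    case (elim x)
    show ?case
    proof
      assume "x \<in> {a - e<..<a + e}"
      then have "x \<in> ball a e" by (auto simp: dist_real_def)
      with e(2) elim show False by blast
    qed
  qed
  then have "emeasure lborel {a - e<..<a + e} = 0" by (subst (asm) AE_iff_null_sets[symmetric]) auto
  then show False using e(1) by simp
qed

lemma L2_norm_mono_AE: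
  assumes u: "u \<in> L2" and v: "v \<in> L2" and a: "a \<ge> 0" and le: "AE x in lborel. cmod (v x) \<le> a * cmod (u x)"
  shows "L2_norm v \<le> a * L2_norm u"
proof -
  have "(LINT x|lborel. (cmod (v x))\<^sup>2) \<le> (LINT x|lborel. a\<^sup>2 * (cmod (u x))\<^sup>2)"
  proof (rule integral_mono_AE)
    show "AE x in lborel. (cmod (v x))\<^sup>2 \<le> a\<^sup>2 * (cmod (u x))\<^sup>2"
      using le by eventually_elim (metis norm_ge_zero power_mono power_mult_distrib)
  qed (use L2D(2)[OF u] L2D(2)[OF v] in auto)
  then have "L2_norm v \<le> sqrt (a\<^sup>2 * (LINT x|lborel. (cmod (u x))\<^sup>2))"
    unfolding L2_norm_def by (intro real_sqrt_le_mono) simp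
  then show ?thesis using a by (simp add: L2_norm_def real_sqrt_mult)
qed

lemma L2_norm_pos:
  assumes u: "u \<in> L2" and nz: "\<not> (AE x in lborel. u x = 0)"
  shows "L2_norm u > 0"
proof -
  have "(LINT x|lborel. (cmod (u x))\<^sup>2) \<noteq> 0"
    using integral_nonneg_eq_0_iff_AE[OF L2D(2)[OF u]] nz by simp
  moreover have "(LINT x|lborel. (cmod (u x))\<^sup>2) \<ge> 0" by (rule Bochner_Integration.integral_nonneg) simp
  ultimately have "(LINT x|lborel. (cmod (u x))\<^sup>2) > 0" by linarith
  then show ?thesis unfolding L2_norm_def by (rule real_sqrt_gt_zero)
qed

text \<open>The a priori bound in the resolvent set gives \<open>\<parallel>u\<parallel> \<le> \<bar>C\<bar> a \<parallel>u\<parallel>\<close> for such \<open>u\<close>, and \<open>a\<close> is chosen with \<open>\<bar>C\<bar> a < 1\<close>. Since the residual is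
  compared with \<open>u\<close> pointwise, no norm of an approximate eigenfunction has to be computed.\<close>

lemma approximate_eigenfunction_bound:
  assumes res: "complex_of_real E \<in> resolvent_set (sobolev_H 2) (schroedinger V)"
  shows "\<exists>a>0. \<forall>u u1 u2. (\<forall>x. (u has_real_derivative u1 x) (at x)) \<longrightarrow> (\<forall>x. (u1 has_real_derivative u2 x) (at x)) \<longrightarrow>
    continuous_on UNIV u2 \<longrightarrow> (\<lambda>x. complex_of_real (u x)) \<in> L2 \<longrightarrow> (\<lambda>x. complex_of_real (u1 x)) \<in> L2 \<longrightarrow>
    (\<lambda>x. complex_of_real (u2 x)) \<in> L2 \<longrightarrow> (\<lambda>x. complex_of_real ((V x - E) * u x)) \<in> L2 \<longrightarrow>
    (\<forall>x. \<bar>(V x - E) * u x - u2 x\<bar> \<le> a * \<bar>u x\<bar>) \<longrightarrow> (\<forall>x. u x = 0)"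
proof -
  obtain C where C: "\<And>u. u \<in> sobolev_H 2 \<Longrightarrow> L2_norm u \<le> C * L2_norm (\<lambda>x. schroedinger V u x - complex_of_real E * u x)"
    using res by (auto simp: resolvent_set_def)
  define a where "a = 1 / (2 * (\<bar>C\<bar> + 1))"
  have a: "a > 0" "\<bar>C\<bar> * a < 1" by (auto simp: a_def field_simps)
  have "u y = 0"
    if D: "\<And>x. (u has_real_derivative u1 x) (at x)" "\<And>x. (u1 has_real_derivative u2 x) (at x)"
      and cont: "continuous_on UNIV u2" and L: "(\<lambda>x. complex_of_real (u x)) \<in> L2" "(\<lambda>x. complex_of_real (u1 x)) \<in> L2"
      "(\<lambda>x. complex_of_real (u2 x)) \<in> L2" "(\<lambda>x. complex_of_real ((V x - E) * u x)) \<in> L2"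
      and le: "\<And>x. \<bar>(V x - E) * u x - u2 x\<bar> \<le> a * \<bar>u x\<bar>" for u u1 u2 y
  proof (rule ccontr)
    assume nz: "u y \<noteq> 0"
    let ?u = "\<lambda>x. complex_of_real (u x)"
    let ?r = "\<lambda>x. schroedinger V ?u x - complex_of_real E * ?u x"
    note s = classical_sobolev[OF D cont L(1-3)]
    have "weak_deriv 2 ?u \<in> L2"
      using s(1) weak_deriv(1) by (auto simp: sobolev_H_def)
    from L2_diff[OF L(4) this] have r: "?r \<in> L2"
      by (simp add: schroedinger_def algebra_simps)
    have "AE x in lborel. cmod (?r x) \<le> a * cmod (?u x)"
      using s(2)
    proof eventually_elim
      case (elim x)
      have "?r x = complex_of_real ((V x - E) * u x - u2 x)"
        by (simp add: schroedinger_def elim algebra_simps)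
      then have "cmod (?r x) = \<bar>(V x - E) * u x - u2 x\<bar>" by (simp only: norm_of_real)
      with le[of x] show ?case by simp
    qed
    from L2_norm_mono_AE[OF L(1) r _ this] a have "L2_norm ?r \<le> a * L2_norm ?u" by simp
    then have "\<bar>C\<bar> * L2_norm ?r \<le> \<bar>C\<bar> * (a * L2_norm ?u)" by (intro mult_left_mono) auto
    moreover have "L2_norm ?u \<le> \<bar>C\<bar> * L2_norm ?r"
    proof -
      have "L2_norm ?r \<ge> 0" unfolding L2_norm_def by (intro real_sqrt_ge_zero Bochner_Integration.integral_nonneg) simp
      then have "C * L2_norm ?r \<le> \<bar>C\<bar> * L2_norm ?r" by (intro mult_right_mono) auto
      with C[OF s(1)] show ?thesis by linarith
    qed
    ultimately have "L2_norm ?u \<le> \<bar>C\<bar> * a * L2_norm ?u" by simp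
    moreover have "L2_norm ?u > 0"
    proof (rule L2_norm_pos[OF L(1)])
      show "\<not> (AE x in lborel. ?u x = 0)"
        using continuous_AE_zero_imp_zero[OF DERIV_imp_continuous_on[OF D(1)], of y] nz by auto
    qed
    ultimately show False using a(2) mult_strict_right_mono[OF a(2), of "L2_norm ?u"] by simp
  qed
  with a(1) show ?thesis by blast
qed

context ground_state
begin

lemma dislocated_eq: "dislocated V t x = V (\<bar>x\<bar> + t)"
  using even_V[of "x - t"] by (auto simp: dislocated_def add.commute)

lemma psi_reflect_sol: "ode_solution (\<lambda>x. V x - E) (\<lambda>x. \<psi> E (- x)) (\<lambda>x. - \<psi>' E (- x))"
  by (rule solution_neg[OF psi_sol])

lemma cont_dislocated: "continuous_on UNIV (dislocated V t)"
  unfolding dislocated_eq[abs_def]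
  by (intro continuous_on_compose2[OF cont_V] continuous_intros) auto

lemma dislocated_even: "dislocated V t (- x) = dislocated V t x"
  by (simp add: dislocated_eq)

lemma dislocated_bounded: "\<exists>B>0. \<forall>x. \<bar>dislocated V t x\<bar> \<le> B"
  using bounded_V by (auto simp: dislocated_eq)

text \<open>To the right of the origin the solution is \<open>\<psi> (x + t)\<close>. To the left it is a combination of the two Floquet solutions evaluated at
  \<open>\<bar>x\<bar> + t\<close>; generically the growing one is present, but it grows at the rate \<open>k\<close> at which \<open>\<psi>\<close> decays.\<close>

lemma jost_solution:
  assumes E: "E < E0"
  shows "\<exists>Y Y' k N. k > 0 \<and> ode_solution (\<lambda>x. dislocated V t x - E) Y Y' \<and> Y 0 = \<psi> E t \<and> Y' 0 = \<psi>' E t \<and>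
    (\<forall>x. \<bar>Y x\<bar> \<le> N * exp (- k * x) \<and> \<bar>Y' x\<bar> \<le> N * exp (- k * x))"
proof -
  let ?W = "dislocated V t"
  obtain B where B: "\<And>x. \<bar>?W x\<bar> \<le> B" using dislocated_bounded by blast
  have Q: "\<bar>?W x - E\<bar> \<le> B + \<bar>E\<bar>" for x using B[of x] by linarith
  have "continuous_on UNIV (\<lambda>x. ?W x - E)" by (intro continuous_intros cont_dislocated)
  from ode_solution_exists[OF this Q]
  obtain Y Y' where Y: "ode_solution (\<lambda>x. ?W x - E) Y Y'" "Y 0 = \<psi> E t" "Y' 0 = \<psi>' E t" by blast
  obtain k M where kM: "k > 0" "M > 0" "\<And>x. \<bar>\<psi> E x\<bar> \<le> M * exp (- k * x)" "\<And>x. \<bar>\<psi>' E x\<bar> \<le> M * exp (- k * x)"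
    using psi_decay[OF E] by blast
  have Wpos: "?W x - E = V (x + t) - E" if "x \<ge> 0" for x using that by (simp add: dislocated_eq)
  have right: "Y x = \<psi> E (x + t)" "Y' x = \<psi>' E (x + t)" if "x \<ge> 0" for x
    using ode_solution_unique_half_line[OF Y(1) ode_solution_shift[OF psi_sol, of t E] Wpos Q _ _ that] Y by simp_all
  define \<theta> where "\<theta> x = \<psi> E (- x)" for x
  define \<theta>' where "\<theta>' x = - \<psi>' E (- x)" for x
  have \<theta>: "ode_solution (\<lambda>x. V x - E) \<theta> \<theta>'" using psi_reflect_sol by (simp add: \<theta>_def[abs_def] \<theta>'_def[abs_def])
  define \<Delta> where "\<Delta> = \<psi> E t * \<theta>' t - \<psi>' E t * \<theta> t"
  have "\<Delta> = \<psi> E 0 * \<theta>' 0 - \<psi>' E 0 * \<theta> 0"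
    unfolding \<Delta>_def by (rule wronskian_constant[OF psi_sol \<theta>])
  also have "\<dots> = 2 * \<kappa> E" by (simp add: \<theta>_def \<theta>'_def \<psi>'_def)
  finally have \<Delta>: "\<Delta> \<noteq> 0" using kappa(1)[OF E] by simp
  \<comment> \<open>Cramer's rule for the coefficients that match the value and the reflected slope at the origin.\<close>
  define \<alpha> where "\<alpha> = (\<psi> E t * \<theta>' t + \<psi>' E t * \<theta> t) / \<Delta>"
  define \<beta> where "\<beta> = - (2 * \<psi> E t * \<psi>' E t) / \<Delta>"
  have "\<alpha> * \<psi> E t + \<beta> * \<theta> t = \<psi> E t * \<Delta> / \<Delta>"
    unfolding \<alpha>_def \<beta>_def times_divide_eq_left add_divide_distrib[symmetric]
    by (rule arg_cong2[where f = "(/)"]) (simp_all add: \<Delta>_def algebra_simps)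
  then have ab1: "\<alpha> * \<psi> E t + \<beta> * \<theta> t = \<psi> E t" using \<Delta> by simp
  have "\<alpha> * \<psi>' E t + \<beta> * \<theta>' t = - \<psi>' E t * \<Delta> / \<Delta>"
    unfolding \<alpha>_def \<beta>_def times_divide_eq_left add_divide_distrib[symmetric]
    by (rule arg_cong2[where f = "(/)"]) (simp_all add: \<Delta>_def algebra_simps)
  then have ab2: "\<alpha> * \<psi>' E t + \<beta> * \<theta>' t = - \<psi>' E t" using \<Delta> by simp
  have Z: "ode_solution (\<lambda>x. ?W x - E) (\<lambda>x. Y (- x)) (\<lambda>x. - Y' (- x))"
    using ode_solution_reflect[OF Y(1), of 0] by (simp add: dislocated_even)
  note comb = ode_solution_shift[OF ode_solution_linear[OF psi_sol \<theta>, of \<alpha> \<beta>], of t]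
  have left: "Y (- x) = \<alpha> * \<psi> E (x + t) + \<beta> * \<theta> (x + t)" "- Y' (- x) = \<alpha> * \<psi>' E (x + t) + \<beta> * \<theta>' (x + t)" if "x \<ge> 0" for x
    using ode_solution_unique_half_line[OF Z comb Wpos Q _ _ that] Y(2,3) ab1 ab2 by simp_all
  define N where "N = (1 + \<bar>\<alpha>\<bar> + \<bar>\<beta>\<bar>) * (M * exp (k * \<bar>t\<bar>))"
  have N: "M * exp (k * \<bar>t\<bar>) \<le> N" "(\<bar>\<alpha>\<bar> + \<bar>\<beta>\<bar>) * (M * exp (k * \<bar>t\<bar>)) \<le> N"
    unfolding N_def using kM(2) by (auto intro!: mult_right_mono simp: algebra_simps)
  have shift: "M * exp (- k * (x + t)) \<le> M * exp (k * \<bar>t\<bar>) * exp (- k * x)" for x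
  proof -
    have "- k * (x + t) \<le> k * \<bar>t\<bar> + - k * x" using kM(1) mult_left_mono[of "- t" "\<bar>t\<bar>" k] by (simp add: algebra_simps)
    then have "exp (- k * (x + t)) \<le> exp (k * \<bar>t\<bar>) * exp (- k * x)" by (simp only: exp_add[symmetric] exp_le_cancel_iff)
    from mult_left_mono[OF this less_imp_le[OF kM(2)]] show ?thesis by (simp only: mult.assoc)
  qed
  have shift': "M * exp (k * (x + t)) \<le> M * exp (k * \<bar>t\<bar>) * exp (k * x)" for x
  proof -
    have "k * (x + t) \<le> k * \<bar>t\<bar> + k * x" using kM(1) mult_left_mono[of t "\<bar>t\<bar>" k] by (simp add: algebra_simps)
    then have "exp (k * (x + t)) \<le> exp (k * \<bar>t\<bar>) * exp (k * x)" by (simp only: exp_add[symmetric] exp_le_cancel_iff)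
    from mult_left_mono[OF this less_imp_le[OF kM(2)]] show ?thesis by (simp only: mult.assoc)
  qed
  have bound_right: "\<bar>f (x + t)\<bar> \<le> N * exp (- k * x)" if "\<And>x. \<bar>f x\<bar> \<le> M * exp (- k * x)" for f x
    using that[of "x + t"] shift[of x] mult_right_mono[OF N(1) exp_ge_zero, of "- k * x"] by linarith
  have bound_left: "\<bar>\<alpha> * f (x + t) + \<beta> * h (x + t)\<bar> \<le> N * exp (k * x)"
    if f: "\<And>x. \<bar>f x\<bar> \<le> M * exp (- k * x)" and h: "\<And>x. \<bar>h x\<bar> \<le> M * exp (k * x)" and x: "x \<ge> 0" for f h x
  proof -
    have kx: "exp (- k * x) \<le> exp (k * x)" using kM(1) x by simp
    have "\<bar>f (x + t)\<bar> \<le> M * exp (k * \<bar>t\<bar>) * exp (- k * x)" using f[of "x + t"] shift[of x] by linarith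
    also have "\<dots> \<le> M * exp (k * \<bar>t\<bar>) * exp (k * x)" using kx kM(2) by (intro mult_left_mono) auto
    finally have 1: "\<bar>\<alpha>\<bar> * \<bar>f (x + t)\<bar> \<le> \<bar>\<alpha>\<bar> * (M * exp (k * \<bar>t\<bar>) * exp (k * x))" by (rule mult_left_mono) simp
    have "\<bar>h (x + t)\<bar> \<le> M * exp (k * \<bar>t\<bar>) * exp (k * x)" using h[of "x + t"] shift'[of x] by linarith
    then have 2: "\<bar>\<beta>\<bar> * \<bar>h (x + t)\<bar> \<le> \<bar>\<beta>\<bar> * (M * exp (k * \<bar>t\<bar>) * exp (k * x))" by (rule mult_left_mono) simp
    have "\<bar>\<alpha> * f (x + t) + \<beta> * h (x + t)\<bar> \<le> \<bar>\<alpha>\<bar> * \<bar>f (x + t)\<bar> + \<bar>\<beta>\<bar> * \<bar>h (x + t)\<bar>"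
      by (metis abs_mult abs_triangle_ineq)
    also have "\<dots> \<le> (\<bar>\<alpha>\<bar> + \<bar>\<beta>\<bar>) * (M * exp (k * \<bar>t\<bar>)) * exp (k * x)"
      using add_mono[OF 1 2] by (simp add: algebra_simps)
    also have "\<dots> \<le> N * exp (k * x)" by (intro mult_right_mono N(2)) simp
    finally show ?thesis .
  qed
  have \<theta>_bound: "\<bar>\<theta> x\<bar> \<le> M * exp (k * x)" "\<bar>\<theta>' x\<bar> \<le> M * exp (k * x)" for x
    using kM(3)[of "- x"] kM(4)[of "- x"] by (simp_all add: \<theta>_def \<theta>'_def)
  have "\<bar>Y x\<bar> \<le> N * exp (- k * x) \<and> \<bar>Y' x\<bar> \<le> N * exp (- k * x)" for x
  proof (cases "x \<ge> 0")
    case True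
    show ?thesis unfolding right[OF True]
      using bound_right[OF kM(3), of x] bound_right[OF kM(4), of x] by blast
  next
    case False
    then have x: "- x \<ge> 0" by simp
    from bound_left[OF kM(3) \<theta>_bound(1) x] bound_left[OF kM(4) \<theta>_bound(2) x]
    show ?thesis unfolding left[OF x, symmetric] by simp
  qed
  with kM(1) Y show ?thesis by blast
qed

text \<open>The solution that decays on the left is the reflection of the one that decays on the right, so their Wronskian at the
  origin is \<open>-2 \<psi> \<psi>'\<close>, taken at \<open>t\<close>, and does not vanish.\<close>

lemma dislocated_resolvent:
  assumes E: "E < E0" and nz: "\<psi>' E t \<noteq> 0"
  shows "complex_of_real E \<in> resolvent_set (sobolev_H 2) (schroedinger (dislocated V t))"
proof -
  let ?W = "dislocated V t"
  obtain B where B: "\<And>x. \<bar>?W x\<bar> \<le> B" using dislocated_bounded by blast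
  obtain Y Y' k N where Y: "k > 0" "ode_solution (\<lambda>x. ?W x - E) Y Y'" "Y 0 = \<psi> E t" "Y' 0 = \<psi>' E t"
    and bd: "\<And>x. \<bar>Y x\<bar> \<le> N * exp (- k * x)" "\<And>x. \<bar>Y' x\<bar> \<le> N * exp (- k * x)"
    using jost_solution[OF E, of t] by blast
  define c where "c = - 1 / (2 * Y 0 * Y' 0)"
  have YY: "Y 0 * Y' 0 \<noteq> 0" using Y(3,4) nz psi_nonzero[OF E] by simp
  have N0: "N \<ge> 0" using bd(1)[of 0] by simp
  have "ode_solution (\<lambda>x. ?W x - E) (\<lambda>x. Y (- x)) (\<lambda>x. - Y' (- x))"
    using ode_solution_reflect[OF Y(2), of 0] by (simp add: dislocated_even)
  from ode_solution_linear[OF this this, of c 0]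
  have Z: "ode_solution (\<lambda>x. ?W x - E) (\<lambda>x. c * Y (- x)) (\<lambda>x. c * - Y' (- x))" by simp
  have mono: "N * exp y \<le> N * (1 + \<bar>c\<bar>) * exp y" for y
    using N0 by (intro mult_right_mono) (auto simp: algebra_simps)
  have scale: "\<bar>c * a\<bar> \<le> N * (1 + \<bar>c\<bar>) * exp y" if "\<bar>a\<bar> \<le> N * exp y" for a y
  proof -
    have "\<bar>c\<bar> * \<bar>a\<bar> \<le> (1 + \<bar>c\<bar>) * (N * exp y)" using that by (intro mult_mono) auto
    then show ?thesis by (simp add: abs_mult mult_ac)
  qed
  interpret dichotomy ?W Y Y' "\<lambda>x. c * Y (- x)" "\<lambda>x. c * - Y' (- x)" E k "N * (1 + \<bar>c\<bar>)" B
  proof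
    show "\<bar>Y x\<bar> \<le> N * (1 + \<bar>c\<bar>) * exp (- k * x)" "\<bar>Y' x\<bar> \<le> N * (1 + \<bar>c\<bar>) * exp (- k * x)" for x
      using bd[of x] mono[of "- k * x"] by linarith+
    show "\<bar>c * Y (- x)\<bar> \<le> N * (1 + \<bar>c\<bar>) * exp (k * x)" "\<bar>c * - Y' (- x)\<bar> \<le> N * (1 + \<bar>c\<bar>) * exp (k * x)" for x
      by (rule scale; use bd[of "- x"] in simp)+
    show "Y x * (c * - Y' (- x)) - Y' x * (c * Y (- x)) = 1" for x
    proof -
      have "Y x * (c * - Y' (- x)) - Y' x * (c * Y (- x)) = Y 0 * (c * - Y' (- 0)) - Y' 0 * (c * Y (- 0))"
        by (rule wronskian_constant[OF Y(2) Z])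
      also have "\<dots> = 1" using YY by (simp add: c_def field_simps)
      finally show ?thesis .
    qed
  qed (use Y Z B cont_dislocated in auto)
  show ?thesis by (rule in_resolvent_set)
qed

text \<open>With vanishing slope at the origin the decaying solution is even, and so it decays on both sides.\<close>

lemma dislocated_eigenvalue:
  assumes E: "E < E0" and z: "\<psi>' E t = 0"
  shows "dislocation_eigenvalue V t E"
proof -
  let ?W = "dislocated V t"
  obtain B where B: "\<And>x. \<bar>?W x\<bar> \<le> B" using dislocated_bounded by blast
  have Q: "\<bar>?W x - E\<bar> \<le> B + \<bar>E\<bar>" for x using B[of x] by linarith
  obtain Y Y' k N where Y: "k > 0" "ode_solution (\<lambda>x. ?W x - E) Y Y'" "Y 0 = \<psi> E t" "Y' 0 = \<psi>' E t"
    and bd: "\<And>x. \<bar>Y x\<bar> \<le> N * exp (- k * x)" "\<And>x. \<bar>Y' x\<bar> \<le> N * exp (- k * x)"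
    using jost_solution[OF E, of t] by blast
  have refl: "ode_solution (\<lambda>x. ?W x - E) (\<lambda>x. Y (- x)) (\<lambda>x. - Y' (- x))"
    using ode_solution_reflect[OF Y(2), of 0] by (simp add: dislocated_even)
  have even: "(\<lambda>x. Y (- x)) = Y \<and> (\<lambda>x. - Y' (- x)) = Y'"
    by (rule ode_solution_unique[OF refl Y(2) Q, where a = 0]) (use Y(4) z in auto)
  then have even': "Y (- x) = Y x" "Y' (- x) = - Y' x" for x
    by (metis, metis minus_equation_iff)
  have abs_bd: "\<bar>Y x\<bar> \<le> N * exp (- k * \<bar>x\<bar>)" "\<bar>Y' x\<bar> \<le> N * exp (- k * \<bar>x\<bar>)" for x
    using bd[of "\<bar>x\<bar>"] even'[of x] by (auto simp: abs_if split: if_splits)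
  have D: "(Y has_real_derivative Y' x) (at x)" "(Y' has_real_derivative (?W x - E) * Y x) (at x)" for x
    using Y(2) by (auto simp: ode_solution_def)
  have cY: "continuous_on UNIV Y" "continuous_on UNIV Y'" by (rule ode_solution_continuous[OF Y(2)])+
  have c2: "continuous_on UNIV (\<lambda>x. (?W x - E) * Y x)" by (intro continuous_intros cont_dislocated cY)
  note [measurable] = borel_measurable_continuous[OF cY(1)] borel_measurable_continuous[OF cY(2)]
    borel_measurable_continuous[OF c2]
  have L1: "(\<lambda>x. complex_of_real (Y x)) \<in> L2" "(\<lambda>x. complex_of_real (Y' x)) \<in> L2"
    using abs_bd by (auto intro!: L2_exp_bound[OF _ Y(1), of _ N])
  have "\<bar>(?W x - E) * Y x\<bar> \<le> (B + \<bar>E\<bar>) * \<bar>Y x\<bar>" for x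
    unfolding abs_mult by (intro mult_right_mono Q) simp
  then have L2: "(\<lambda>x. complex_of_real ((?W x - E) * Y x)) \<in> L2"
    by (intro L2_dominated[OF L1(1), of _ "B + \<bar>E\<bar>"]) (measurable, simp only: norm_of_real)
  note s = classical_sobolev[OF D c2 L1 L2]
  have "AE x in lborel. schroedinger ?W (\<lambda>x. complex_of_real (Y x)) x = complex_of_real E * complex_of_real (Y x)"
    using s(2) by eventually_elim (simp add: schroedinger_def algebra_simps)
  moreover have "\<not> (AE x in lborel. complex_of_real (Y x) = 0)"
    using continuous_AE_zero_imp_zero[OF cY(1), of 0] Y(3) psi_nonzero[OF E] by auto
  ultimately show ?thesis unfolding dislocation_eigenvalue_def eigenvalue_def
    by (intro bexI[OF _ s(1)] conjI)
qed

lemma dislocation_eigenvalue_iff: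
  assumes "E < E0"
  shows "dislocation_eigenvalue V t E \<longleftrightarrow> \<psi>' E t = 0"
  using dislocated_eigenvalue[OF assms] resolvent_no_eigenvalue[OF dislocated_resolvent[OF assms]]
  by (auto simp: dislocation_eigenvalue_def)

section \<open>The bottom of the spectrum and the number of eigenvalues below it\<close>

text \<open>For \<open>h = 1 / cosh (e x)\<close> both \<open>h'\<close> and \<open>h''\<close> are bounded by a multiple of \<open>e h\<close>. Hence the residual \<open>2 p' h' + p h''\<close> of \<open>p h\<close> is at most a
  multiple of \<open>e p h\<close>, pointwise.\<close>

lemma E0_in_spectrum: "complex_of_real E0 \<in> spectrum (sobolev_H 2) (schroedinger V)"
proof (rule ccontr)
  assume "complex_of_real E0 \<notin> spectrum (sobolev_H 2) (schroedinger V)"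
  then have "complex_of_real E0 \<in> resolvent_set (sobolev_H 2) (schroedinger V)" by (simp add: spectrum_def)
  from approximate_eigenfunction_bound[OF this] obtain a where a: "a > 0"
    and triv: "\<And>u u1 u2 x. (\<And>x. (u has_real_derivative u1 x) (at x)) \<Longrightarrow> (\<And>x. (u1 has_real_derivative u2 x) (at x)) \<Longrightarrow>
    continuous_on UNIV u2 \<Longrightarrow> (\<lambda>x. complex_of_real (u x)) \<in> L2 \<Longrightarrow> (\<lambda>x. complex_of_real (u1 x)) \<in> L2 \<Longrightarrow>
    (\<lambda>x. complex_of_real (u2 x)) \<in> L2 \<Longrightarrow> (\<lambda>x. complex_of_real ((V x - E0) * u x)) \<in> L2 \<Longrightarrow>
    (\<And>x. \<bar>(V x - E0) * u x - u2 x\<bar> \<le> a * \<bar>u x\<bar>) \<Longrightarrow> u x = 0" by blast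
  have cp: "continuous_on A p" "continuous_on A p'" for A by (rule ode_solution_continuous[OF C_sol])+
  have dp: "(p has_real_derivative p' x) (at x)" "(p' has_real_derivative (V x - E0) * p x) (at x)" for x
    using C_sol by (auto simp: ode_solution_def)
  obtain P where P: "P > 0" "\<And>x. \<bar>p x\<bar> \<le> P" using periodic_bounded[OF d_pos p_periodic(1) cp(1)] by blast
  obtain P' where P': "P' > 0" "\<And>x. \<bar>p' x\<bar> \<le> P'" using periodic_bounded[OF d_pos p_periodic(2) cp(2)] by blast
  have "continuous_on UNIV (\<lambda>x. 1 / p x)" by (intro continuous_intros cp) (metis less_irrefl p_pos)
  then obtain m where m: "m > 0" "\<And>x. \<bar>1 / p x\<bar> \<le> m"
    using periodic_bounded[OF d_pos, of "\<lambda>x. 1 / p x"] p_periodic(1) by auto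
  have p_ge: "1 \<le> m * p x" for x using m(2)[of x] p_pos[of x] by (simp add: field_simps)
  obtain B where B: "B > 0" "\<And>x. \<bar>V x\<bar> \<le> B" using bounded_V by blast
  define K where "K = 2 * P' + 3 * P"
  \<comment> \<open>The residual of \<open>u = p h\<close> will be at most \<open>e K m u\<close>, where \<open>m\<close> bounds \<open>1 / p\<close>.\<close>
  define e where "e = min 1 (a / (K * m))"
  have K: "K > 0" using P(1) P'(1) by (simp add: K_def)
  have e: "e > 0" "e \<le> 1" "e * (K * m) \<le> a" using a K m(1) by (auto simp: e_def min_def field_simps)
  define h where "h x = 1 / cosh (e * x)" for x
  define h1 where "h1 x = - e * sinh (e * x) / (cosh (e * x))\<^sup>2" for x
  define h2 where "h2 x = - e\<^sup>2 * ((cosh (e * x))\<^sup>2 - 2 * (sinh (e * x))\<^sup>2) / (cosh (e * x)) ^ 3" for x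
  have ch: "cosh y > (0::real)" for y by (rule cosh_real_pos)
  have chnz: "cosh y \<noteq> (0::real)" for y using ch[of y] by simp
  have sh: "\<bar>sinh y\<bar> \<le> cosh (y::real)" for y
    using cosh_square_eq[of y] ch[of y] by (intro abs_le_square_iff[THEN iffD2, THEN order_trans[OF _ eq_refl[OF abs_of_pos]]]) auto
  have dh: "(h has_real_derivative h1 x) (at x)" for x
    unfolding h_def[abs_def] h1_def
    by (rule derivative_eq_intros refl chnz)+ (simp add: power2_eq_square chnz)
  have dh1: "(h1 has_real_derivative h2 x) (at x)" for x
  proof -
    let ?c = "cosh (e * x)" and ?s = "sinh (e * x)"
    have s: "((\<lambda>x. - e * sinh (e * x)) has_real_derivative - e * (?c * e)) (at x)"
      by (rule derivative_eq_intros refl)+ simp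
    have c: "((\<lambda>x. (cosh (e * x))\<^sup>2) has_real_derivative 2 * ?c * (?s * e)) (at x)"
      by (rule derivative_eq_intros refl)+ simp
    have "(- e * (?c * e) * ?c\<^sup>2 - (- e * ?s) * (2 * ?c * (?s * e))) / (?c\<^sup>2 * ?c\<^sup>2) = h2 x"
      unfolding h2_def using chnz[of "e * x"]
      by (simp add: divide_simps) (simp add: algebra_simps power2_eq_square power3_eq_cube power4_eq_xxxx)
    moreover have "?c\<^sup>2 \<noteq> 0" using chnz[of "e * x"] by simp
    ultimately show ?thesis unfolding h1_def[abs_def] using DERIV_divide[OF s c] by simp
  qed
  have hpos: "h x > 0" for x by (simp add: h_def ch)
  have h1_le: "\<bar>h1 x\<bar> \<le> e * h x" for x
  proof -
    have "\<bar>h1 x\<bar> = e * (\<bar>sinh (e * x)\<bar> / cosh (e * x)) / cosh (e * x)"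
      using e(1) ch[of "e * x"] by (simp add: h1_def abs_mult power2_eq_square)
    also have "\<dots> \<le> e * 1 / cosh (e * x)"
      using e(1) ch[of "e * x"] sh[of "e * x"] by (intro divide_right_mono mult_left_mono) (auto simp: divide_le_eq_1)
    finally show ?thesis by (simp add: h_def)
  qed
  have h2_le: "\<bar>h2 x\<bar> \<le> 3 * e\<^sup>2 * h x" for x
  proof -
    let ?c = "cosh (e * x)" and ?s = "sinh (e * x)"
    have "?s\<^sup>2 \<le> ?c\<^sup>2" using sh[of "e * x"] abs_le_square_iff[of ?s ?c] ch[of "e * x"] by simp
    then have "\<bar>?c\<^sup>2 - 2 * ?s\<^sup>2\<bar> \<le> 3 * ?c\<^sup>2" using zero_le_power2[of ?s] by (simp only: abs_le_iff) linarith
    then have "e\<^sup>2 * \<bar>?c\<^sup>2 - 2 * ?s\<^sup>2\<bar> / ?c ^ 3 \<le> e\<^sup>2 * (3 * ?c\<^sup>2) / ?c ^ 3"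
      using ch[of "e * x"] by (intro divide_right_mono mult_left_mono) auto
    moreover have "\<bar>h2 x\<bar> = e\<^sup>2 * \<bar>?c\<^sup>2 - 2 * ?s\<^sup>2\<bar> / ?c ^ 3"
      using ch[of "e * x"] by (simp add: h2_def abs_mult)
    moreover have "e\<^sup>2 * (3 * ?c\<^sup>2) / ?c ^ 3 = 3 * e\<^sup>2 * h x"
      using chnz[of "e * x"] by (simp add: h_def power2_eq_square power3_eq_cube)
    ultimately show ?thesis by simp
  qed
  have h_exp: "h x \<le> 2 * exp (- e * \<bar>x\<bar>)" for x
  proof -
    have "exp (e * \<bar>x\<bar>) \<le> 2 * cosh (e * x)"
      unfolding cosh_def by (cases "x \<ge> 0") auto
    then show ?thesis using ch[of "e * x"] by (simp add: h_def exp_minus field_simps)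
  qed
  define u where "u x = p x * h x" for x
  define u1 where "u1 x = p' x * h x + p x * h1 x" for x
  define u2 where "u2 x = (V x - E0) * p x * h x + (2 * (p' x * h1 x) + p x * h2 x)" for x
  have du: "(u has_real_derivative u1 x) (at x)" for x
    unfolding u_def[abs_def] u1_def by (rule derivative_eq_intros dp dh refl)+ (simp add: algebra_simps)
  have du1: "(u1 has_real_derivative u2 x) (at x)" for x
    unfolding u1_def[abs_def] u2_def by (rule derivative_eq_intros dp dh dh1 refl)+ (simp add: algebra_simps)
  have chs: "continuous_on A h" "continuous_on A h1" "continuous_on A h2" for A
    unfolding h_def h1_def h2_def by (intro continuous_intros; simp add: chnz)+
  have cu: "continuous_on UNIV u" "continuous_on UNIV u1" "continuous_on UNIV u2" "continuous_on UNIV (\<lambda>x. (V x - E0) * u x)"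
    unfolding u_def u1_def u2_def by (intro continuous_intros cp chs cont_V)+
  have hle: "\<bar>h x\<bar> \<le> h x" "\<bar>h1 x\<bar> \<le> h x" "\<bar>h2 x\<bar> \<le> 3 * h x" for x
  proof -
    show "\<bar>h x\<bar> \<le> h x" using hpos[of x] by simp
    have "e * h x \<le> 1 * h x" using e hpos[of x] by (intro mult_right_mono) auto
    then show "\<bar>h1 x\<bar> \<le> h x" using h1_le[of x] by simp
    have "3 * e\<^sup>2 * h x \<le> 3 * 1 * h x" using e hpos[of x] by (intro mult_right_mono) (auto simp: power_le_one)
    then show "\<bar>h2 x\<bar> \<le> 3 * h x" using h2_le[of x] by simp
  qed
  have VE: "\<bar>V x - E0\<bar> \<le> B + \<bar>E0\<bar>" for x using B(2)[of x] by linarith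
  have inL2: "(\<lambda>x. complex_of_real (f x)) \<in> L2" if "continuous_on UNIV f" "\<And>x. \<bar>f x\<bar> \<le> c * h x" for f c
  proof -
    note [measurable] = borel_measurable_continuous[OF that(1)]
    have c0: "c \<ge> 0" using that(2)[of 0] hpos[of 0] by (smt (verit) mult_neg_pos)
    have "\<bar>f x\<bar> \<le> c * 2 * exp (- e * \<bar>x\<bar>)" for x
      using that(2)[of x] mult_left_mono[OF h_exp[of x] c0] by (simp add: mult.assoc)
    then show ?thesis by (intro L2_exp_bound[OF _ e(1)]) auto
  qed
  have prod: "\<bar>a * b\<bar> \<le> a' * b'" if "\<bar>a\<bar> \<le> a'" "\<bar>b\<bar> \<le> b'" for a b a' b' :: real
    unfolding abs_mult using that by (rule mult_mono) (use that in auto)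
  have sum: "\<bar>a + b\<bar> \<le> a' + b'" if "\<bar>a\<bar> \<le> a'" "\<bar>b\<bar> \<le> b'" for a b a' b' :: real using that by linarith
  have uL: "(\<lambda>x. complex_of_real (u x)) \<in> L2"
    by (rule inL2[OF cu(1), of P]) (simp only: u_def, rule prod[OF P(2) hle(1)])
  have u1L: "(\<lambda>x. complex_of_real (u1 x)) \<in> L2"
    by (rule inL2[OF cu(2), of "P' + P"]) (simp only: u1_def distrib_right, intro sum prod P(2) P'(2) hle)
  have VuL: "(\<lambda>x. complex_of_real ((V x - E0) * u x)) \<in> L2"
    by (rule inL2[OF cu(4), of "(B + \<bar>E0\<bar>) * P"]) (simp only: u_def mult.assoc, intro prod P(2) VE hle)
  have u2L: "(\<lambda>x. complex_of_real (u2 x)) \<in> L2"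
  proof (rule inL2[OF cu(3), of "(B + \<bar>E0\<bar>) * P + (2 * P' + P * 3)"])
    fix x
    have "\<bar>u2 x\<bar> \<le> (B + \<bar>E0\<bar>) * P * h x + (2 * (P' * h x) + P * (3 * h x))"
      unfolding u2_def by (intro sum prod P(2) P'(2) VE hle) auto
    then show "\<bar>u2 x\<bar> \<le> ((B + \<bar>E0\<bar>) * P + (2 * P' + P * 3)) * h x" by (simp add: algebra_simps)
  qed
  have "\<bar>(V x - E0) * u x - u2 x\<bar> \<le> a * \<bar>u x\<bar>" for x
  proof -
    have e2: "e\<^sup>2 \<le> e" using e(1,2) by (simp add: power2_eq_square mult_left_le)
    have "\<bar>(V x - E0) * u x - u2 x\<bar> = \<bar>2 * (p' x * h1 x) + p x * h2 x\<bar>"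
      by (simp add: u_def u2_def algebra_simps abs_minus_commute)
    also have "\<dots> \<le> 2 * (P' * (e * h x)) + P * (3 * e\<^sup>2 * h x)"
      by (intro sum prod P(2) P'(2) h1_le h2_le) auto
    also have "\<dots> \<le> 2 * (P' * (e * h x)) + P * (3 * e * h x)"
      using e2 P(1) hpos[of x] by (intro add_left_mono mult_left_mono mult_right_mono) auto
    also have "\<dots> = e * K * h x * 1" by (simp add: K_def algebra_simps)
    also have "\<dots> \<le> e * K * h x * (m * p x)" using e(1) K hpos[of x] p_ge[of x] by (intro mult_left_mono) auto
    also have "\<dots> = e * (K * m) * u x" by (simp add: u_def mult_ac)
    also have "\<dots> \<le> a * u x" using e(3) hpos[of x] p_pos[of x] by (intro mult_right_mono) (auto simp: u_def)
    finally show ?thesis using hpos[of x] p_pos[of x] by (simp add: u_def)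
  qed
  then have "u 0 = 0" by (intro triv[OF du du1 cu(3) uL u1L u2L VuL])
  then show False using hpos[of 0] p_pos[of 0] by (simp add: u_def)
qed

text \<open>Without a dislocation, \<open>\<psi>' E 0 = - \<kappa> E\<close> is not \<open>0\<close>, so every \<open>E < E0\<close> is in the resolvent set.\<close>

lemma min_spectrum_eq: "min_spectrum V = E0"
  unfolding min_spectrum_def
proof (rule Least_equality)
  show "complex_of_real E0 \<in> spectrum (sobolev_H 2) (schroedinger V)" by (rule E0_in_spectrum)
next
  fix E assume "complex_of_real E \<in> spectrum (sobolev_H 2) (schroedinger V)"
  moreover have "dislocated V 0 = V" by (simp add: dislocated_def fun_eq_iff)
  moreover have "\<psi>' E 0 \<noteq> 0" if "E < E0" using kappa(1)[OF that] by (simp add: \<psi>'_def)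
  ultimately show "E0 \<le> E" using dislocated_resolvent[of E 0] by (auto simp: spectrum_def not_less[symmetric])
qed

lemma no_eigenvalue_below:
  assumes "p' t \<le> 0"
  shows "\<not> (\<exists>E\<in>{..<min_spectrum V}. dislocation_eigenvalue V t E)"
  using no_neumann[OF _ assms] by (auto simp: min_spectrum_eq dislocation_eigenvalue_iff)

lemma unique_eigenvalue_below:
  assumes "p' t > 0"
  shows "\<exists>!E. E \<in> {..<min_spectrum V} \<and> dislocation_eigenvalue V t E"
proof -
  obtain E where E: "E < E0" "\<psi>' E t = 0" using neumann_exists[OF assms] by blast
  show ?thesis
  proof (rule ex1I[of _ E])
    show "E \<in> {..<min_spectrum V} \<and> dislocation_eigenvalue V t E"
      using E by (simp add: min_spectrum_eq dislocation_eigenvalue_iff)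
    fix E' assume "E' \<in> {..<min_spectrum V} \<and> dislocation_eigenvalue V t E'"
    then have E': "E' < E0" "\<psi>' E' t = 0" by (auto simp: min_spectrum_eq dislocation_eigenvalue_iff)
    show "E' = E"
      using neumann_unique[OF _ E(1) E'(2) E(2)] neumann_unique[OF _ E'(1) E(2) E'(2)] by (meson linorder_neqE)
  qed
qed

lemma p'_at_symmetry_points: "p' 0 = 0" "p' (d/2) = 0" "p' d = 0"
  using C'0_half C'_0_d by auto

end

theorem theorem3p11:
  fixes V0 :: "real \<Rightarrow> real" and d :: real
  assumes "d > 0"
    and "continuous_on UNIV V0"
    and "\<forall>x. V0 (- x) = V0 x"
    and "\<forall>x. V0 (x + d) = V0 x"
  shows
    "(strict_mono_on {0..d/2} V0 \<longrightarrow>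
        (\<forall>t\<in>{0..d/2}. \<not> (\<exists>E\<in>{..<min_spectrum V0}. dislocation_eigenvalue V0 t E)) \<and>
        (\<forall>t\<in>{d/2<..<d}. \<exists>!E. E \<in> {..<min_spectrum V0} \<and> dislocation_eigenvalue V0 t E)) \<and>
     (strict_antimono_on {0..d/2} V0 \<longrightarrow>
        (\<forall>t\<in>{0<..<d/2}. \<exists>!E. E \<in> {..<min_spectrum V0} \<and> dislocation_eigenvalue V0 t E) \<and>
        (\<forall>t\<in>{d/2..d}. \<not> (\<exists>E\<in>{..<min_spectrum V0}. dislocation_eigenvalue V0 t E)))"
proof -
  interpret periodic_potential V0 d using assms by unfold_locales auto
  obtain E0 where E0: "\<And>x. x \<in> {0..d/2} \<Longrightarrow> C E0 x > 0" "C' E0 (d/2) = 0" using ground_state_exists by blast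
  interpret ground_state V0 d E0 using E0 by unfold_locales
  show ?thesis
  proof (intro conjI impI ballI)
    fix t assume mono: "strict_mono_on {0..d/2} V0" and t: "t \<in> {0..d/2}"
    have "p' t \<le> 0"
      using t p'_sign_mono[OF mono, of t] p'_at_symmetry_points by (cases "t = 0 \<or> t = d/2") auto
    then show "\<not> (\<exists>E\<in>{..<min_spectrum V0}. dislocation_eigenvalue V0 t E)" by (rule no_eigenvalue_below)
  next
    fix t assume mono: "strict_mono_on {0..d/2} V0" and t: "t \<in> {d/2<..<d}"
    have "p' t > 0" using t p'_sign_mono[OF mono, of "d - t"] p_symmetric(2)[of t] by auto
    then show "\<exists>!E. E \<in> {..<min_spectrum V0} \<and> dislocation_eigenvalue V0 t E" by (rule unique_eigenvalue_below)
  next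
    fix t assume anti: "strict_antimono_on {0..d/2} V0" and t: "t \<in> {0<..<d/2}"
    have "p' t > 0" using t p'_sign_antimono[OF anti, of t] by auto
    then show "\<exists>!E. E \<in> {..<min_spectrum V0} \<and> dislocation_eigenvalue V0 t E" by (rule unique_eigenvalue_below)
  next
    fix t assume anti: "strict_antimono_on {0..d/2} V0" and t: "t \<in> {d/2..d}"
    have "p' t \<le> 0"
      using t p'_sign_antimono[OF anti, of "d - t"] p_symmetric(2)[of t] p'_at_symmetry_points
      by (cases "t = d \<or> t = d/2") auto
    then show "\<not> (\<exists>E\<in>{..<min_spectrum V0}. dislocation_eigenvalue V0 t E)" by (rule no_eigenvalue_below)
  qed
qed

end
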